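(* For any realization $x_1,\dots,x_n$ of $X_1,\dots,X_n$, any integer $m\ge1$, any $0<a<1$ and any $0\le\varepsilon\le1$, $$\mathbb P\Big(\frac1{1+a}\hat L_m\big((\hat g_1^n)_{\tilde k}\big)-\mathbb L\big((\hat g_1^n)_{\tilde k}\big)>\varepsilon\Big)\le N\Big(1+2\exp\Big(\frac{\ln2}{t_{mix}}\Big)\Big)\exp\Bigg(-\frac{a(1+a)m\varepsilon}{4t_{mix}\big(8(1+\frac1{\gamma_{ps}})+20\big)}\Bigg)$$ and $$\mathbb P\Big(\mathbb L\big((\hat g_1^n)_{\hat k}\big)-\frac1{1-a}\hat L_m\big((\hat g_1^n)_{\hat k}\big)>\varepsilon\Big)\le N\Big(1+2\exp\Big(\frac{\ln2}{t_{mix}}\Big)\Big)\exp\Bigg(-\frac{a(1-a)m\varepsilon}{4t_{mix}\big(8(1+\frac1{\gamma_{ps}})+20\big)}\Bigg).$$ Moreover, $$\mathbb E\Big(\frac1{1+a}\hat L_m\big((\hat g_1^n)_{\tilde k}\big)-\mathbb L\big((\hat g_1^n)_{\tilde k}\big)\Big)\le\frac{4t_{mix}\big(8(1+\frac1{\gamma_{ps}})+20\big)\ln\big(eN\big(2\exp(\frac{\ln2}{t_{mix}})+1\big)\big)}{a(1+a)m}$$ and $$\mathbb E\Big(\mathbb L\big((\hat g_1^n)_{\hat k}\big)-\frac1{1-a}\hat L_m\big((\hat g_1^n)_{\hat k}\big)\Big)\le\frac{4t_{mix}\big(8(1+\frac1{\gamma_{ps}})+20\big)\ln\big(eN\big(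2\exp(\frac{\ln2}{t_{mix}})+1\big)\big)}{a(1-a)m}.$$
   Context: Process. Let $\mathcal Y$ be a Polish space and $(Y_t)_{t\in\mathbb Z}$ a $\mathcal Y$-valued Markov chain of order $k_0$ that is time homogeneous, stationary and uniformly ergodic. Fix an integer $p\ge k_0$ and put $X_t=(Y_t,Y_{t-1},\dots,Y_{t-p})^T$, with values in $\mathcal X=\mathcal Y^{p+1}$. Then $(X_t)_{t\in\mathbb Z}$ is a time homogeneous, stationary, uniformly ergodic Markov chain of order $1$; $K$ denotes its transition kernel and $Q$ its stationary law. With $d_{TV}(P,P')=\sup_A|P(A)-P'(A)|$, uniform ergodicity means that there are $C>0$ and $0<\rho<1$ with $\sup_{x\in\mathcal X}d_{TV}(K^n(x,\cdot),Q)\le C\rho^n$ for all $n$. The mixing time is $t_{mix}=\min\{t\ge 1:\ \sup_{x\in\mathcal X}d_{TV}(K^t(x,\cdot),Q)\le 1/4\}$. Pseudo spectral gap. View Markov kernels with invariant law $Q$ as bounded operators on $L^2(Q)$; $K^*$ is the adjoint of $K$ on $L^2(Q)$ (the time reversal of $K$). For a self-adjoint Markov operator $M$ on $L^2(Q)$ let $S_2(M)=\{\lambda\in\mathbb C\setminus\{0\}: (\lambda I-M)^{-1}$ does not exist as a bounded linear operator on $L^2(Q)\}$; its spectral gap is $\gamma(M)=1-\sup\{\lambda\in S_2(M):\lambda\ne1\}$ (with $\sup\emptyset=0$) if the eigenvalue $1$ has multiplicity one, and $\gamma(M)=0$ otherwise. The pseudo spectral gap is $\gamma_{ps}=\max_{k\ge1}\gamma((K^*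 )^kK^k)/k$. Losses. A prediction function is a measurable $g:\mathcal Y^p\to\mathcal Y$; $\mathcal F$ is the set of all of them. A loss function is a measurable $L:\mathcal Y^2\to[0,1]$; write $L(g(X_t)):=L(g(Y_{t-1},\dots,Y_{t-p}),Y_t)$. The expected loss is $\mathbb L(g)=\mathbb E_Q(L(g(X)))$ with $X\sim Q$. The out-of-sample empirical loss on the validation set $(X_{n+1},\dots,X_{n+m})$ is $\hat L_m(g)=\frac1m\sum_{j=n+1}^{n+m}L(g(X_j))$. Estimators and selection. Let $\tilde L$ be a loss function (possibly different from $L$), $N$ a positive integer and $\mathcal G_1,\dots,\mathcal G_N\subset\mathcal F$. For a realization $x_1,\dots,x_n$ of the learning set $X_1,\dots,X_n$, $(\hat g_1^n)_k\in\arg\min_{g\in\mathcal G_k}\sum_{t=1}^n\tilde L(g(x_t))$, $k=1,\dots,N$. Put $\tilde k\in\arg\min_{1\le k\le N}\mathbb L((\hat g_1^n)_k)$ and $\hat k\in\arg\min_{1\le k\le N}\hat L_m((\hat g_1^n)_k)$ ($\hat k$ depends on the validation set and is random). $\mathbb P$ and $\mathbb E$ are taken conditionally on $X_1=x_1,\dots,X_n=x_n$; thus the functions $(\hat g_1^n)_k$ are fixed, and $(X_{n+j})_{j\ge1}$ is the chain with kernel $K$ started from $X_n=x_n$. *)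

theory Defs
  imports "HOL-Probability.Probability"
begin

section \<open>Markov kernels\<close>

definition tv_dist :: "'a measure \<Rightarrow> 'a measure \<Rightarrow> real" where
  "tv_dist P P' = (SUP A\<in>sets P. \<bar>measure P A - measure P' A\<bar>)"

primrec kernel_power :: "'a measure \<Rightarrow> ('a \<Rightarrow> 'a measure) \<Rightarrow> nat \<Rightarrow> 'a \<Rightarrow> 'a measure" where
  "kernel_power S K 0 x = return S x"
| "kernel_power S K (Suc n) x = K x \<bind> kernel_power S K n"

definition worst_tv :: "'a measure \<Rightarrow> ('a \<Rightarrow> 'a measure) \<Rightarrow> 'a measure \<Rightarrow> nat \<Rightarrow> real" where
  "worst_tv S K Q n = (SUP x\<in>space S. tv_dist (kernel_power S K n x) Q)"

definition uniformly_ergodic :: "'a measure \<Rightarrow> ('a \<Rightarrow> 'a measure) \<Rightarrow> 'a measure \<Rightarrow> bool" where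
  "uniformly_ergodic S K Q \<longleftrightarrow>
     (\<exists>C>0. \<exists>\<rho>. 0 < \<rho> \<and> \<rho> < 1 \<and> (\<forall>n. worst_tv S K Q n \<le> C * \<rho> ^ n))"

definition mixing_time :: "'a measure \<Rightarrow> ('a \<Rightarrow> 'a measure) \<Rightarrow> 'a measure \<Rightarrow> nat" where
  "mixing_time S K Q = (LEAST t. t \<ge> 1 \<and> worst_tv S K Q t \<le> 1 / 4)"

text \<open>
  The law on \<open>nat \<Rightarrow> 'a\<close> of the chain with transition kernel \<open>K\<close> started at the point \<open>x\<close>
  (at time \<open>0\<close>), obtained from the Ionescu-Tulcea construction of the library.
\<close>

definition chain_law :: "'a measure \<Rightarrow> ('a \<Rightarrow> 'a measure) \<Rightarrow> 'a \<Rightarrow> (nat \<Rightarrow> 'a) measure" where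
  "chain_law S K x =
     (let step = (\<lambda>i \<omega>. if i = 0 then return S x else K (\<omega> (i - 1)))
      in projective_family.lim UNIV (Ionescu_Tulcea.CI step (\<lambda>_. S)) (\<lambda>_. S))"

text \<open>
  The law of \<open>(X\<^bsub>n+1\<^esub>, \<dots>, X\<^bsub>n+m\<^esub>)\<close> when \<open>(X\<^bsub>n+j\<^esub>)\<^bsub>j\<ge>0\<^esub>\<close> is the chain with kernel \<open>K\<close> started from
  \<open>X\<^sub>n = x\<close>.
\<close>

definition validation_law ::
    "'a measure \<Rightarrow> ('a \<Rightarrow> 'a measure) \<Rightarrow> nat \<Rightarrow> nat \<Rightarrow> 'a \<Rightarrow> (nat \<Rightarrow> 'a) measure" where
  "validation_law S K n m x =
     distr (chain_law S K x) (PiM {n+1..n+m} (\<lambda>_. S)) (\<lambda>\<omega>. \<lambda>j\<in>{n+1..n+m}. \<omega> (j - n))"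


section \<open>Operators on the complex Hilbert space of square integrable functions\<close>

text \<open>
  Elements of the \<open>L\<^sup>2\<close> space are represented by square integrable functions, and equality in the
  \<open>L\<^sup>2\<close> space is equality almost everywhere; accordingly, all equations between (images of)
  functions below are required almost everywhere only. A linear map that is bounded in the sense
  of \<open>L2_operator\<close> respects this equality, hence is an operator on the quotient.
\<close>

definition L2_space :: "'a measure \<Rightarrow> ('a \<Rightarrow> complex) set" where
  "L2_space Q = {f \<in> borel_measurable Q. integrable Q (\<lambda>x. (cmod (f x))\<^sup>2)}"

definition L2_norm :: "'a measure \<Rightarrow> ('a \<Rightarrow> complex) \<Rightarrow> real" where
  "L2_norm Q f = sqrt (\<integral>x. (cmod (f x))\<^sup>2 \<partial>Q)"

definition L2_inner :: "'a measure \<Rightarrow> ('a \<Rightarrow> complex) \<Rightarrow> ('a \<Rightarrow> complex) \<Rightarrow> complex" where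
  "L2_inner Q f g = (\<integral>x. f x * cnj (g x) \<partial>Q)"

definition L2_operator ::
    "'a measure \<Rightarrow> (('a \<Rightarrow> complex) \<Rightarrow> ('a \<Rightarrow> complex)) \<Rightarrow> bool" where
  "L2_operator Q T \<longleftrightarrow>
     (\<forall>f\<in>L2_space Q. T f \<in> L2_space Q) \<and>
     (\<forall>f\<in>L2_space Q. \<forall>g\<in>L2_space Q. AE x in Q. T (\<lambda>x. f x + g x) x = T f x + T g x) \<and>
     (\<forall>f\<in>L2_space Q. \<forall>c. AE x in Q. T (\<lambda>x. c * f x) x = c * T f x) \<and>
     (\<exists>B. \<forall>f\<in>L2_space Q. L2_norm Q (T f) \<le> B * L2_norm Q f)"

text \<open>The adjoint is determined up to equality almost everywhere.\<close>

definition L2_adjoint ::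
    "'a measure \<Rightarrow> (('a \<Rightarrow> complex) \<Rightarrow> ('a \<Rightarrow> complex)) \<Rightarrow> (('a \<Rightarrow> complex) \<Rightarrow> ('a \<Rightarrow> complex))" where
  "L2_adjoint Q T = (SOME T'. L2_operator Q T' \<and>
     (\<forall>f\<in>L2_space Q. \<forall>g\<in>L2_space Q. L2_inner Q (T f) g = L2_inner Q f (T' g)))"

definition kernel_operator ::
    "('a \<Rightarrow> 'a measure) \<Rightarrow> ('a \<Rightarrow> complex) \<Rightarrow> ('a \<Rightarrow> complex)" where
  "kernel_operator K f = (\<lambda>x. \<integral>y. f y \<partial>(K x))"

definition S\<^sub>2 :: "'a measure \<Rightarrow> (('a \<Rightarrow> complex) \<Rightarrow> ('a \<Rightarrow> complex)) \<Rightarrow> complex set" where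
  "S\<^sub>2 Q T = {z. z \<noteq> 0 \<and>
     \<not> (\<exists>R. L2_operator Q R \<and>
          (\<forall>f\<in>L2_space Q.
             (AE x in Q. R (\<lambda>x. z * f x - T f x) x = f x) \<and>
             (AE x in Q. z * R f x - T (R f) x = f x)))}"

definition simple_eigenvalue_one ::
    "'a measure \<Rightarrow> (('a \<Rightarrow> complex) \<Rightarrow> ('a \<Rightarrow> complex)) \<Rightarrow> bool" where
  "simple_eigenvalue_one Q T \<longleftrightarrow>
     (\<exists>f\<in>L2_space Q. \<not> (AE x in Q. f x = 0) \<and> (AE x in Q. T f x = f x) \<and>
        (\<forall>g\<in>L2_space Q. (AE x in Q. T g x = g x) \<longrightarrow> (\<exists>c. AE x in Q. g x = c * f x)))"

text \<open>
  Only used for self-adjoint \<open>T\<close>, for which \<open>S\<^sub>2 Q T\<close> consists of real numbers. The case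
  distinction implements the convention that the supremum of the empty set is \<open>0\<close>.
\<close>

definition spectral_gap ::
    "'a measure \<Rightarrow> (('a \<Rightarrow> complex) \<Rightarrow> ('a \<Rightarrow> complex)) \<Rightarrow> real" where
  "spectral_gap Q T =
     (if simple_eigenvalue_one Q T
      then 1 - (let \<Lambda> = {r::real. complex_of_real r \<in> S\<^sub>2 Q T \<and> r \<noteq> 1}
                in if \<Lambda> = {} then 0 else Sup \<Lambda>)
      else 0)"

definition pseudo_spectral_gap :: "('a \<Rightarrow> 'a measure) \<Rightarrow> 'a measure \<Rightarrow> real" where
  "pseudo_spectral_gap K Q =
     (let T = kernel_operator K
      in GREATEST r. \<exists>k\<ge>1. r = spectral_gap Q ((L2_adjoint Q T ^^ k) \<circ> (T ^^ k)) / real k)"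


section \<open>Chains of higher order and their windows\<close>

text \<open>
  A vector \<open>(y\<^bsub>t\<^esub>, y\<^bsub>t-1\<^esub>, \<dots>, y\<^bsub>t-p\<^esub>)\<close> is represented by a function on \<open>{0..p}\<close> whose value at \<open>i\<close> is
  the entry of lag \<open>i\<close>; a vector \<open>(y\<^bsub>t-1\<^esub>, \<dots>, y\<^bsub>t-k\<^esub>)\<close> of strictly past values is represented in
  the same way by a function on \<open>{1..k}\<close>.
\<close>

abbreviation state_space :: "nat \<Rightarrow> (nat \<Rightarrow> 'y::topological_space) measure" where
  "state_space p \<equiv> PiM {0..p} (\<lambda>_. borel)"

abbreviation past_space :: "nat \<Rightarrow> (nat \<Rightarrow> 'y::topological_space) measure" where
  "past_space k \<equiv> PiM {1..k} (\<lambda>_. borel)"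

definition window :: "nat \<Rightarrow> (int \<Rightarrow> 'y) \<Rightarrow> int \<Rightarrow> (nat \<Rightarrow> 'y)" where
  "window p y t = (\<lambda>i\<in>{0..p}. y (t - int i))"

definition past :: "nat \<Rightarrow> (int \<Rightarrow> 'y) \<Rightarrow> int \<Rightarrow> (nat \<Rightarrow> 'y)" where
  "past k y t = (\<lambda>i\<in>{1..k}. y (t - int i))"

definition past_algebra ::
    "'w measure \<Rightarrow> (int \<Rightarrow> 'w \<Rightarrow> 'y::topological_space) \<Rightarrow> int \<Rightarrow> 'w measure" where
  "past_algebra M Y t =
     vimage_algebra (space M) (\<lambda>\<omega>. \<lambda>s\<in>{..<t}. Y s \<omega>) (PiM {..<t} (\<lambda>_. borel))"

text \<open>
  \<open>Y\<close> is a time homogeneous Markov chain of order \<open>k\<close>: the conditional law of \<open>Y\<^sub>t\<close> given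
  the whole past is \<open>\<kappa>(Y\<^bsub>t-1\<^esub>, \<dots>, Y\<^bsub>t-k\<^esub>)\<close> with a kernel \<open>\<kappa>\<close> that does not depend on \<open>t\<close>.
\<close>

definition homogeneous_markov_chain ::
    "'w measure \<Rightarrow> (int \<Rightarrow> 'w \<Rightarrow> 'y::topological_space) \<Rightarrow> nat \<Rightarrow>
     ((nat \<Rightarrow> 'y) \<Rightarrow> 'y measure) \<Rightarrow> bool" where
  "homogeneous_markov_chain M Y k \<kappa> \<longleftrightarrow>
     prob_space M \<and>
     (\<forall>t. Y t \<in> borel_measurable M) \<and>
     \<kappa> \<in> past_space k \<rightarrow>\<^sub>M prob_algebra borel \<and>
     (\<forall>t. \<forall>A\<in>sets borel. AE \<omega> in M.
        real_cond_exp M (past_algebra M Y t) (\<lambda>\<omega>. indicator A (Y t \<omega>)) \<omega>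
          = measure (\<kappa> (past k (\<lambda>s. Y s \<omega>) t)) A)"

definition stationary_process ::
    "'w measure \<Rightarrow> (int \<Rightarrow> 'w \<Rightarrow> 'y::topological_space) \<Rightarrow> bool" where
  "stationary_process M Y \<longleftrightarrow>
     (\<forall>h. distr M (PiM UNIV (\<lambda>_. borel)) (\<lambda>\<omega> t. Y (t + h) \<omega>)
        = distr M (PiM UNIV (\<lambda>_. borel)) (\<lambda>\<omega> t. Y t \<omega>))"

text \<open>
  The transition kernel of \<open>X\<^sub>t = (Y\<^sub>t, \<dots>, Y\<^bsub>t-p\<^esub>)\<close> for \<open>p \<ge> k\<close>: the window is shifted by one step, and
  the new entry is drawn according to the \<open>k\<close> most recent old ones.
\<close>

definition window_kernel ::
    "nat \<Rightarrow> nat \<Rightarrow> ((nat \<Rightarrow> 'y) \<Rightarrow> 'y measure) \<Rightarrow> (nat \<Rightarrow> 'y::topological_space) \<Rightarrow>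
     (nat \<Rightarrow> 'y) measure" where
  "window_kernel p k \<kappa> x =
     distr (\<kappa> (\<lambda>i\<in>{1..k}. x (i - 1))) (state_space p)
       (\<lambda>z. \<lambda>i\<in>{0..p}. if i = 0 then z else x (i - 1))"

text \<open>By stationarity, the law of \<open>X\<^sub>t\<close> is that of \<open>X\<^sub>0\<close> for every \<open>t\<close>.\<close>

definition window_law ::
    "nat \<Rightarrow> 'w measure \<Rightarrow> (int \<Rightarrow> 'w \<Rightarrow> 'y::topological_space) \<Rightarrow> (nat \<Rightarrow> 'y) measure" where
  "window_law p M Y = distr M (state_space p) (\<lambda>\<omega>. window p (\<lambda>s. Y s \<omega>) 0)"


section \<open>Prediction functions and losses\<close>

definition prediction_functions :: "nat \<Rightarrow> ((nat \<Rightarrow> 'y::topological_space) \<Rightarrow> 'y) set" where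
  "prediction_functions p = past_space p \<rightarrow>\<^sub>M borel"

definition loss_function :: "('y::topological_space \<times> 'y \<Rightarrow> real) \<Rightarrow> bool" where
  "loss_function L \<longleftrightarrow> L \<in> borel_measurable (borel \<Otimes>\<^sub>M borel) \<and> range L \<subseteq> {0..1}"

text \<open>\<open>loss p L g x\<close> is the quantity written \<open>L(g(x))\<close> for a window \<open>x\<close>.\<close>

definition loss ::
    "nat \<Rightarrow> ('y \<times> 'y \<Rightarrow> real) \<Rightarrow> ((nat \<Rightarrow> 'y) \<Rightarrow> 'y) \<Rightarrow> (nat \<Rightarrow> 'y) \<Rightarrow> real" where
  "loss p L g x = L (g (restrict x {1..p}), x 0)"

definition expected_loss ::
    "nat \<Rightarrow> ('y \<times> 'y \<Rightarrow> real) \<Rightarrow> (nat \<Rightarrow> 'y) measure \<Rightarrow> ((nat \<Rightarrow> 'y) \<Rightarrow> 'y) \<Rightarrow> real" where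
  "expected_loss p L Q g = (\<integral>x. loss p L g x \<partial>Q)"

definition empirical_loss ::
    "nat \<Rightarrow> ('y \<times> 'y \<Rightarrow> real) \<Rightarrow> nat \<Rightarrow> nat \<Rightarrow> (nat \<Rightarrow> (nat \<Rightarrow> 'y)) \<Rightarrow>
     ((nat \<Rightarrow> 'y) \<Rightarrow> 'y) \<Rightarrow> real" where
  "empirical_loss p L n m v g = (1 / real m) * (\<Sum>j=n+1..n+m. loss p L g (v j))"

end

theory Submission
  imports Defs
begin

text \<open>
  For a loss \<open>f\<close> with values in \<open>[0, 1]\<close> and mean \<open>\<mu>\<close>, uniform ergodicity halves the oscillation of \<open>K\<^sup>j f\<close>
  every \<open>t\<^sub>m\<^sub>i\<^sub>x\<close> steps, so the functions \<open>h\<^sub>r = (\<Sum>j<r. K\<^sup>j f - \<mu>)\<close> are bounded by \<open>2 t\<^sub>m\<^sub>i\<^sub>x\<close> and satisfy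
  \<open>K h\<^sub>r = h\<^bsub>r+1\<^esub> - (f - \<mu>)\<close>. With \<open>V\<^sub>r = 1 + \<theta> h\<^sub>r\<close> and \<open>\<theta> = a / ((2 + a) 2 t\<^sub>m\<^sub>i\<^sub>x)\<close> this gives
  \<open>exp (\<lambda> (f - (1 + a) \<mu>)) K V\<^sub>r \<le> V\<^bsub>r+1\<^esub>\<close> for \<open>\<lambda> = a / (4 t\<^sub>m\<^sub>i\<^sub>x (1 + a))\<close>: the relative slack \<open>a\<close> absorbs the
  fluctuation of \<open>V\<^sub>r\<close> around \<open>1\<close>. Hence \<open>exp (\<lambda> (\<Sum>j. f (X\<^sub>j) - (1 + a) \<mu>))\<close> has expectation at most \<open>2\<close> from every
  starting point, and symmetrically for the lower deviation with \<open>1 - a\<close>. The resulting exponent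
  \<open>a m \<epsilon> / (4 t\<^sub>m\<^sub>i\<^sub>x)\<close> is better than the claimed one as soon as the pseudo spectral gap is nonnegative, which
  holds because the adjoint of \<open>K\<close> exists and all operators involved are contractions, whose spectrum
  lies in the unit disc.
\<close>

section \<open>Mixing and the Poisson equation\<close>

text \<open>The validation chain starts at a fixed point, so the exponential bound must be uniform
  in the starting state. Indexing the Poisson sums by the number r of observations still to come
  achieves this with one backward recursion: \<open>poisson f 0 = 0\<close> fixes the terminal value
  1, and a sup bound on the sums controls the initial value.

  The sign of the pseudo spectral gap is a genuine obligation: \<open>L2_adjoint\<close> and
  \<open>pseudo_spectral_gap\<close> are given by \<open>SOME\<close> and \<open>GREATEST\<close>,
  which carry no information until a witness and a maximum are known to exist. A gap equal to 0 does
  no harm: then \<open>1 / \<gamma>ps\<close> is 0 and the bracket in the rate equals 28.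

  The oracle index and the random index are both treated as arbitrary pointwise selections among N
  candidates; summing over the candidates produces the factor N.\<close>

lemma abs_integral_diff_le_tv_dist:
  fixes f :: "'a \<Rightarrow> real"
  assumes P: "P \<in> space (prob_algebra S)" and P': "P' \<in> space (prob_algebra S)"
    and f[measurable]: "f \<in> borel_measurable S"
    and f01: "\<And>x. x \<in> space S \<Longrightarrow> 0 \<le> f x \<and> f x \<le> 1"
  shows "\<bar>(\<integral>x. f x \<partial>P) - (\<integral>x. f x \<partial>P')\<bar> \<le> tv_dist P P'"
proof -
  have sets[measurable_cong, simp]: "sets P = sets S" "sets P' = sets S"
    and prob: "prob_space P" "prob_space P'"
    using P P' by (auto simp: space_prob_algebra)
  have space[simp]: "space P = space S" "space P' = space S"
    using sets(1,2)[THEN sets_eq_imp_space_eq] by auto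
  interpret P: prob_space P by fact
  interpret P': prob_space P' by fact
  have bdd: "bdd_above ((\<lambda>A. \<bar>measure P A - measure P' A\<bar>) ` sets P)"
  proof (rule bdd_aboveI2)
    fix A
    show "\<bar>measure P A - measure P' A\<bar> \<le> 1"
      using P.prob_le_1[of A] P'.prob_le_1[of A] measure_nonneg[of P A] measure_nonneg[of P' A]
      by linarith
  qed
  have tv: "\<bar>measure P A - measure P' A\<bar> \<le> tv_dist P P'" if "A \<in> sets S" for A
    unfolding tv_dist_def using that bdd by (intro cSUP_upper) auto
  have approx: "\<bar>(\<integral>x. f x \<partial>P) - (\<integral>x. f x \<partial>P')\<bar> \<le> tv_dist P P' + 2 / real n" if n: "n > 0" for n :: nat
  proof -
    \<comment> \<open>Layer-cake approximation: the level sets add up to floor(n f) / n, which is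
      within 1/n of f, and each set costs at most one total variation distance, averaged with weight
      1/n.\<close>
    define A where "A i = {x \<in> space S. real i \<le> real n * f x}" for i :: nat
    define g where "g x = (\<Sum>i=1..n. indicator (A i) x) / real n" for x
    have A[measurable]: "A i \<in> sets S" for i
      unfolding A_def by measurable
    have gf: "\<bar>f x - g x\<bar> \<le> 1 / real n" if x: "x \<in> space S" for x
    proof -
      have nf: "0 \<le> real n * f x" "real n * f x \<le> real n"
        using f01[OF x] n by (auto intro: mult_left_le)
      have "(\<Sum>i=1..n. indicator (A i) x) = (\<Sum>i=1..n. if i \<le> nat \<lfloor>real n * f x\<rfloor> then 1 else 0 :: real)"
        using x nf by (intro sum.cong) (auto simp: A_def indicator_def le_nat_iff le_floor_iff)
      also have "\<dots> = real (card {i \<in> {1..n}. i \<le> nat \<lfloor>real n * f x\<rfloor>})"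
        by (simp add: sum.If_cases Int_def)
      also have "{i \<in> {1..n}. i \<le> nat \<lfloor>real n * f x\<rfloor>} = {1..nat \<lfloor>real n * f x\<rfloor>}"
        using nf by (auto simp: le_nat_iff le_floor_iff)
      finally have "g x = of_int \<lfloor>real n * f x\<rfloor> / real n"
        using nf by (simp add: g_def)
      moreover have "\<bar>real n * f x - of_int \<lfloor>real n * f x\<rfloor>\<bar> \<le> 1"
        by linarith
      moreover have "f x - of_int \<lfloor>real n * f x\<rfloor> / real n = (real n * f x - of_int \<lfloor>real n * f x\<rfloor>) / real n"
        using n by (simp add: field_simps)
      ultimately show ?thesis
        using n by (simp add: divide_right_mono)
    qed
    have int_close: "\<bar>(\<integral>x. f x \<partial>R) - (\<Sum>i=1..n. measure R (A i)) / real n\<bar> \<le> 1 / real n"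
      if R: "prob_space R" "sets R = sets S" for R
    proof -
      interpret R: prob_space R by fact
      note R(2)[measurable_cong]
      have sp: "space R = space S" using R(2) by (rule sets_eq_imp_space_eq)
      have intf: "integrable R f"
        using f01 by (intro R.integrable_const_bound[where B=1]) (auto simp: sp)
      have intA: "integrable R (indicator (A i) :: 'a \<Rightarrow> real)" for i
        by (intro R.integrable_const_bound[where B=1]) auto
      have intg: "integrable R g"
        unfolding g_def using intA by auto
      have "(\<integral>x. g x \<partial>R) = (\<Sum>i=1..n. measure R (A i)) / real n"
        unfolding g_def using intA by (simp add: R(2))
      then have "\<bar>(\<integral>x. f x \<partial>R) - (\<Sum>i=1..n. measure R (A i)) / real n\<bar> = \<bar>\<integral>x. f x - g x \<partial>R\<bar>"
        using intf intg by simp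
      also have "\<dots> \<le> (\<integral>x. \<bar>f x - g x\<bar> \<partial>R)"
        by simp
      also have "\<dots> \<le> (\<integral>x. 1 / real n \<partial>R)"
        using intf intg gf by (intro integral_mono) (auto simp: sp)
      also have "\<dots> = 1 / real n"
        by (simp add: R.prob_space)
      finally show ?thesis .
    qed
    have "\<bar>(\<Sum>i=1..n. measure P (A i)) / real n - (\<Sum>i=1..n. measure P' (A i)) / real n\<bar>
        = \<bar>\<Sum>i=1..n. measure P (A i) - measure P' (A i)\<bar> / real n"
      by (simp add: sum_subtractf flip: diff_divide_distrib)
    also have "\<dots> \<le> (\<Sum>i=1..n. tv_dist P P') / real n"
      by (intro divide_right_mono order_trans[OF sum_abs] sum_mono tv) auto
    also have "\<dots> = tv_dist P P'"
      using n by simp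
    finally show ?thesis
      using int_close[OF prob(1) sets(1)] int_close[OF prob(2) sets(2)] by (simp add: abs_if split: if_splits)
  qed
  have "(\<lambda>n. tv_dist P P' + 2 / real n) \<longlonglongrightarrow> tv_dist P P' + 0"
    by (intro tendsto_intros lim_const_over_n)
  then show ?thesis
    by (intro LIMSEQ_le_const[where X="\<lambda>n. tv_dist P P' + 2 / real n"])
       (auto intro!: exI[of _ 1] approx)
qed

lemma tv_dist_le_1:
  assumes "prob_space P" "prob_space P'"
  shows "tv_dist P P' \<le> 1"
  unfolding tv_dist_def
proof (rule cSUP_least)
  fix A
  show "\<bar>measure P A - measure P' A\<bar> \<le> 1"
    using prob_space.prob_le_1[OF assms(1), of A] prob_space.prob_le_1[OF assms(2), of A]
      measure_nonneg[of P A] measure_nonneg[of P' A]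
    by linarith
qed (auto intro: sets.empty_sets)

text \<open>Both laws have mass 1, so the infimum of f can be subtracted and the rest divided by w.
  The constant 1 in front of the distance is what turns the threshold 1/4 of the mixing time into a
  contraction by 1/2.\<close>

lemma abs_integral_diff_le_tv_dist_osc:
  fixes f :: "'a \<Rightarrow> real"
  assumes P: "P \<in> space (prob_algebra S)" and P': "P' \<in> space (prob_algebra S)"
    and f[measurable]: "f \<in> borel_measurable S" and w: "w > 0"
    and osc: "\<And>x y. x \<in> space S \<Longrightarrow> y \<in> space S \<Longrightarrow> \<bar>f x - f y\<bar> \<le> w"
  shows "\<bar>(\<integral>x. f x \<partial>P) - (\<integral>x. f x \<partial>P')\<bar> \<le> w * tv_dist P P'"
proof -
  have sets[measurable_cong, simp]: "sets P = sets S" "sets P' = sets S"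
    and prob: "prob_space P" "prob_space P'"
    using P P' by (auto simp: space_prob_algebra)
  have space[simp]: "space P = space S" "space P' = space S"
    using sets(1,2)[THEN sets_eq_imp_space_eq] by auto
  interpret P: prob_space P by fact
  interpret P': prob_space P' by fact
  obtain x0 where x0: "x0 \<in> space S"
    using P.not_empty by auto
  define c where "c = (INF x\<in>space S. f x)"
  have bdd: "bdd_below (f ` space S)"
  proof (rule bdd_belowI2)
    show "f x0 - w \<le> f x" if "x \<in> space S" for x
      using osc[OF x0 that] by linarith
  qed
  have c: "c \<le> f x" "f x \<le> c + w" if x: "x \<in> space S" for x
  proof -
    show "c \<le> f x"
      unfolding c_def using bdd x by (intro cINF_lower)
    have "f x - w \<le> c"
      unfolding c_def
    proof (rule cINF_greatest)
      show "f x - w \<le> f y" if "y \<in> space S" for y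
        using osc[OF x that] by linarith
    qed (use x in auto)
    then show "f x \<le> c + w" by simp
  qed
  have bound: "norm (f x) \<le> \<bar>c\<bar> + w" if "x \<in> space S" for x
    using c[OF that] w by auto
  have int: "integrable P f" "integrable P' f"
    using bound by (auto intro!: P.integrable_const_bound[where B="\<bar>c\<bar> + w"] P'.integrable_const_bound[where B="\<bar>c\<bar> + w"])
  have "\<bar>(\<integral>x. (f x - c) / w \<partial>P) - (\<integral>x. (f x - c) / w \<partial>P')\<bar> \<le> tv_dist P P'"
    using c w by (intro abs_integral_diff_le_tv_dist[OF P P']) (auto simp: field_simps)
  moreover have "(\<integral>x. (f x - c) / w \<partial>P) - (\<integral>x. (f x - c) / w \<partial>P')
      = ((\<integral>x. f x \<partial>P) - (\<integral>x. f x \<partial>P')) / w"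
    using int P.prob_space P'.prob_space by (simp add: diff_divide_distrib)
  ultimately show ?thesis
    using w by (simp add: abs_mult field_simps)
qed

section \<open>Markov kernels acting on functions with values in [0, 1]\<close>

locale markov_kernel =
  fixes S :: "'a measure" and K :: "'a \<Rightarrow> 'a measure"
  assumes K_measurable[measurable]: "K \<in> S \<rightarrow>\<^sub>M prob_algebra S"
begin

lemma K_in_prob_algebra: "x \<in> space S \<Longrightarrow> K x \<in> space (prob_algebra S)"
  using measurable_space[OF K_measurable] .

lemma K_subprob[measurable]: "K \<in> S \<rightarrow>\<^sub>M subprob_algebra S"
  by (rule measurable_prob_algebraD) measurable

lemma prob_space_K: "x \<in> space S \<Longrightarrow> prob_space (K x)"
  and sets_K[measurable_cong]: "x \<in> space S \<Longrightarrow> sets (K x) = sets S"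
  using K_in_prob_algebra[of x] by (auto simp: space_prob_algebra)

lemma space_K: "x \<in> space S \<Longrightarrow> space (K x) = space S"
  using sets_K by (rule sets_eq_imp_space_eq)

lemma kernel_power_measurable[measurable]: "kernel_power S K n \<in> S \<rightarrow>\<^sub>M prob_algebra S"
proof (induction n)
  case 0
  have "kernel_power S K 0 = return S"
    by (rule ext) simp
  then show ?case by simp
next
  case (Suc n)
  note Suc[measurable]
  have "kernel_power S K (Suc n) = (\<lambda>x. K x \<bind> kernel_power S K n)"
    by (rule ext) simp
  then show ?case
    using measurable_bind_prob_space[OF K_measurable Suc] by simp
qed

text \<open>A class stable under the kernel in which every function is integrable for every
  probability on S, so no integrability conditions have to be carried through the iterates.\<close>

definition unit_functions :: "('a \<Rightarrow> real) set" where
  "unit_functions = {f \<in> borel_measurable S. \<forall>x\<in>space S. 0 \<le> f x \<and> f x \<le> 1}"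

lemma unit_functions_measurable: "f \<in> unit_functions \<Longrightarrow> f \<in> borel_measurable S"
  and unit_functions_nonneg: "f \<in> unit_functions \<Longrightarrow> x \<in> space S \<Longrightarrow> 0 \<le> f x"
  and unit_functions_le_1: "f \<in> unit_functions \<Longrightarrow> x \<in> space S \<Longrightarrow> f x \<le> 1"
  by (auto simp: unit_functions_def)

lemma integrable_unit:
  assumes "f \<in> unit_functions" "R \<in> space (prob_algebra S)"
  shows "integrable R f"
proof -
  have R: "prob_space R" and s[measurable_cong]: "sets R = sets S"
    using assms(2) by (auto simp: space_prob_algebra)
  interpret prob_space R by fact
  have "space R = space S" using s by (rule sets_eq_imp_space_eq)
  then show ?thesis
    using assms(1) by (intro integrable_const_bound[where B=1]) (auto simp: unit_functions_def)
qed

lemma integral_unit: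
  assumes "f \<in> unit_functions" "R \<in> space (prob_algebra S)"
  shows "0 \<le> (\<integral>x. f x \<partial>R)" "(\<integral>x. f x \<partial>R) \<le> 1"
proof -
  have R: "prob_space R" and s: "sets R = sets S"
    using assms(2) by (auto simp: space_prob_algebra)
  interpret prob_space R by fact
  have sp: "space R = space S" using s by (rule sets_eq_imp_space_eq)
  show "0 \<le> (\<integral>x. f x \<partial>R)"
    using assms(1) by (intro integral_nonneg_AE) (auto simp: sp unit_functions_def)
  have "(\<integral>x. f x \<partial>R) \<le> (\<integral>x. 1 \<partial>R)"
    using assms by (intro integral_mono integrable_unit) (auto simp: sp unit_functions_def)
  then show "(\<integral>x. f x \<partial>R) \<le> 1" by (simp add: prob_space)
qed

definition U :: "('a \<Rightarrow> real) \<Rightarrow> 'a \<Rightarrow> real" where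
  "U f x = (\<integral>y. f y \<partial>K x)"

lemma U_unit: 
  assumes "f \<in> unit_functions" shows "U f \<in> unit_functions"
proof -
  have [measurable]: "f \<in> borel_measurable S"
    using assms by (rule unit_functions_measurable)
  have "U f \<in> borel_measurable S"
    unfolding U_def
    by (rule measurable_compose[OF K_subprob integral_measurable_subprob_algebra]) measurable
  then show ?thesis
    using integral_unit[OF assms K_in_prob_algebra] by (auto simp: unit_functions_def U_def)
qed

lemma U_power_unit: "f \<in> unit_functions \<Longrightarrow> (U ^^ n) f \<in> unit_functions"
  by (induction n) (auto intro: U_unit)

lemma integral_bind_unit:
  assumes f: "f \<in> unit_functions" and R: "R \<in> space (prob_algebra S)"
    and N: "N \<in> S \<rightarrow>\<^sub>M prob_algebra S"
  shows "(\<integral>x. f x \<partial>(R \<bind> N)) = (\<integral>x. (\<integral>y. f y \<partial>N x) \<partial>R)"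
proof -
  have "prob_space R" and s[measurable_cong]: "sets R = sets S"
    using R by (auto simp: space_prob_algebra)
  interpret prob_space R by fact
  have sp: "space R = space S" using s by (rule sets_eq_imp_space_eq)
  have N': "N \<in> R \<rightarrow>\<^sub>M subprob_algebra S"
    using N measurable_cong_sets[OF s refl] by (auto intro: measurable_prob_algebraD)
  show ?thesis
  proof (rule integral_bind[where K=S and B=1 and B'=1])
    show "AE x in R. emeasure (N x) (space (N x)) \<le> ennreal 1"
    proof (rule AE_I2)
      fix x assume "x \<in> space R"
      then have "prob_space (N x)"
        using measurable_space[OF N, of x] by (simp add: sp space_prob_algebra)
      then show "emeasure (N x) (space (N x)) \<le> ennreal 1"
        by (simp add: prob_space.emeasure_space_1)
    qed
  qed (use f N' in \<open>auto simp: unit_functions_def finite_measure_axioms\<close>)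
qed

lemma integral_kernel_power:
  assumes f: "f \<in> unit_functions" and x: "x \<in> space S"
  shows "(\<integral>y. f y \<partial>kernel_power S K n x) = (U ^^ n) f x"
  using x
proof (induction n arbitrary: x)
  case 0
  then show ?case
    using unit_functions_measurable[OF f] by (simp add: integral_return)
next
  case (Suc n)
  have "(\<integral>y. f y \<partial>kernel_power S K (Suc n) x) = (\<integral>y. (\<integral>z. f z \<partial>kernel_power S K n y) \<partial>K x)"
    using integral_bind_unit[OF f K_in_prob_algebra kernel_power_measurable] Suc.prems by simp
  also have "\<dots> = (\<integral>y. (U ^^ n) f y \<partial>K x)"
    using Suc by (intro Bochner_Integration.integral_cong) (auto simp: space_K)
  finally show ?case
    using U_def[of "(U ^^ n) f" x] by simp
qed

end

section \<open>Uniform ergodicity: invariance, geometric decay, Poisson equation\<close>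

locale markov_kernel_law = markov_kernel +
  fixes Q :: "'a measure"
  assumes Q_in_prob_algebra: "Q \<in> space (prob_algebra S)"
begin

sublocale Q: prob_space Q
  using Q_in_prob_algebra by (simp add: space_prob_algebra)

lemma sets_Q[measurable_cong, simp]: "sets Q = sets S"
  using Q_in_prob_algebra by (simp add: space_prob_algebra)

lemma space_Q[simp]: "space Q = space S"
  using sets_Q by (rule sets_eq_imp_space_eq)

end

locale ergodic_kernel = markov_kernel_law +
  assumes ergodic: "uniformly_ergodic S K Q"
begin

lemma kernel_power_in_prob_algebra: "x \<in> space S \<Longrightarrow> kernel_power S K n x \<in> space (prob_algebra S)"
  using measurable_space[OF kernel_power_measurable] .

lemma tv_dist_le_worst_tv:
  assumes "x \<in> space S"
  shows "tv_dist (kernel_power S K n x) Q \<le> worst_tv S K Q n"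
  unfolding worst_tv_def
proof (rule cSUP_upper[OF assms bdd_aboveI2])
  show "tv_dist (kernel_power S K n y) Q \<le> 1" if "y \<in> space S" for y
    using kernel_power_in_prob_algebra[OF that, of n] Q.prob_space_axioms
    by (intro tv_dist_le_1) (auto simp: space_prob_algebra)
qed

lemma power_minus_mean_le:
  assumes f: "f \<in> unit_functions" and x: "x \<in> space S"
  shows "\<bar>(U ^^ n) f x - (\<integral>y. f y \<partial>Q)\<bar> \<le> worst_tv S K Q n"
proof -
  have "\<bar>(\<integral>y. f y \<partial>kernel_power S K n x) - (\<integral>y. f y \<partial>Q)\<bar> \<le> tv_dist (kernel_power S K n x) Q"
    using f by (intro abs_integral_diff_le_tv_dist[OF kernel_power_in_prob_algebra[OF x] Q_in_prob_algebra])
      (auto simp: unit_functions_def)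
  then show ?thesis
    using tv_dist_le_worst_tv[OF x, of n] integral_kernel_power[OF f x] by simp
qed

lemma worst_tv_tendsto_0: "\<exists>b. b \<longlonglongrightarrow> 0 \<and> (\<forall>n. worst_tv S K Q n \<le> b n)"
proof -
  obtain C \<rho> where "0 < \<rho>" "\<rho> < 1" and *: "\<forall>n. worst_tv S K Q n \<le> C * \<rho> ^ n"
    using ergodic by (auto simp: uniformly_ergodic_def)
  then have "(\<lambda>n. C * \<rho> ^ n) \<longlonglongrightarrow> C * 0"
    by (intro tendsto_intros LIMSEQ_power_zero) auto
  then show ?thesis
    using * by auto
qed

lemma power_tendsto_mean:
  assumes f: "f \<in> unit_functions" and x: "x \<in> space S"
  shows "(\<lambda>n. (U ^^ n) f x) \<longlonglongrightarrow> (\<integral>y. f y \<partial>Q)"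
proof -
  obtain b where b: "b \<longlonglongrightarrow> 0" "\<And>n. worst_tv S K Q n \<le> b n"
    using worst_tv_tendsto_0 by auto
  have "(\<lambda>n. (U ^^ n) f x - (\<integral>y. f y \<partial>Q)) \<longlonglongrightarrow> 0"
    using b(1) by (rule Lim_null_comparison[rotated])
      (use power_minus_mean_le[OF f x] b(2) in \<open>auto intro!: always_eventually intro: order_trans\<close>)
  then show ?thesis by (simp add: LIM_zero_iff)
qed

text \<open>\<open>LEAST\<close> says nothing until some t qualifies; a bound on
  \<open>worst_tv\<close> tending to 0 supplies one.\<close>

lemma mixing_time_ge_1: "mixing_time S K Q \<ge> 1"
  and worst_tv_mixing_time: "worst_tv S K Q (mixing_time S K Q) \<le> 1 / 4"
proof -
  obtain b where b: "b \<longlonglongrightarrow> 0" "\<And>n. worst_tv S K Q n \<le> b n"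
    using worst_tv_tendsto_0 by auto
  have "\<forall>\<^sub>F n in sequentially. b n < 1 / 4 \<and> n \<ge> 1"
    using order_tendstoD(2)[OF b(1), of "1/4"] eventually_ge_at_top[of 1] by (auto intro: eventually_conj)
  then obtain n where "b n < 1 / 4" "n \<ge> 1"
    by (auto simp: eventually_sequentially)
  then have "n \<ge> 1 \<and> worst_tv S K Q n \<le> 1 / 4"
    using b(2)[of n] by linarith
  then have "mixing_time S K Q \<ge> 1 \<and> worst_tv S K Q (mixing_time S K Q) \<le> 1 / 4"
    unfolding mixing_time_def by (rule LeastI)
  then show "mixing_time S K Q \<ge> 1" "worst_tv S K Q (mixing_time S K Q) \<le> 1 / 4"
    by auto
qed

text \<open>Uniqueness of limits: \<open>(U ^^ n) (U f) x\<close> tends to the mean of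
  \<open>U f\<close>, and, being the shifted sequence \<open>(U ^^ Suc n) f x\<close>, also to the
  mean of f.\<close>

lemma integral_U:
  assumes f: "f \<in> unit_functions"
  shows "(\<integral>x. U f x \<partial>Q) = (\<integral>x. f x \<partial>Q)"
proof -
  obtain x where x: "x \<in> space S"
    using Q.not_empty by auto
  have "(\<lambda>n. (U ^^ n) (U f) x) \<longlonglongrightarrow> (\<integral>y. f y \<partial>Q)"
    using LIMSEQ_Suc[OF power_tendsto_mean[OF f x]] by (simp add: funpow_swap1)
  then show ?thesis
    using power_tendsto_mean[OF U_unit[OF f] x] LIMSEQ_unique by blast
qed

lemma integral_U_power: "f \<in> unit_functions \<Longrightarrow> (\<integral>x. (U ^^ n) f x \<partial>Q) = (\<integral>x. f x \<partial>Q)"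
  by (induction n) (auto simp: integral_U U_power_unit)

lemma invariant: "Q \<bind> K = Q"
proof (rule measure_eqI)
  show sets: "sets (Q \<bind> K) = sets Q"
    using Q.not_empty by (subst sets_bind[where N=S]) (auto simp: sets_K)
  interpret B: prob_space "Q \<bind> K"
    using prob_space_bind'[OF Q_in_prob_algebra K_measurable] .
  fix A assume "A \<in> sets (Q \<bind> K)"
  then have A[measurable]: "A \<in> sets S" by (simp add: sets)
  have f: "indicator A \<in> unit_functions"
    by (auto simp: unit_functions_def)
  have "measure (Q \<bind> K) A = (\<integral>x. indicator A x \<partial>(Q \<bind> K))"
    using A sets by simp
  also have "\<dots> = (\<integral>x. indicator A x \<partial>Q)"
    using integral_bind_unit[OF f Q_in_prob_algebra K_measurable] integral_U[OF f] by (simp add: U_def)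
  also have "\<dots> = measure Q A" by simp
  finally show "emeasure (Q \<bind> K) A = emeasure Q A"
    by (simp add: B.emeasure_eq_measure Q.emeasure_eq_measure)
qed

abbreviation t\<^sub>m\<^sub>i\<^sub>x :: nat where "t\<^sub>m\<^sub>i\<^sub>x \<equiv> mixing_time S K Q"

text \<open>Strong induction in blocks of \<open>t\<^sub>m\<^sub>i\<^sub>x\<close> steps: one block
  moves a function of oscillation w to within w/4 of its Q-mean at every point, hence to oscillation
  at most w/2.\<close>

lemma power_oscillation:
  assumes f: "f \<in> unit_functions" and "x \<in> space S" "y \<in> space S"
  shows "\<bar>(U ^^ j) f x - (U ^^ j) f y\<bar> \<le> (1 / 2) ^ (j div t\<^sub>m\<^sub>i\<^sub>x)"
  using assms(2,3)
proof (induction j arbitrary: x y rule: less_induct)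
  case (less j)
  show ?case
  proof (cases "j < t\<^sub>m\<^sub>i\<^sub>x")
    case True
    have *: "(U ^^ j) f \<in> unit_functions" using f by (rule U_power_unit)
    show ?thesis
      using True less.prems unit_functions_nonneg[OF *] unit_functions_le_1[OF *]
      by (smt (verit) div_less power_0)
  next
    case False
    define i where "i = j - t\<^sub>m\<^sub>i\<^sub>x"
    have j: "j = t\<^sub>m\<^sub>i\<^sub>x + i" and ij: "i < j"
      using False mixing_time_ge_1 by (auto simp: i_def)
    let ?g = "(U ^^ i) f"
    have g: "?g \<in> unit_functions" using f by (rule U_power_unit)
    have mean: "\<bar>(U ^^ t\<^sub>m\<^sub>i\<^sub>x) ?g z - (\<integral>z. ?g z \<partial>Q)\<bar> \<le> (1 / 2) ^ (i div t\<^sub>m\<^sub>i\<^sub>x) / 4"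
      if z: "z \<in> space S" for z
    proof -
      have "\<bar>(\<integral>z. ?g z \<partial>kernel_power S K t\<^sub>m\<^sub>i\<^sub>x z) - (\<integral>z. ?g z \<partial>Q)\<bar>
          \<le> (1 / 2) ^ (i div t\<^sub>m\<^sub>i\<^sub>x) * tv_dist (kernel_power S K t\<^sub>m\<^sub>i\<^sub>x z) Q"
        using less.IH[OF ij] unit_functions_measurable[OF g]
        by (intro abs_integral_diff_le_tv_dist_osc[OF kernel_power_in_prob_algebra[OF z] Q_in_prob_algebra]) auto
      also have "\<dots> \<le> (1 / 2) ^ (i div t\<^sub>m\<^sub>i\<^sub>x) * (1 / 4)"
        using tv_dist_le_worst_tv[OF z, of t\<^sub>m\<^sub>i\<^sub>x] worst_tv_mixing_time by (intro mult_left_mono) auto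
      finally show ?thesis
        using integral_kernel_power[OF g z] by simp
    qed
    have "(U ^^ j) f = (U ^^ t\<^sub>m\<^sub>i\<^sub>x) ?g"
      unfolding j by (simp add: funpow_add)
    moreover have "(1 / 2 :: real) ^ (j div t\<^sub>m\<^sub>i\<^sub>x) = (1 / 2) ^ (i div t\<^sub>m\<^sub>i\<^sub>x) / 2"
      using mixing_time_ge_1 by (simp add: j)
    ultimately show ?thesis
      using mean[OF less.prems(1)] mean[OF less.prems(2)] by (simp add: abs_if split: if_splits)
  qed
qed

text \<open>By invariance the mean of f is also the mean of \<open>(U ^^ j) f\<close>, so the
  distance to it is an average of oscillations.\<close>

lemma power_minus_mean_decay:
  assumes f: "f \<in> unit_functions" and x: "x \<in> space S"
  shows "\<bar>(U ^^ j) f x - (\<integral>y. f y \<partial>Q)\<bar> \<le> (1 / 2) ^ (j div t\<^sub>m\<^sub>i\<^sub>x)"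
proof -
  have int: "integrable Q ((U ^^ j) f)"
    using integrable_unit[OF U_power_unit[OF f] Q_in_prob_algebra] .
  have "\<bar>(U ^^ j) f x - (\<integral>y. f y \<partial>Q)\<bar> = \<bar>\<integral>y. (U ^^ j) f x - (U ^^ j) f y \<partial>Q\<bar>"
    using int integral_U_power[OF f, of j] Q.prob_space by simp
  also have "\<dots> \<le> (\<integral>y. \<bar>(U ^^ j) f x - (U ^^ j) f y\<bar> \<partial>Q)"
    by simp
  also have "\<dots> \<le> (\<integral>y. (1 / 2) ^ (j div t\<^sub>m\<^sub>i\<^sub>x) \<partial>Q)"
    using int power_oscillation[OF f x] by (intro integral_mono) auto
  finally show ?thesis using Q.prob_space by simp
qed

text \<open>The solution of the Poisson equation for \<open>f\<close> truncated at the finite horizon \<open>r\<close>.\<close>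

definition poisson :: "('a \<Rightarrow> real) \<Rightarrow> nat \<Rightarrow> 'a \<Rightarrow> real" where
  "poisson f r x = (\<Sum>j<r. (U ^^ j) f x - (\<integral>y. f y \<partial>Q))"

lemma abs_poisson_le:
  assumes f: "f \<in> unit_functions" and x: "x \<in> space S"
  shows "\<bar>poisson f r x\<bar> \<le> 2 * real t\<^sub>m\<^sub>i\<^sub>x"
proof -
  let ?b = "\<lambda>j. (1 / 2 :: real) ^ (j div t\<^sub>m\<^sub>i\<^sub>x)"
  have t: "t\<^sub>m\<^sub>i\<^sub>x > 0" using mixing_time_ge_1 by linarith
  have "\<bar>poisson f r x\<bar> \<le> (\<Sum>j<r. ?b j)"
    unfolding poisson_def
    by (intro order_trans[OF sum_abs] sum_mono power_minus_mean_decay[OF f x])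
  \<comment> \<open>Enlarging the range to r full blocks of \<open>t\<^sub>m\<^sub>i\<^sub>x\<close>
    terms makes the exponent constant on each block, and a geometric series with sum at most 2
    remains.\<close>
  also have "\<dots> \<le> (\<Sum>j<r * t\<^sub>m\<^sub>i\<^sub>x. ?b j)"
    using t by (intro sum_mono2) (auto intro: less_le_trans)
  also have "\<dots> = (\<Sum>i<r. \<Sum>j\<in>{i * t\<^sub>m\<^sub>i\<^sub>x..<i * t\<^sub>m\<^sub>i\<^sub>x + t\<^sub>m\<^sub>i\<^sub>x}. ?b j)"
    by (simp add: sum.nat_group)
  also have "\<dots> = (\<Sum>i<r. \<Sum>j\<in>{i * t\<^sub>m\<^sub>i\<^sub>x..<i * t\<^sub>m\<^sub>i\<^sub>x + t\<^sub>m\<^sub>i\<^sub>x}. (1 / 2 :: real) ^ i)"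
  proof (intro sum.cong refl)
    fix i j assume "j \<in> {i * t\<^sub>m\<^sub>i\<^sub>x..<i * t\<^sub>m\<^sub>i\<^sub>x + t\<^sub>m\<^sub>i\<^sub>x}"
    then have "j div t\<^sub>m\<^sub>i\<^sub>x = i"
      by (intro div_nat_eqI) (auto simp: algebra_simps)
    then show "?b j = (1 / 2) ^ i" by simp
  qed
  also have "\<dots> = real t\<^sub>m\<^sub>i\<^sub>x * (\<Sum>i<r. (1 / 2) ^ i)"
    by (simp add: sum_distrib_left)
  also have "\<dots> \<le> real t\<^sub>m\<^sub>i\<^sub>x * 2"
    by (intro mult_left_mono) (simp_all add: geometric_sum)
  finally show ?thesis by simp
qed

lemma poisson_0[simp]: "poisson f 0 x = 0"
  by (simp add: poisson_def)

lemma poisson_measurable[measurable]: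
  assumes "f \<in> unit_functions" shows "poisson f r \<in> borel_measurable S"
proof -
  have [measurable]: "(U ^^ j) f \<in> borel_measurable S" for j
    using U_power_unit[OF assms] by (rule unit_functions_measurable)
  show ?thesis unfolding poisson_def by measurable
qed

text \<open>Applying K raises every power by one: the horizon grows from r to \<open>Suc r\<close>,
  and the term j = 0 of the longer sum is left over. No limit in r is involved.\<close>

lemma integral_poisson:
  assumes f: "f \<in> unit_functions" and x: "x \<in> space S"
  shows "(\<integral>y. poisson f r y \<partial>K x) = poisson f (Suc r) x - (f x - (\<integral>y. f y \<partial>Q))"
proof -
  interpret Kx: prob_space "K x" using x by (rule prob_space_K)
  have "(\<integral>y. poisson f r y \<partial>K x) = (\<Sum>j<r. U ((U ^^ j) f) x - (\<integral>y. f y \<partial>Q))"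
    unfolding poisson_def using integrable_unit[OF U_power_unit[OF f] K_in_prob_algebra[OF x]]
    by (simp add: U_def Kx.prob_space)
  then show ?thesis
    by (simp add: poisson_def sum.lessThan_Suc_shift del: sum.lessThan_Suc)
qed

end

section \<open>Exponential moments along the chain\<close>

context markov_kernel
begin

text \<open>Names the step function inside \<open>chain_law\<close> so that the Ionescu-Tulcea
  locale can be interpreted for it. Time 0 is a point mass at x; the first random state has index
  1.\<close>

definition chain_step :: "'a \<Rightarrow> nat \<Rightarrow> (nat \<Rightarrow> 'a) \<Rightarrow> 'a measure" where
  "chain_step x = (\<lambda>i \<omega>. if i = 0 then return S x else K (\<omega> (i - 1)))"

lemma Ionescu_Tulcea_chain_step:
  assumes x: "x \<in> space S"
  shows "Ionescu_Tulcea (chain_step x) (\<lambda>_. S)"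
proof (rule Ionescu_Tulcea.intro)
  have *: "(\<lambda>\<omega>. \<omega> (i - 1)) \<in> PiM {0..<i} (\<lambda>_. S) \<rightarrow>\<^sub>M S" if "i \<noteq> 0" for i :: nat
    using that by (intro measurable_component_singleton) auto
  show "chain_step x i \<in> PiM {0..<i} (\<lambda>_. S) \<rightarrow>\<^sub>M subprob_algebra S" for i
  proof (cases "i = 0")
    case True
    then show ?thesis
      using x measurable_space[OF return_measurable, of x S] by (simp add: chain_step_def)
  next
    case False
    then show ?thesis
      using measurable_compose[OF *[OF False] K_subprob] by (simp add: chain_step_def)
  qed
  fix i :: nat and \<omega> assume "\<omega> \<in> space (PiM {0..<i} (\<lambda>_. S))"
  then show "prob_space (chain_step x i \<omega>)"
    using x measurable_space[OF *, of i \<omega>]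
    by (auto simp: chain_step_def prob_space_return prob_space_K)
qed

lemma
  assumes x: "x \<in> space S"
  shows sets_chain_law: "sets (chain_law S K x) = sets (PiM UNIV (\<lambda>_. S))"
    and prob_space_chain_law: "prob_space (chain_law S K x)"
    and distr_chain_law: "distr (chain_law S K x) (PiM {0..<k} (\<lambda>_. S)) (\<lambda>\<omega>. restrict \<omega> {0..<k})
      = Ionescu_Tulcea.C (chain_step x) (\<lambda>_. S) 0 k (\<lambda>_. undefined)"
proof -
  interpret IT: Ionescu_Tulcea "chain_step x" "\<lambda>_. S"
    using x by (rule Ionescu_Tulcea_chain_step)
  have eq: "chain_law S K x = IT.PF.lim"
    unfolding chain_law_def chain_step_def Let_def ..
  show sets: "sets (chain_law S K x) = sets (PiM UNIV (\<lambda>_. S))"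
    by (simp add: eq)
  have restr: "(\<lambda>\<omega>. restrict \<omega> J) \<in> chain_law S K x \<rightarrow>\<^sub>M PiM J (\<lambda>_. S)" for J
  proof -
    have "(\<lambda>\<omega>. restrict \<omega> J) \<in> PiM UNIV (\<lambda>_. S) \<rightarrow>\<^sub>M PiM J (\<lambda>_. S)"
      by (rule measurable_restrict_subset) simp
    then show ?thesis
      using measurable_cong_sets[OF sets refl] by blast
  qed
  have C: "IT.CI {0..<k} = IT.C 0 k (\<lambda>_. undefined)" for k
  proof -
    \<comment> \<open>\<open>CI\<close> projects the iterated kernel cut at \<open>up_to\<close>;
      for an initial segment nothing is projected away.\<close>
    have "IT.up_to {0..<k} = k"
    proof (rule antisym)
      show "IT.up_to {0..<k} \<le> k" by (simp add: IT.up_to_iff_Ico)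
      show "k \<le> IT.up_to {0..<k}"
        using IT.up_to[of "{0..<k}"] by (cases k) auto
    qed
    then show ?thesis
      using IT.distr_C[of k k "\<lambda>_. undefined" 0] by (simp add: IT.CI_def)
  qed
  show distr: "distr (chain_law S K x) (PiM {0..<k} (\<lambda>_. S)) (\<lambda>\<omega>. restrict \<omega> {0..<k})
      = IT.C 0 k (\<lambda>_. undefined)" for k
    using IT.distr_lim[of "{0..<k}"] C[of k] by (simp add: eq)
  \<comment> \<open>The projection to the empty set of coordinates already has mass 1, and a
    push-forward has the mass of its source.\<close>
  have "prob_space (IT.C 0 0 (\<lambda>_. undefined))"
    by (rule IT.prob_space_C) simp
  then show "prob_space (chain_law S K x)"
    using prob_space_distrD[OF restr] distr[of 0] by metis
qed

text \<open>Dynamic programming: r counts the factors still to come, \<open>W 0 = 1\<close> closes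
  the product, and \<open>decr\<close> absorbs one factor \<phi> while lengthening the horizon by
  one. Since the product starts at index 1, one integral under \<open>K x\<close> remains on the
  right.\<close>

lemma nn_integral_chain_supermartingale:
  fixes \<phi> :: "'a \<Rightarrow> ennreal" and W :: "nat \<Rightarrow> 'a \<Rightarrow> ennreal"
  assumes x: "x \<in> space S"
    and \<phi>[measurable]: "\<phi> \<in> borel_measurable S"
    and W[measurable]: "\<And>r. W r \<in> borel_measurable S"
    and W_0: "\<And>y. y \<in> space S \<Longrightarrow> W 0 y = 1"
    and decr: "\<And>r y. y \<in> space S \<Longrightarrow> \<phi> y * (\<integral>\<^sup>+z. W r z \<partial>K y) \<le> W (Suc r) y"
  shows "(\<integral>\<^sup>+\<omega>. (\<Prod>j\<in>{1..m}. \<phi> (\<omega> j)) \<partial>chain_law S K x) \<le> (\<integral>\<^sup>+z. W m z \<partial>K x)"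
proof -
  interpret IT: Ionescu_Tulcea "chain_step x" "\<lambda>_. S"
    using x by (rule Ionescu_Tulcea_chain_step)
  define C where "C k = IT.C 0 k (\<lambda>_. undefined)" for k
  have sets_C[measurable_cong]: "sets (C k) = sets (PiM {0..<k} (\<lambda>_. S))" for k
    unfolding C_def using IT.sets_C[of "\<lambda>_. undefined" 0 k] by simp
  have space_C: "space (C k) = space (PiM {0..<k} (\<lambda>_. S))" for k
    using sets_C by (rule sets_eq_imp_space_eq)
  have KW[measurable]: "(\<lambda>y. \<integral>\<^sup>+z. W r z \<partial>K y) \<in> borel_measurable S" for r
    by (rule measurable_compose[OF K_subprob nn_integral_measurable_subprob_algebra]) measurable
  have comp[measurable]: "(\<lambda>\<omega>. \<omega> j) \<in> PiM {0..<k} (\<lambda>_. S) \<rightarrow>\<^sub>M S" if "j < k" for j k :: nat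
    using that by (intro measurable_component_singleton) auto
  have comp_in: "\<omega> j \<in> space S" if "\<omega> \<in> space (PiM {0..<k} (\<lambda>_. S))" "j < k" for \<omega> and j k :: nat
    using measurable_space[OF comp[OF that(2)] that(1)] .
  \<comment> \<open>\<open>A i\<close> keeps the first i factors and replaces the other m - i by
    their bound given the state at time i. It is the right side at i = 0 and the left side at i = m;
    \<open>C (Suc i)\<close> carries the coordinates 0 to i.\<close>
  define A where "A i = (\<integral>\<^sup>+\<omega>. (\<Prod>j\<in>{1..i}. \<phi> (\<omega> j)) * (\<integral>\<^sup>+z. W (m - i) z \<partial>K (\<omega> i)) \<partial>C (Suc i))" for i
  have meas: "(\<lambda>\<omega>. (\<Prod>j\<in>{1..i}. \<phi> (\<omega> j)) * (\<integral>\<^sup>+z. W r z \<partial>K (\<omega> i))) \<in> borel_measurable (PiM {0..<Suc i} (\<lambda>_. S))" for i r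
    by (intro borel_measurable_times_ennreal borel_measurable_prod_ennreal measurable_compose[OF comp KW]
        measurable_compose[OF comp \<phi>]) auto
  have A_Suc: "A (Suc i) \<le> A i" if i: "i < m" for i
  proof -
    \<comment> \<open>Given the coordinates up to i, the next one is a single draw from
      \<open>K (\<omega> i)\<close>. Then \<open>decr\<close> applies with horizon
      \<open>m - Suc i\<close>, whose successor is \<open>m - i\<close> because i < m.\<close>
    have "A (Suc i) = (\<integral>\<^sup>+\<omega>. (\<integral>\<^sup>+\<omega>'. (\<Prod>j\<in>{1..Suc i}. \<phi> (\<omega>' j)) * (\<integral>\<^sup>+z. W (m - Suc i) z \<partial>K (\<omega>' (Suc i))) \<partial>IT.eP (Suc i) \<omega>) \<partial>C (Suc i))"
      unfolding A_def C_def IT.C.simps(2)[of 0 "Suc i"] plus_nat.add_0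
    proof (rule nn_integral_bind[OF meas])
      show "IT.eP (Suc i) \<in> IT.C 0 (Suc i) (\<lambda>_. undefined) \<rightarrow>\<^sub>M subprob_algebra (PiM {0..<Suc (Suc i)} (\<lambda>_. S))"
        using IT.measurable_eP[of "Suc i"] measurable_cong_sets[OF sets_C[of "Suc i"] refl]
        unfolding C_def by blast
    qed
    also have "\<dots> \<le> A i"
      unfolding A_def
    proof (rule nn_integral_mono)
      fix \<omega> assume "\<omega> \<in> space (C (Suc i))"
      then have \<omega>: "\<omega> \<in> space (PiM {0..<Suc i} (\<lambda>_. S))" by (simp add: space_C)
      have \<omega>i: "\<omega> i \<in> space S" using comp_in[OF \<omega>] by simp
      note sK = sets_K[OF \<omega>i]
      have "(\<integral>\<^sup>+\<omega>'. (\<Prod>j\<in>{1..Suc i}. \<phi> (\<omega>' j)) * (\<integral>\<^sup>+z. W (m - Suc i) z \<partial>K (\<omega>' (Suc i))) \<partial>IT.eP (Suc i) \<omega>)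
        = (\<integral>\<^sup>+y. (\<Prod>j\<in>{1..Suc i}. \<phi> (fun_upd \<omega> (Suc i) y j)) * (\<integral>\<^sup>+z. W (m - Suc i) z \<partial>K y) \<partial>K (\<omega> i))"
        using meas by (subst IT.nn_integral_eP[OF \<omega>]) (simp_all add: chain_step_def)
      also have "\<dots> = (\<integral>\<^sup>+y. (\<Prod>j\<in>{1..i}. \<phi> (\<omega> j)) * (\<phi> y * (\<integral>\<^sup>+z. W (m - Suc i) z \<partial>K y)) \<partial>K (\<omega> i))"
        by (intro nn_integral_cong) (simp add: mult_ac)
      also have "\<dots> = (\<Prod>j\<in>{1..i}. \<phi> (\<omega> j)) * (\<integral>\<^sup>+y. \<phi> y * (\<integral>\<^sup>+z. W (m - Suc i) z \<partial>K y) \<partial>K (\<omega> i))"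
      proof (rule nn_integral_cmult)
        have "(\<lambda>y. \<phi> y * (\<integral>\<^sup>+z. W (m - Suc i) z \<partial>K y)) \<in> borel_measurable S"
          by (intro borel_measurable_times_ennreal \<phi> KW)
        then show "(\<lambda>y. \<phi> y * (\<integral>\<^sup>+z. W (m - Suc i) z \<partial>K y)) \<in> borel_measurable (K (\<omega> i))"
          using measurable_cong_sets[OF sK refl] by blast
      qed
      also have "\<dots> \<le> (\<Prod>j\<in>{1..i}. \<phi> (\<omega> j)) * (\<integral>\<^sup>+y. W (m - i) y \<partial>K (\<omega> i))"
        using decr[of _ "m - Suc i"] i
        by (intro mult_left_mono nn_integral_mono) (auto simp: space_K[OF \<omega>i] Suc_diff_Suc)
      finally show "(\<integral>\<^sup>+\<omega>'. (\<Prod>j\<in>{1..Suc i}. \<phi> (\<omega>' j)) * (\<integral>\<^sup>+z. W (m - Suc i) z \<partial>K (\<omega>' (Suc i))) \<partial>IT.eP (Suc i) \<omega>)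
        \<le> (\<Prod>j\<in>{1..i}. \<phi> (\<omega> j)) * (\<integral>\<^sup>+y. W (m - i) y \<partial>K (\<omega> i))" .
    qed
    finally show ?thesis .
  qed
  have A_le: "i \<le> m \<Longrightarrow> A i \<le> A 0" for i
    by (induction i) (auto intro: order_trans[OF A_Suc])
  have A_0: "A 0 = (\<integral>\<^sup>+z. W m z \<partial>K x)"
  proof -
    have "A 0 = (\<integral>\<^sup>+\<omega>. (\<integral>\<^sup>+z. W m z \<partial>K (\<omega> 0)) \<partial>IT.eP 0 (\<lambda>_. undefined))"
      unfolding A_def C_def
      using IT.measurable_eP[of 0]
      by (subst IT.C.simps(2), subst IT.C.simps(1), subst bind_return) (auto simp: space_PiM)
    also have "\<dots> = (\<integral>\<^sup>+y. (\<integral>\<^sup>+z. W m z \<partial>K y) \<partial>return S x)"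
      using meas[of 0 m] by (subst IT.nn_integral_eP) (auto simp: chain_step_def)
    also have "\<dots> = (\<integral>\<^sup>+z. W m z \<partial>K x)"
      using x by (intro nn_integral_return) auto
    finally show ?thesis .
  qed
  have "(\<integral>\<^sup>+\<omega>. (\<Prod>j\<in>{1..m}. \<phi> (\<omega> j)) \<partial>chain_law S K x)
      = (\<integral>\<^sup>+\<omega>. (\<Prod>j\<in>{1..m}. \<phi> (\<omega> j)) \<partial>distr (chain_law S K x) (PiM {0..<Suc m} (\<lambda>_. S)) (\<lambda>\<omega>. restrict \<omega> {0..<Suc m}))"
  proof (subst nn_integral_distr)
    have "(\<lambda>\<omega>. restrict \<omega> {0..<Suc m}) \<in> PiM UNIV (\<lambda>_. S) \<rightarrow>\<^sub>M PiM {0..<Suc m} (\<lambda>_. S)"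
      by (rule measurable_restrict_subset) simp
    then show "(\<lambda>\<omega>. restrict \<omega> {0..<Suc m}) \<in> chain_law S K x \<rightarrow>\<^sub>M PiM {0..<Suc m} (\<lambda>_. S)"
      using measurable_cong_sets[OF sets_chain_law[OF x] refl] by blast
    have "(\<lambda>\<omega>. \<Prod>j\<in>{1..m}. \<phi> (\<omega> j)) \<in> borel_measurable (PiM {0..<Suc m} (\<lambda>_. S))"
      by (intro borel_measurable_prod_ennreal measurable_compose[OF comp \<phi>]) auto
    then show "(\<lambda>\<omega>. \<Prod>j\<in>{1..m}. \<phi> (\<omega> j)) \<in> borel_measurable
        (distr (chain_law S K x) (PiM {0..<Suc m} (\<lambda>_. S)) (\<lambda>\<omega>. restrict \<omega> {0..<Suc m}))"
      by simp
  qed (auto intro!: nn_integral_cong prod.cong)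
  also have "\<dots> = (\<integral>\<^sup>+\<omega>. (\<Prod>j\<in>{1..m}. \<phi> (\<omega> j)) \<partial>C (Suc m))"
    by (simp add: distr_chain_law[OF x] C_def del: IT.C.simps)
  also have "\<dots> = A m"
    unfolding A_def
  proof (rule nn_integral_cong)
    fix \<omega> assume "\<omega> \<in> space (C (Suc m))"
    then have \<omega>m: "\<omega> m \<in> space S" using comp_in[of \<omega> "Suc m" m] by (simp add: space_C)
    interpret Km: prob_space "K (\<omega> m)" using \<omega>m by (rule prob_space_K)
    have "(\<integral>\<^sup>+z. W (m - m) z \<partial>K (\<omega> m)) = (\<integral>\<^sup>+z. 1 \<partial>K (\<omega> m))"
      by (intro nn_integral_cong) (simp add: W_0 space_K[OF \<omega>m])
    then show "(\<Prod>j\<in>{1..m}. \<phi> (\<omega> j)) = (\<Prod>j\<in>{1..m}. \<phi> (\<omega> j)) * (\<integral>\<^sup>+z. W (m - m) z \<partial>K (\<omega> m))"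
      by (simp add: Km.emeasure_space_1)
  qed
  also have "\<dots> \<le> A 0" by (rule A_le) simp
  finally show ?thesis by (simp add: A_0)
qed

lemma validation_map_measurable:
  assumes x: "x \<in> space S"
  shows "(\<lambda>\<omega>. \<lambda>j\<in>{n+1..n+m}. \<omega> (j - n)) \<in> chain_law S K x \<rightarrow>\<^sub>M PiM {n+1..n+m} (\<lambda>_. S)"
proof -
  have "(\<lambda>\<omega>. \<lambda>j\<in>{n+1..n+m}. \<omega> (j - n)) \<in> PiM UNIV (\<lambda>_. S) \<rightarrow>\<^sub>M PiM {n+1..n+m} (\<lambda>_. S)"
    by (intro measurable_restrict measurable_component_singleton) auto
  then show ?thesis
    using measurable_cong_sets[OF sets_chain_law[OF x] refl] by blast
qed

lemma prob_space_validation_law: "x \<in> space S \<Longrightarrow> prob_space (validation_law S K n m x)"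
  unfolding validation_law_def
  by (intro prob_space.prob_space_distr prob_space_chain_law validation_map_measurable)

lemma sets_validation_law[simp, measurable_cong]: "sets (validation_law S K n m x) = sets (PiM {n+1..n+m} (\<lambda>_. S))"
  by (simp add: validation_law_def)

lemma nn_integral_validation_law_prod:
  fixes \<phi> :: "'a \<Rightarrow> ennreal"
  assumes x: "x \<in> space S" and \<phi>[measurable]: "\<phi> \<in> borel_measurable S"
  shows "(\<integral>\<^sup>+v. (\<Prod>j\<in>{n+1..n+m}. \<phi> (v j)) \<partial>validation_law S K n m x)
    = (\<integral>\<^sup>+\<omega>. (\<Prod>j\<in>{1..m}. \<phi> (\<omega> j)) \<partial>chain_law S K x)"
proof -
  have "(\<lambda>v. \<Prod>j\<in>{n+1..n+m}. \<phi> (v j)) \<in> borel_measurable (PiM {n+1..n+m} (\<lambda>_. S))"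
    by (intro borel_measurable_prod_ennreal measurable_compose[OF _ \<phi>] measurable_component_singleton)
  moreover have "(\<Prod>j\<in>{n+1..n+m}. \<phi> ((\<lambda>j\<in>{n+1..n+m}. \<omega> (j - n)) j)) = (\<Prod>j\<in>{1..m}. \<phi> (\<omega> j))" for \<omega>
    by (rule prod.reindex_bij_witness[where i="\<lambda>j. j + n" and j="\<lambda>j. j - n"]) auto
  ultimately show ?thesis
    unfolding validation_law_def
    by (subst nn_integral_distr[OF validation_map_measurable[OF x]]) simp_all
qed

end

text \<open>A rearranged \<open>1 - d / v \<le> exp (- (d / v))\<close>. With
  \<open>v = V (Suc r) y\<close> and \<open>v - d\<close> the integral of \<open>V r\<close> under
  \<open>K y\<close>, it is one step of the backward recursion; d may have either sign.\<close>

lemma exp_mult_diff_le: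
  fixes v d u :: real
  assumes "v > 0" "u \<le> d / v"
  shows "exp u * (v - d) \<le> v"
proof -
  have "1 - d / v \<le> exp (- (d / v))"
    using exp_ge_add_one_self[of "- (d / v)"] by simp
  also have "\<dots> \<le> exp (- u)" using assms by simp
  finally have "v * (1 - d / v) \<le> v * exp (- u)"
    using assms by (intro mult_left_mono) auto
  moreover have "v * (1 - d / v) = v - d"
    using assms by (simp add: right_diff_distrib)
  ultimately have "v - d \<le> v * exp (- u)" by simp
  then have "exp u * (v - d) \<le> exp u * (v * exp (- u))"
    by (intro mult_left_mono) auto
  also have "exp u * (v * exp (- u)) = v"
    by (simp add: exp_minus)
  finally show ?thesis .
qed

section \<open>Exponential moments of upper and lower deviations\<close>

context ergodic_kernel
begin

text \<open>
  The Lyapunov functions \<open>1 + \<theta> h\<^sub>r\<close>, with \<open>h\<^sub>r\<close> the truncated Poisson solution, are affine in \<open>h\<^sub>r\<close>, so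
  the kernel acts on them exactly and no variance estimate is needed.
\<close>

lemma nn_integral_exp_sum_le:
  assumes f: "f \<in> unit_functions" and x: "x \<in> space S"
    and u[measurable]: "u \<in> borel_measurable S"
    and \<theta>: "\<bar>\<theta>\<bar> * (2 * real t\<^sub>m\<^sub>i\<^sub>x) \<le> 1"
    and step: "\<And>y v. y \<in> space S \<Longrightarrow> \<bar>v - 1\<bar> \<le> \<bar>\<theta>\<bar> * (2 * real t\<^sub>m\<^sub>i\<^sub>x) \<Longrightarrow>
      exp (u y) * (v - \<theta> * (f y - (\<integral>y. f y \<partial>Q))) \<le> v"
  shows "(\<integral>\<^sup>+v. ennreal (exp (\<Sum>j\<in>{n+1..n+m}. u (v j))) \<partial>validation_law S K n m x) \<le> 2"
proof -
  define V where "V r y = 1 + \<theta> * poisson f r y" for r y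
  have bound: "\<bar>\<theta> * poisson f r y\<bar> \<le> \<bar>\<theta>\<bar> * (2 * real t\<^sub>m\<^sub>i\<^sub>x)" if "y \<in> space S" for r y
    using abs_poisson_le[OF f that, of r] by (simp add: abs_mult mult_left_mono)
  \<comment> \<open>The bound on \<open>\<theta>\<close> keeps V between 0 and 2: nonnegativity
    allows the passage to \<open>ennreal\<close>, and the 2 becomes the final constant for every
    starting point.\<close>
  have V_bounds: "0 \<le> V r y" "V r y \<le> 2" if "y \<in> space S" for r y
    using bound[OF that, of r] \<theta> by (auto simp: V_def)
  have V_measurable[measurable]: "V r \<in> borel_measurable S" for r
    using poisson_measurable[OF f, of r] unfolding V_def by measurable
  have KV: "(\<integral>\<^sup>+z. ennreal (V r z) \<partial>K y) = ennreal (V (Suc r) y - \<theta> * (f y - (\<integral>y. f y \<partial>Q)))"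
    if y: "y \<in> space S" for r y
  proof -
    interpret Ky: prob_space "K y" using y by (rule prob_space_K)
    note [measurable_cong] = sets_K[OF y]
    have "poisson f r \<in> borel_measurable (K y)"
      using poisson_measurable[OF f] measurable_cong_sets[OF sets_K[OF y] refl] by blast
    then have int: "integrable (K y) (poisson f r)"
      using abs_poisson_le[OF f]
      by (intro Ky.integrable_const_bound[where B="2 * real t\<^sub>m\<^sub>i\<^sub>x"]) (auto simp: space_K[OF y])
    then have "integrable (K y) (V r)" unfolding V_def by simp
    then have "(\<integral>\<^sup>+z. ennreal (V r z) \<partial>K y) = ennreal (\<integral>z. V r z \<partial>K y)"
      by (intro nn_integral_eq_integral) (auto simp: space_K[OF y] V_bounds)
    also have "(\<integral>z. V r z \<partial>K y) = 1 + \<theta> * (\<integral>z. poisson f r z \<partial>K y)"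
      unfolding V_def using int Ky.prob_space by simp
    finally show ?thesis
      by (simp add: integral_poisson[OF f y] V_def algebra_simps)
  qed
  have "(\<integral>\<^sup>+v. ennreal (exp (\<Sum>j\<in>{n+1..n+m}. u (v j))) \<partial>validation_law S K n m x)
      = (\<integral>\<^sup>+v. (\<Prod>j\<in>{n+1..n+m}. ennreal (exp (u (v j)))) \<partial>validation_law S K n m x)"
    by (simp add: exp_sum prod_ennreal)
  also have "\<dots> = (\<integral>\<^sup>+\<omega>. (\<Prod>j\<in>{1..m}. ennreal (exp (u (\<omega> j)))) \<partial>chain_law S K x)"
    by (intro nn_integral_validation_law_prod x) measurable
  also have "\<dots> \<le> (\<integral>\<^sup>+z. ennreal (V m z) \<partial>K x)"
  proof (rule nn_integral_chain_supermartingale[OF x, where W="\<lambda>r y. ennreal (V r y)"])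
    fix r y assume y: "y \<in> space S"
    show "ennreal (exp (u y)) * (\<integral>\<^sup>+z. ennreal (V r z) \<partial>K y) \<le> ennreal (V (Suc r) y)"
      using step[OF y, of "V (Suc r) y"] bound[OF y, of "Suc r"]
      unfolding KV[OF y] by (simp add: V_def ennreal_mult'[symmetric] ennreal_leI)
  qed (simp_all add: V_def[of 0])
  also have "\<dots> \<le> (\<integral>\<^sup>+z. 2 \<partial>K x)"
    using V_bounds by (intro nn_integral_mono) (auto simp: space_K[OF x] ennreal_le_iff2 simp flip: ennreal_numeral)
  also have "\<dots> = 2"
    using prob_space.emeasure_space_1[OF prob_space_K[OF x]] by simp
  finally show ?thesis .
qed

text \<open>The choice \<open>\<theta> * D = a / (2 + a)\<close> confines v to
  [2 / (2 + a), (2 + 2 a) / (2 + a)], an interval whose endpoints have ratio 1 + a. Dividing f by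
  the largest v and \<mu> by the smallest turns \<mu> into (1 + a) \<mu>, and the rate a / (4 t (1 +
  a)), t the mixing time, is \<open>\<theta>\<close> over the largest v.\<close>

lemma nn_integral_exp_upper:
  assumes f: "f \<in> unit_functions" and x: "x \<in> space S" and a: "0 < a" "a < 1"
  shows "(\<integral>\<^sup>+v. ennreal (exp (\<Sum>j\<in>{n+1..n+m}.
      a / (4 * real t\<^sub>m\<^sub>i\<^sub>x * (1 + a)) * (f (v j) - (1 + a) * (\<integral>y. f y \<partial>Q)))) \<partial>validation_law S K n m x) \<le> 2"
proof (rule nn_integral_exp_sum_le[OF f x])
  define D where "D = 2 * real t\<^sub>m\<^sub>i\<^sub>x"
  define \<mu> where "\<mu> = (\<integral>y. f y \<partial>Q)"
  define \<theta> where "\<theta> = a / ((2 + a) * D)"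
  have D: "D > 0" using mixing_time_ge_1 by (simp add: D_def)
  have \<mu>: "0 \<le> \<mu>" unfolding \<mu>_def using integral_unit(1)[OF f Q_in_prob_algebra] .
  have \<theta>: "\<theta> > 0" "\<theta> * D = a / (2 + a)" using a D by (simp_all add: \<theta>_def)
  have [measurable]: "f \<in> borel_measurable S" using f by (rule unit_functions_measurable)
  show "(\<lambda>y. a / (4 * real t\<^sub>m\<^sub>i\<^sub>x * (1 + a)) * (f y - (1 + a) * (\<integral>y. f y \<partial>Q))) \<in> borel_measurable S"
    by measurable
  show "\<bar>\<theta>\<bar> * (2 * real t\<^sub>m\<^sub>i\<^sub>x) \<le> 1"
    using \<theta> a by (simp flip: D_def)
  fix y v assume y: "y \<in> space S" and "\<bar>v - 1\<bar> \<le> \<bar>\<theta>\<bar> * (2 * real t\<^sub>m\<^sub>i\<^sub>x)"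
  then have "\<bar>v - 1\<bar> \<le> a / (2 + a)" using \<theta> by (simp flip: D_def)
  then have v: "v \<le> (2 + 2 * a) / (2 + a)" "2 / (2 + a) \<le> v"
    using a by (auto simp: abs_le_iff field_simps)
  then have v0: "v > 0" using a by (intro less_le_trans[OF _ v(2)]) auto
  have fy: "0 \<le> f y" using f y by (rule unit_functions_nonneg)
  have "a / (2 * D * (1 + a)) * (f y - (1 + a) * \<mu>) = \<theta> * f y * ((2 + a) / (2 + 2 * a)) - \<theta> * \<mu> * ((2 + a) / 2)"
  proof -
    have "2 + a \<noteq> 0" "1 + a \<noteq> 0" "2 + 2 * a \<noteq> 0" "D \<noteq> 0" using a D by auto
    then show ?thesis
      unfolding \<theta>_def by (simp add: divide_simps) (simp add: algebra_simps)
  qed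
  \<comment> \<open>As f and \<mu> are nonnegative, each of the two terms can be estimated with its
    own extreme value of v.\<close>
  also have "\<dots> \<le> \<theta> * f y * (1 / v) - \<theta> * \<mu> * (1 / v)"
    using v v0 a \<theta> fy \<mu> by (intro diff_mono mult_left_mono mult_nonneg_nonneg) (auto simp: field_simps)
  also have "\<dots> = \<theta> * (f y - \<mu>) / v" by (simp add: right_diff_distrib diff_divide_distrib)
  finally have "a / (2 * D * (1 + a)) * (f y - (1 + a) * \<mu>) \<le> \<theta> * (f y - \<mu>) / v" .
  then show "exp (a / (4 * real t\<^sub>m\<^sub>i\<^sub>x * (1 + a)) * (f y - (1 + a) * (\<integral>y. f y \<partial>Q))) * (v - \<theta> * (f y - (\<integral>y. f y \<partial>Q))) \<le> v"
    using v0 by (intro exp_mult_diff_le) (simp_all add: D_def \<mu>_def)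
qed

text \<open>The mirror image, with \<open>- \<theta>\<close> as the coefficient of the Poisson sums:
  now \<mu> is divided by the largest v, 2 / (2 - a), and f by the smallest, (2 - 2 a) / (2 - a).
  Their ratio gives 1 - a, and a < 1 keeps the smallest v positive.\<close>

lemma nn_integral_exp_lower:
  assumes f: "f \<in> unit_functions" and x: "x \<in> space S" and a: "0 < a" "a < 1"
  shows "(\<integral>\<^sup>+v. ennreal (exp (\<Sum>j\<in>{n+1..n+m}.
      a / (4 * real t\<^sub>m\<^sub>i\<^sub>x * (1 - a)) * ((1 - a) * (\<integral>y. f y \<partial>Q) - f (v j)))) \<partial>validation_law S K n m x) \<le> 2"
proof (rule nn_integral_exp_sum_le[OF f x])
  define D where "D = 2 * real t\<^sub>m\<^sub>i\<^sub>x"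
  define \<mu> where "\<mu> = (\<integral>y. f y \<partial>Q)"
  define \<theta> where "\<theta> = a / ((2 - a) * D)"
  have D: "D > 0" using mixing_time_ge_1 by (simp add: D_def)
  have \<mu>: "0 \<le> \<mu>" unfolding \<mu>_def using integral_unit(1)[OF f Q_in_prob_algebra] .
  have \<theta>: "\<theta> > 0" "\<theta> * D = a / (2 - a)" using a D by (simp_all add: \<theta>_def)
  have [measurable]: "f \<in> borel_measurable S" using f by (rule unit_functions_measurable)
  show "(\<lambda>y. a / (4 * real t\<^sub>m\<^sub>i\<^sub>x * (1 - a)) * ((1 - a) * (\<integral>y. f y \<partial>Q) - f y)) \<in> borel_measurable S"
    by measurable
  show "\<bar>- \<theta>\<bar> * (2 * real t\<^sub>m\<^sub>i\<^sub>x) \<le> 1"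
    using \<theta> a by (simp flip: D_def)
  fix y v assume y: "y \<in> space S" and "\<bar>v - 1\<bar> \<le> \<bar>- \<theta>\<bar> * (2 * real t\<^sub>m\<^sub>i\<^sub>x)"
  then have "\<bar>v - 1\<bar> \<le> a / (2 - a)" using \<theta> by (simp flip: D_def)
  then have v: "v \<le> 2 / (2 - a)" "(2 - 2 * a) / (2 - a) \<le> v"
    using a by (auto simp: abs_le_iff field_simps)
  then have v0: "v > 0" using a by (intro less_le_trans[OF _ v(2)]) auto
  have fy: "0 \<le> f y" using f y by (rule unit_functions_nonneg)
  have "a / (2 * D * (1 - a)) * ((1 - a) * \<mu> - f y) = \<theta> * \<mu> * ((2 - a) / 2) - \<theta> * f y * ((2 - a) / (2 - 2 * a))"
  proof -
    have "2 - a \<noteq> 0" "1 - a \<noteq> 0" "2 - 2 * a \<noteq> 0" "D \<noteq> 0" using a D by auto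
    then show ?thesis
      unfolding \<theta>_def by (simp add: divide_simps) (simp add: algebra_simps)
  qed
  also have "\<dots> \<le> \<theta> * \<mu> * (1 / v) - \<theta> * f y * (1 / v)"
    using v v0 a \<theta> fy \<mu> by (intro diff_mono mult_left_mono mult_nonneg_nonneg) (auto simp: field_simps)
  also have "\<dots> = - \<theta> * (f y - \<mu>) / v" by (simp add: right_diff_distrib diff_divide_distrib)
  finally have "a / (2 * D * (1 - a)) * ((1 - a) * \<mu> - f y) \<le> - \<theta> * (f y - \<mu>) / v" .
  then show "exp (a / (4 * real t\<^sub>m\<^sub>i\<^sub>x * (1 - a)) * ((1 - a) * (\<integral>y. f y \<partial>Q) - f y)) * (v - - \<theta> * (f y - (\<integral>y. f y \<partial>Q))) \<le> v"
    using v0 by (intro exp_mult_diff_le) (simp_all add: D_def \<mu>_def)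
qed

end

section \<open>Contractions of the space of square integrable functions\<close>

lemma L2_space_iff:
  "f \<in> L2_space Q \<longleftrightarrow> f \<in> borel_measurable Q \<and> (\<integral>\<^sup>+x. ennreal ((cmod (f x))\<^sup>2) \<partial>Q) < \<infinity>"
  by (auto simp: L2_space_def integrable_iff_bounded)

lemma L2_measurable: "f \<in> L2_space Q \<Longrightarrow> f \<in> borel_measurable Q"
  and L2_integrable: "f \<in> L2_space Q \<Longrightarrow> integrable Q (\<lambda>x. (cmod (f x))\<^sup>2)"
  by (auto simp: L2_space_def)

lemma L2_norm_nonneg: "0 \<le> L2_norm Q f"
  by (simp add: L2_norm_def)

lemma L2_norm_square: "(L2_norm Q f)\<^sup>2 = (\<integral>x. (cmod (f x))\<^sup>2 \<partial>Q)"
  by (simp add: L2_norm_def)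

lemma nn_integral_L2:
  "f \<in> L2_space Q \<Longrightarrow> (\<integral>\<^sup>+x. ennreal ((cmod (f x))\<^sup>2) \<partial>Q) = ennreal ((L2_norm Q f)\<^sup>2)"
  unfolding L2_norm_square by (intro nn_integral_eq_integral L2_integrable) auto

lemma L2_normI:
  assumes "f \<in> borel_measurable Q" "(\<integral>\<^sup>+x. ennreal ((cmod (f x))\<^sup>2) \<partial>Q) \<le> ennreal (c\<^sup>2)" "0 \<le> c"
  shows "f \<in> L2_space Q" "L2_norm Q f \<le> c"
proof -
  show f: "f \<in> L2_space Q"
    using assms by (auto simp: L2_space_iff intro: le_less_trans)
  have "(L2_norm Q f)\<^sup>2 \<le> c\<^sup>2"
    using assms(2) by (simp add: nn_integral_L2[OF f])
  then show "L2_norm Q f \<le> c"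
    using assms(3) by (rule power2_le_imp_le)
qed

lemma cmod_add_square_le: "(cmod (a + b))\<^sup>2 \<le> 2 * (cmod a)\<^sup>2 + 2 * (cmod b)\<^sup>2"
proof -
  have "(cmod (a + b))\<^sup>2 \<le> (cmod a + cmod b)\<^sup>2"
    by (intro power_mono norm_triangle_ineq) auto
  also have "\<dots> \<le> 2 * (cmod a)\<^sup>2 + 2 * (cmod b)\<^sup>2"
    using sum_squares_bound[of "cmod a" "cmod b"] by (simp add: power2_sum)
  finally show ?thesis .
qed

lemma L2_add:
  assumes f: "f \<in> L2_space Q" and g: "g \<in> L2_space Q"
  shows "(\<lambda>x. f x + g x) \<in> L2_space Q"
proof -
  note [measurable] = f[THEN L2_measurable] g[THEN L2_measurable]
  have "integrable Q (\<lambda>x. 2 * (cmod (f x))\<^sup>2 + 2 * (cmod (g x))\<^sup>2)"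
    using f g by (intro Bochner_Integration.integrable_add integrable_mult_right L2_integrable)
  then have "integrable Q (\<lambda>x. (cmod (f x + g x))\<^sup>2)"
    by (rule Bochner_Integration.integrable_bound) (auto intro!: AE_I2 cmod_add_square_le)
  then show ?thesis by (simp add: L2_space_def)
qed

text \<open>A cheap substitute for Minkowski's inequality: it serves only to bound a commutator,
  where the extra factor is later beaten by powers of 1 / |z|.\<close>

lemma L2_norm_add_square:
  assumes f: "f \<in> L2_space Q" and g: "g \<in> L2_space Q"
  shows "(L2_norm Q (\<lambda>x. f x + g x))\<^sup>2 \<le> 2 * (L2_norm Q f)\<^sup>2 + 2 * (L2_norm Q g)\<^sup>2"
proof -
  have "(\<integral>x. (cmod (f x + g x))\<^sup>2 \<partial>Q) \<le> (\<integral>x. 2 * (cmod (f x))\<^sup>2 + 2 * (cmod (g x))\<^sup>2 \<partial>Q)"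
    using f g by (intro integral_mono Bochner_Integration.integrable_add integrable_mult_right L2_integrable
        L2_add cmod_add_square_le)
  also have "\<dots> = 2 * (\<integral>x. (cmod (f x))\<^sup>2 \<partial>Q) + 2 * (\<integral>x. (cmod (g x))\<^sup>2 \<partial>Q)"
    using f g by (simp add: L2_integrable)
  finally show ?thesis by (simp add: L2_norm_square)
qed

lemma L2_scale:
  assumes f: "f \<in> L2_space Q" shows "(\<lambda>x. c * f x) \<in> L2_space Q"
  using f by (auto simp: L2_space_def norm_mult power_mult_distrib)

lemma L2_norm_scale: "L2_norm Q (\<lambda>x. c * f x) = cmod c * L2_norm Q f"
  by (simp add: L2_norm_def norm_mult power_mult_distrib real_sqrt_mult)

lemma L2_lincomb:
  assumes "f \<in> L2_space Q" "g \<in> L2_space Q"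
  shows "(\<lambda>x. a * f x + b * g x) \<in> L2_space Q"
  using L2_add[OF L2_scale[OF assms(1)] L2_scale[OF assms(2)]] .

lemma L2_norm_cong_AE:
  assumes "f \<in> L2_space Q" "g \<in> L2_space Q" "AE x in Q. f x = g x"
  shows "L2_norm Q f = L2_norm Q g"
proof -
  have "(\<integral>x. (cmod (f x))\<^sup>2 \<partial>Q) = (\<integral>x. (cmod (g x))\<^sup>2 \<partial>Q)"
    using assms(3) assms(1,2)[THEN L2_integrable] 
    by (intro integral_cong_AE) (auto intro: borel_measurable_integrable)
  then show ?thesis by (simp add: L2_norm_def)
qed

lemma L2_norm_eq_0_iff:
  assumes f: "f \<in> L2_space Q"
  shows "L2_norm Q f = 0 \<longleftrightarrow> (AE x in Q. f x = 0)"
  using integral_nonneg_eq_0_iff_AE[OF L2_integrable[OF f]] by (simp add: L2_norm_def)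

lemma L2_inner_integrable:
  assumes f: "f \<in> L2_space Q" and g: "g \<in> L2_space Q"
  shows "integrable Q (\<lambda>x. f x * cnj (g x))"
proof -
  note [measurable] = f[THEN L2_measurable] g[THEN L2_measurable]
  have [measurable]: "(\<lambda>x. cnj (g x)) \<in> borel_measurable Q"
    by (rule measurable_compose[OF L2_measurable[OF g] borel_measurable_continuous_onI])
      (intro continuous_intros)
  have "integrable Q (\<lambda>x. (cmod (f x))\<^sup>2 + (cmod (g x))\<^sup>2)"
    using f g by (auto intro: L2_integrable)
  then show ?thesis
  proof (rule Bochner_Integration.integrable_bound)
    show "AE x in Q. norm (f x * cnj (g x)) \<le> norm ((cmod (f x))\<^sup>2 + (cmod (g x))\<^sup>2)"
    proof (rule AE_I2)
      fix x
      have "cmod (f x) * cmod (g x) \<le> (cmod (f x))\<^sup>2 + (cmod (g x))\<^sup>2"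
        using sum_squares_bound[of "cmod (f x)" "cmod (g x)"] mult_nonneg_nonneg[of "cmod (f x)" "cmod (g x)"]
        unfolding mult.assoc by (smt (verit) norm_ge_zero)
      then show "norm (f x * cnj (g x)) \<le> norm ((cmod (f x))\<^sup>2 + (cmod (g x))\<^sup>2)"
        by (simp add: norm_mult)
    qed
  qed measurable
qed

lemma L2_Cauchy_Schwarz:
  assumes f: "f \<in> L2_space Q" and g: "g \<in> L2_space Q"
  shows "cmod (L2_inner Q f g) \<le> L2_norm Q f * L2_norm Q g"
proof -
  note [measurable] = f[THEN L2_measurable] g[THEN L2_measurable]
  have "ennreal (cmod (L2_inner Q f g)) \<le> (\<integral>\<^sup>+x. ennreal (cmod (f x * cnj (g x))) \<partial>Q)"
    unfolding L2_inner_def by (rule integral_norm_bound_ennreal[OF L2_inner_integrable[OF f g]])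
  also have "\<dots> = (\<integral>\<^sup>+x. ennreal (cmod (f x)) * ennreal (cmod (g x)) \<partial>Q)"
    by (simp add: norm_mult ennreal_mult)
  finally have "(ennreal (cmod (L2_inner Q f g)))\<^sup>2 \<le> (\<integral>\<^sup>+x. ennreal (cmod (f x)) * ennreal (cmod (g x)) \<partial>Q)\<^sup>2"
    by (intro power_mono) auto
  also have "\<dots> \<le> (\<integral>\<^sup>+x. (ennreal (cmod (f x)))\<^sup>2 \<partial>Q) * (\<integral>\<^sup>+x. (ennreal (cmod (g x)))\<^sup>2 \<partial>Q)"
    by (rule Cauchy_Schwarz_nn_integral) measurable
  also have "\<dots> = ennreal ((L2_norm Q f * L2_norm Q g)\<^sup>2)"
    using nn_integral_L2[OF f] nn_integral_L2[OF g]
    by (simp add: ennreal_power ennreal_mult power_mult_distrib)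
  finally have "(cmod (L2_inner Q f g))\<^sup>2 \<le> (L2_norm Q f * L2_norm Q g)\<^sup>2"
    by (simp add: ennreal_power)
  then show ?thesis
    by (rule power2_le_imp_le) (simp add: L2_norm_nonneg)
qed

lemma L2_inner_self: "f \<in> L2_space Q \<Longrightarrow> L2_inner Q f f = complex_of_real ((L2_norm Q f)\<^sup>2)"
  unfolding L2_inner_def L2_norm_square
  by (simp add: complex_norm_square[symmetric] flip: integral_complex_of_real of_real_power)

lemma L2_inner_add_left:
  assumes "f \<in> L2_space Q" "g \<in> L2_space Q" "h \<in> L2_space Q"
  shows "L2_inner Q (\<lambda>x. f x + g x) h = L2_inner Q f h + L2_inner Q g h"
  using L2_inner_integrable[OF assms(1,3)] L2_inner_integrable[OF assms(2,3)]
  by (simp add: L2_inner_def distrib_right)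

lemma L2_inner_add_right:
  assumes "f \<in> L2_space Q" "g \<in> L2_space Q" "h \<in> L2_space Q"
  shows "L2_inner Q h (\<lambda>x. f x + g x) = L2_inner Q h f + L2_inner Q h g"
  using L2_inner_integrable[OF assms(3,1)] L2_inner_integrable[OF assms(3,2)]
  by (simp add: L2_inner_def distrib_left)

lemma L2_inner_scale_left: "L2_inner Q (\<lambda>x. c * f x) h = c * L2_inner Q f h"
  by (simp add: L2_inner_def mult.assoc)

lemma L2_inner_scale_right: "L2_inner Q h (\<lambda>x. c * f x) = cnj c * L2_inner Q h f"
  by (simp add: L2_inner_def mult.left_commute)

lemma L2_inner_cong_AE:
  assumes "f \<in> L2_space Q" "f' \<in> L2_space Q" "g \<in> L2_space Q" "AE x in Q. f x = f' x"
  shows "L2_inner Q f g = L2_inner Q f' g"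
  unfolding L2_inner_def
  using assms(4) L2_inner_integrable[OF assms(1,3)] L2_inner_integrable[OF assms(2,3)]
  by (intro integral_cong_AE) (auto intro: borel_measurable_integrable)

text \<open>Reduces statements linear in f to nonnegative real functions, where
  \<open>nn_integral\<close> is available. The positive and negative parts of the real and imaginary
  part are dominated by |f| and recombine to f at every point.\<close>

lemma L2_nonneg_induct[consumes 1, case_names add scale nonneg]:
  assumes f: "f \<in> L2_space Q"
    and add: "\<And>f g. f \<in> L2_space Q \<Longrightarrow> g \<in> L2_space Q \<Longrightarrow> P f \<Longrightarrow> P g \<Longrightarrow> P (\<lambda>x. f x + g x)"
    and scale: "\<And>f c. f \<in> L2_space Q \<Longrightarrow> P f \<Longrightarrow> P (\<lambda>x. c * f x)"
    and nonneg: "\<And>u. u \<in> borel_measurable Q \<Longrightarrow> (\<And>x. 0 \<le> u x) \<Longrightarrow>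
      (\<lambda>x. complex_of_real (u x)) \<in> L2_space Q \<Longrightarrow> P (\<lambda>x. complex_of_real (u x))"
  shows "P f"
proof -
  note [measurable] = L2_measurable[OF f]
  have base: "(\<lambda>x. complex_of_real (u x)) \<in> L2_space Q \<and> P (\<lambda>x. complex_of_real (u x))"
    if [measurable]: "u \<in> borel_measurable Q" and "\<And>x. 0 \<le> u x" "\<And>x. u x \<le> cmod (f x)" for u
  proof -
    have "integrable Q (\<lambda>x. (u x)\<^sup>2)"
      using L2_integrable[OF f] by (rule Bochner_Integration.integrable_bound)
        (use that in \<open>auto intro!: AE_I2 power_mono\<close>)
    then have "(\<lambda>x. complex_of_real (u x)) \<in> L2_space Q"
      by (simp add: L2_space_def)
    then show ?thesis using nonneg[of u] that by blast
  qed
  have comb: "(\<lambda>x. a * g x + b * h x) \<in> L2_space Q \<and> P (\<lambda>x. a * g x + b * h x)"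
    if "g \<in> L2_space Q \<and> P g" "h \<in> L2_space Q \<and> P h" for a b g h
    using that by (auto intro!: add scale L2_lincomb L2_scale)
  have Re: "\<bar>Re z\<bar> \<le> cmod z" and Im: "\<bar>Im z\<bar> \<le> cmod z" for z
    by (rule abs_Re_le_cmod, rule abs_Im_le_cmod)
  have le: "max 0 (Re z) \<le> cmod z" "max 0 (- Re z) \<le> cmod z" "max 0 (Im z) \<le> cmod z" "max 0 (- Im z) \<le> cmod z" for z
    using Re[of z] Im[of z] by auto
  have "P (\<lambda>x. 1 * (1 * complex_of_real (max 0 (Re (f x))) + (- 1) * complex_of_real (max 0 (- Re (f x))))
      + \<i> * (1 * complex_of_real (max 0 (Im (f x))) + (- 1) * complex_of_real (max 0 (- Im (f x)))))"
    by (intro comb[THEN conjunct2] comb base le) auto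
  also have "(\<lambda>x. 1 * (1 * complex_of_real (max 0 (Re (f x))) + (- 1) * complex_of_real (max 0 (- Re (f x))))
      + \<i> * (1 * complex_of_real (max 0 (Im (f x))) + (- 1) * complex_of_real (max 0 (- Im (f x))))) = f"
    by (rule ext, simp add: complex_eq_iff) (auto simp: max_def)
  finally show ?thesis .
qed

section \<open>Bounded operators, contractions and their compositions\<close>

definition L2_contraction :: "'a measure \<Rightarrow> (('a \<Rightarrow> complex) \<Rightarrow> ('a \<Rightarrow> complex)) \<Rightarrow> bool" where
  "L2_contraction Q T \<longleftrightarrow> L2_operator Q T \<and> (\<forall>f\<in>L2_space Q. L2_norm Q (T f) \<le> L2_norm Q f)"

lemma L2_operator_L2: "L2_operator Q T \<Longrightarrow> f \<in> L2_space Q \<Longrightarrow> T f \<in> L2_space Q"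
  and L2_operator_add: "L2_operator Q T \<Longrightarrow> f \<in> L2_space Q \<Longrightarrow> g \<in> L2_space Q \<Longrightarrow>
    AE x in Q. T (\<lambda>x. f x + g x) x = T f x + T g x"
  and L2_operator_scale: "L2_operator Q T \<Longrightarrow> f \<in> L2_space Q \<Longrightarrow> AE x in Q. T (\<lambda>x. c * f x) x = c * T f x"
  by (auto simp: L2_operator_def)

lemma L2_operator_lincomb:
  assumes T: "L2_operator Q T" and f: "f \<in> L2_space Q" and g: "g \<in> L2_space Q"
  shows "AE x in Q. T (\<lambda>x. a * f x + b * g x) x = a * T f x + b * T g x"
  using L2_operator_add[OF T L2_scale[OF f, of a] L2_scale[OF g, of b]]
    L2_operator_scale[OF T f, of a] L2_operator_scale[OF T g, of b]
  by eventually_elim simp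

text \<open>T maps the difference f - g, which has norm 0, to a function of norm 0. Composing
  operators that are linear only almost everywhere rests on this.\<close>

lemma L2_operator_cong_AE:
  assumes T: "L2_operator Q T" and f: "f \<in> L2_space Q" and g: "g \<in> L2_space Q"
    and eq: "AE x in Q. f x = g x"
  shows "AE x in Q. T f x = T g x"
proof -
  define d where "d = (\<lambda>x. 1 * f x + (- 1) * g x)"
  have d: "d \<in> L2_space Q" unfolding d_def using f g by (rule L2_lincomb)
  have "L2_norm Q d = 0"
    using eq by (subst L2_norm_eq_0_iff[OF d]) (simp add: d_def)
  moreover obtain B where "L2_norm Q (T d) \<le> B * L2_norm Q d"
    using T d by (auto simp: L2_operator_def)
  ultimately have "L2_norm Q (T d) = 0"
    using L2_norm_nonneg[of Q "T d"] by simp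
  then have "AE x in Q. T d x = 0"
    using L2_norm_eq_0_iff[OF L2_operator_L2[OF T d]] by simp
  with L2_operator_lincomb[OF T f g, of 1 "- 1"] show ?thesis
    unfolding d_def by eventually_elim simp
qed

lemma L2_contraction_id: "L2_contraction Q id"
  by (auto simp: L2_contraction_def L2_operator_def intro!: exI[of _ 1])

lemma L2_contraction_comp:
  assumes S: "L2_contraction Q S" and T: "L2_contraction Q T"
  shows "L2_contraction Q (S \<circ> T)"
proof -
  have S': "L2_operator Q S" and T': "L2_operator Q T"
    using S T by (auto simp: L2_contraction_def)
  have norm: "L2_norm Q (S (T f)) \<le> L2_norm Q f" if "f \<in> L2_space Q" for f
    using S T L2_operator_L2[OF T' that] that unfolding L2_contraction_def by (meson order_trans)
  have "L2_operator Q (S \<circ> T)"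
    unfolding L2_operator_def
  proof (intro conjI ballI allI)
    fix f g c assume f: "f \<in> L2_space Q" and g: "g \<in> L2_space Q"
    note Tf = L2_operator_L2[OF T' f] and Tg = L2_operator_L2[OF T' g]
    show "AE x in Q. (S \<circ> T) (\<lambda>x. f x + g x) x = (S \<circ> T) f x + (S \<circ> T) g x"
      using L2_operator_cong_AE[OF S' L2_operator_L2[OF T' L2_add[OF f g]] L2_add[OF Tf Tg]
          L2_operator_add[OF T' f g]] L2_operator_add[OF S' Tf Tg]
      by eventually_elim simp
  next
    fix f c assume f: "f \<in> L2_space Q"
    note Tf = L2_operator_L2[OF T' f]
    show "(S \<circ> T) f \<in> L2_space Q"
      using L2_operator_L2[OF S' Tf] by simp
    show "AE x in Q. (S \<circ> T) (\<lambda>x. c * f x) x = c * (S \<circ> T) f x"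
      using L2_operator_cong_AE[OF S' L2_operator_L2[OF T' L2_scale[OF f]] L2_scale[OF Tf]
          L2_operator_scale[OF T' f, of c]] L2_operator_scale[OF S' Tf, of c]
      by eventually_elim simp
  qed (use norm in \<open>auto intro!: exI[of _ 1]\<close>)
  with norm show ?thesis by (simp add: L2_contraction_def)
qed

lemma L2_contraction_funpow: "L2_contraction Q T \<Longrightarrow> L2_contraction Q (T ^^ n)"
  by (induction n) (auto intro: L2_contraction_comp simp: L2_contraction_id)

section \<open>Resolvents outside the unit disc\<close>

lemma suminf_square_le:
  fixes w b :: "nat \<Rightarrow> real"
  assumes w: "\<And>n. 0 \<le> w n" "summable w" and b: "\<And>n. 0 \<le> b n" "summable (\<lambda>n. w n * (b n)\<^sup>2)"
  shows "summable (\<lambda>n. w n * b n)" "(\<Sum>n. w n * b n)\<^sup>2 \<le> (\<Sum>n. w n) * (\<Sum>n. w n * (b n)\<^sup>2)"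
proof -
  \<comment> \<open>The parameter s is left free: 2 s = 1 gives summability by comparison, and
    optimising over s gives the Cauchy-Schwarz bound.\<close>
  have le: "w n * b n * (2 * s) \<le> w n * (b n)\<^sup>2 + w n * s\<^sup>2" for n s
    using mult_left_mono[OF sum_squares_bound[of "b n" s] w(1)[of n]] by (simp add: algebra_simps)
  have sum2: "summable (\<lambda>n. w n * (b n)\<^sup>2 + w n * s\<^sup>2)" for s
    using b(2) w(2) by (intro summable_add summable_mult2)
  show s: "summable (\<lambda>n. w n * b n)"
  proof (rule summable_comparison_test')
    show "summable (\<lambda>n. w n * (b n)\<^sup>2 + w n * (1/2)\<^sup>2)" by (rule sum2)
    show "norm (w n * b n) \<le> w n * (b n)\<^sup>2 + w n * (1/2)\<^sup>2" for n
      using le[of n "1/2"] w(1)[of n] b(1)[of n] by simp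
  qed
  define B where "B = (\<Sum>n. w n * b n)"
  define c where "c = (\<Sum>n. w n)"
  define A where "A = (\<Sum>n. w n * (b n)\<^sup>2)"
  have key: "B * (2 * s) \<le> A + c * s\<^sup>2" for s
  proof -
    have "B * (2 * s) = (\<Sum>n. w n * b n * (2 * s))"
      unfolding B_def using s by (rule suminf_mult2)
    also have "\<dots> \<le> (\<Sum>n. w n * (b n)\<^sup>2 + w n * s\<^sup>2)"
      using s le sum2 by (intro suminf_le summable_mult2) auto
    also have "\<dots> = A + c * s\<^sup>2"
      unfolding A_def c_def using b(2) w(2) by (simp add: suminf_add[symmetric] suminf_mult2 summable_mult2)
    finally show ?thesis .
  qed
  have c: "0 \<le> c" unfolding c_def using w by (intro suminf_nonneg) auto
  have "B\<^sup>2 \<le> c * A"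
  proof (cases "c = 0")
    case True
    have "w n = 0" for n
      using w True unfolding c_def by (subst (asm) suminf_eq_zero_iff) auto
    then have "B = 0" by (simp add: B_def)
    then show ?thesis using True by simp
  next
    case False
    \<comment> \<open>s = B / c minimises the quadratic
      \<open>A + c * s\<^sup>2 - B * (2 * s)\<close>.\<close>
    then have "c * (B * (2 * (B / c))) \<le> c * (A + c * (B / c)\<^sup>2)"
      using key[of "B / c"] c by (intro mult_left_mono) auto
    moreover have "c * (B * (2 * (B / c))) = 2 * B\<^sup>2" "c * (A + c * (B / c)\<^sup>2) = c * A + B\<^sup>2"
      using False by (simp_all add: power2_eq_square distrib_left)
    ultimately show ?thesis by simp
  qed
  then show "(\<Sum>n. w n * b n)\<^sup>2 \<le> (\<Sum>n. w n) * (\<Sum>n. w n * (b n)\<^sup>2)"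
    by (simp add: A_def B_def c_def)
qed

text \<open>The resolvent of T at z as a pointwise series of representatives. Where the series
  diverges the value is unspecified; for a contraction, |z| > 1 and square integrable f this
  concerns only a null set.\<close>

definition neumann_series :: "(('a \<Rightarrow> complex) \<Rightarrow> ('a \<Rightarrow> complex)) \<Rightarrow> complex \<Rightarrow> ('a \<Rightarrow> complex) \<Rightarrow> 'a \<Rightarrow> complex" where
  "neumann_series T z f x = (\<Sum>n. (T ^^ n) f x / z ^ Suc n)"

locale contraction_resolvent =
  fixes Q :: "'a measure" and T :: "('a \<Rightarrow> complex) \<Rightarrow> ('a \<Rightarrow> complex)" and z :: complex
  assumes T: "L2_contraction Q T" and z: "1 < cmod z"
begin

lemma T_power_operator: "L2_operator Q (T ^^ n)"
  and T_power_norm: "f \<in> L2_space Q \<Longrightarrow> L2_norm Q ((T ^^ n) f) \<le> L2_norm Q f"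
  using L2_contraction_funpow[OF T, of n] by (auto simp: L2_contraction_def)

lemma T_operator: "L2_operator Q T"
  using T_power_operator[of 1] by simp

lemma T_power_L2: "f \<in> L2_space Q \<Longrightarrow> (T ^^ n) f \<in> L2_space Q"
  using L2_operator_L2[OF T_power_operator] .

definition weight :: "nat \<Rightarrow> real" where
  "weight n = 1 / cmod z ^ Suc n"

lemma weight_pos: "0 < weight n"
proof -
  have "0 < cmod z" using z by linarith
  then show ?thesis by (simp add: weight_def)
qed

lemma summable_weight: "summable weight"
proof -
  have "summable (\<lambda>n. (1 / cmod z) * (1 / cmod z) ^ n)"
    using z by (intro summable_mult summable_geometric) (simp add: norm_divide divide_less_eq)
  then show ?thesis by (simp add: weight_def[abs_def] power_one_over mult.commute)
qed

definition total_weight :: real where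
  "total_weight = (\<Sum>n. weight n)"

lemma total_weight_nonneg: "0 \<le> total_weight" unfolding total_weight_def using summable_weight weight_pos by (intro suminf_nonneg) (auto intro: less_imp_le)

text \<open>Tonelli and contractivity. Since |z| > 1 the weights are summable, so the weighted
  squares of the whole orbit have a finite integral, and therefore a finite sum at almost every
  point.\<close>

lemma nn_integral_weighted_orbit:
  assumes f: "f \<in> L2_space Q"
  shows "(\<integral>\<^sup>+x. (\<Sum>n. ennreal (weight n * (cmod ((T ^^ n) f x))\<^sup>2)) \<partial>Q) \<le> ennreal (total_weight * (L2_norm Q f)\<^sup>2)"
proof -
  have [measurable]: "(T ^^ n) f \<in> borel_measurable Q" for n
    using L2_measurable[OF T_power_L2[OF f]] .
  have "(\<integral>\<^sup>+x. (\<Sum>n. ennreal (weight n * (cmod ((T ^^ n) f x))\<^sup>2)) \<partial>Q)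
      = (\<Sum>n. \<integral>\<^sup>+x. ennreal (weight n * (cmod ((T ^^ n) f x))\<^sup>2) \<partial>Q)"
    by (intro nn_integral_suminf) measurable
  also have "\<dots> = (\<Sum>n. ennreal (weight n * (L2_norm Q ((T ^^ n) f))\<^sup>2))"
    using weight_pos by (simp add: ennreal_mult less_imp_le nn_integral_cmult nn_integral_L2[OF T_power_L2[OF f]])
  also have "\<dots> \<le> (\<Sum>n. ennreal (weight n * (L2_norm Q f)\<^sup>2))"
    using weight_pos T_power_norm[OF f]
    by (intro suminf_le ennreal_leI mult_left_mono power_mono L2_norm_nonneg) (auto intro: less_imp_le)
  also have "\<dots> = ennreal (\<Sum>n. weight n * (L2_norm Q f)\<^sup>2)"
    using weight_pos summable_weight by (intro suminf_ennreal2 summable_mult2) (auto simp: less_imp_le)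
  also have "(\<Sum>n. weight n * (L2_norm Q f)\<^sup>2) = total_weight * (L2_norm Q f)\<^sup>2"
    unfolding total_weight_def using summable_weight by (simp add: suminf_mult2)
  finally show ?thesis .
qed

lemma AE_weighted_orbit_summable:
  assumes f: "f \<in> L2_space Q"
  shows "AE x in Q. summable (\<lambda>n. weight n * (cmod ((T ^^ n) f x))\<^sup>2)"
proof -
  have [measurable]: "(T ^^ n) f \<in> borel_measurable Q" for n
    using L2_measurable[OF T_power_L2[OF f]] .
  have "AE x in Q. (\<Sum>n. ennreal (weight n * (cmod ((T ^^ n) f x))\<^sup>2)) \<noteq> \<infinity>"
    using nn_integral_weighted_orbit[OF f]
    by (intro nn_integral_noteq_infinite) (auto simp: top_unique)
  then show ?thesis
  proof eventually_elim
    fix x assume "(\<Sum>n. ennreal (weight n * (cmod ((T ^^ n) f x))\<^sup>2)) \<noteq> \<infinity>"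
    then show "summable (\<lambda>n. weight n * (cmod ((T ^^ n) f x))\<^sup>2)"
      using weight_pos by (intro summable_suminf_not_top) (auto simp: less_imp_le)
  qed
qed

lemma neumann_term_norm: "cmod ((T ^^ n) f x / z ^ Suc n) = weight n * cmod ((T ^^ n) f x)"
  by (simp add: weight_def norm_divide norm_mult norm_power)

lemma neumann_summable:
  assumes "summable (\<lambda>n. weight n * (cmod ((T ^^ n) f x))\<^sup>2)"
  shows "summable (\<lambda>n. (T ^^ n) f x / z ^ Suc n)"
proof (rule summable_norm_cancel)
  have "summable (\<lambda>n. weight n * cmod ((T ^^ n) f x))"
    by (rule suminf_square_le(1)[where w=weight and b="\<lambda>n. cmod ((T ^^ n) f x)", OF less_imp_le[OF weight_pos] summable_weight norm_ge_zero assms])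
  then show "summable (\<lambda>n. cmod ((T ^^ n) f x / z ^ Suc n))"
    by (simp only: neumann_term_norm)
qed

lemma neumann_square_le:
  assumes "summable (\<lambda>n. weight n * (cmod ((T ^^ n) f x))\<^sup>2)"
  shows "(cmod (neumann_series T z f x))\<^sup>2 \<le> total_weight * (\<Sum>n. weight n * (cmod ((T ^^ n) f x))\<^sup>2)"
proof -
  note * = suminf_square_le[where w=weight and b="\<lambda>n. cmod ((T ^^ n) f x)", OF less_imp_le[OF weight_pos] summable_weight norm_ge_zero assms]
  have "cmod (neumann_series T z f x) \<le> (\<Sum>n. weight n * cmod ((T ^^ n) f x))"
    unfolding neumann_series_def neumann_term_norm[symmetric]
    by (rule summable_norm) (use *(1) in \<open>simp only: neumann_term_norm\<close>)
  then have "(cmod (neumann_series T z f x))\<^sup>2 \<le> (\<Sum>n. weight n * cmod ((T ^^ n) f x))\<^sup>2"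
    by (intro power_mono) auto
  also note *(2)
  finally show ?thesis by (simp add: total_weight_def)
qed

lemma
  assumes f: "f \<in> L2_space Q"
  shows neumann_L2: "neumann_series T z f \<in> L2_space Q"
    and neumann_norm: "L2_norm Q (neumann_series T z f) \<le> total_weight * L2_norm Q f"
proof -
  have [measurable]: "(T ^^ n) f \<in> borel_measurable Q" for n
    using L2_measurable[OF T_power_L2[OF f]] .
  have meas: "neumann_series T z f \<in> borel_measurable Q"
    unfolding neumann_series_def by measurable
  have "(\<integral>\<^sup>+x. ennreal ((cmod (neumann_series T z f x))\<^sup>2) \<partial>Q)
      \<le> (\<integral>\<^sup>+x. ennreal total_weight * (\<Sum>n. ennreal (weight n * (cmod ((T ^^ n) f x))\<^sup>2)) \<partial>Q)"
  proof (rule nn_integral_mono_AE, use AE_weighted_orbit_summable[OF f] in eventually_elim)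
    fix x assume s: "summable (\<lambda>n. weight n * (cmod ((T ^^ n) f x))\<^sup>2)"
    have "(\<Sum>n. ennreal (weight n * (cmod ((T ^^ n) f x))\<^sup>2)) = ennreal (\<Sum>n. weight n * (cmod ((T ^^ n) f x))\<^sup>2)"
      using s weight_pos by (intro suminf_ennreal2) (auto simp: less_imp_le)
    then show "ennreal ((cmod (neumann_series T z f x))\<^sup>2) \<le> ennreal total_weight * (\<Sum>n. ennreal (weight n * (cmod ((T ^^ n) f x))\<^sup>2))"
      using neumann_square_le[OF s] total_weight_nonneg by (simp add: ennreal_mult'[symmetric] ennreal_leI)
  qed
  also have "\<dots> \<le> ennreal total_weight * ennreal (total_weight * (L2_norm Q f)\<^sup>2)"
    using nn_integral_weighted_orbit[OF f] by (subst nn_integral_cmult) (auto intro: mult_left_mono)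
  also have "\<dots> = ennreal ((total_weight * L2_norm Q f)\<^sup>2)"
    using total_weight_nonneg by (simp add: ennreal_mult'[symmetric] power2_eq_square mult_ac)
  finally show "neumann_series T z f \<in> L2_space Q" "L2_norm Q (neumann_series T z f) \<le> total_weight * L2_norm Q f"
    using L2_normI[OF meas] total_weight_nonneg L2_norm_nonneg[of Q f] by auto
qed

lemma neumann_operator: "L2_operator Q (neumann_series T z)"
  unfolding L2_operator_def
proof (intro conjI ballI allI)
  fix f g assume f: "f \<in> L2_space Q" and g: "g \<in> L2_space Q"
  \<comment> \<open>Each power is additive off its own null set; countably many of these are
    discarded at once.\<close>
  have "AE x in Q. \<forall>n. (T ^^ n) (\<lambda>x. f x + g x) x = (T ^^ n) f x + (T ^^ n) g x"
    using L2_operator_add[OF T_power_operator f g] by (simp add: AE_all_countable)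
  with AE_weighted_orbit_summable[OF f] AE_weighted_orbit_summable[OF g]
  show "AE x in Q. neumann_series T z (\<lambda>x. f x + g x) x = neumann_series T z f x + neumann_series T z g x"
    by eventually_elim
      (simp add: neumann_series_def add_divide_distrib suminf_add[symmetric] neumann_summable[simplified])
next
  fix f c assume f: "f \<in> L2_space Q"
  have "AE x in Q. \<forall>n. (T ^^ n) (\<lambda>x. c * f x) x = c * (T ^^ n) f x"
    using L2_operator_scale[OF T_power_operator f] by (simp add: AE_all_countable)
  with AE_weighted_orbit_summable[OF f]
  show "AE x in Q. neumann_series T z (\<lambda>x. c * f x) x = c * neumann_series T z f x"
  proof eventually_elim
    fix x assume "summable (\<lambda>n. weight n * (cmod ((T ^^ n) f x))\<^sup>2)"
      "\<forall>n. (T ^^ n) (\<lambda>x. c * f x) x = c * (T ^^ n) f x"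
    then show "neumann_series T z (\<lambda>x. c * f x) x = c * neumann_series T z f x"
      using suminf_mult[OF neumann_summable, of f x c] by (simp add: neumann_series_def)
  qed
  show "neumann_series T z f \<in> L2_space Q" using f by (rule neumann_L2)
qed (auto intro!: exI[of _ total_weight] neumann_norm)

text \<open>Splitting off the term n = 0 yields the left inverse R (z - T) = 1. The right inverse
  also needs T R = R T, and T, known only to be bounded in norm, cannot be taken through a pointwise
  series term by term.\<close>

lemma neumann_shift:
  assumes f: "f \<in> L2_space Q"
  shows "AE x in Q. neumann_series T z f x = (1 / z) * f x + (1 / z) * neumann_series T z (T f) x"
  using AE_weighted_orbit_summable[OF f]
proof eventually_elim
  fix x assume "summable (\<lambda>n. weight n * (cmod ((T ^^ n) f x))\<^sup>2)"
  then have s: "summable (\<lambda>n. (T ^^ n) f x / z ^ Suc n)" by (rule neumann_summable)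
  have "neumann_series T z f x = (T ^^ 0) f x / z ^ Suc 0 + (\<Sum>n. (T ^^ Suc n) f x / z ^ Suc (Suc n))"
    unfolding neumann_series_def using suminf_split_head[OF s] by simp
  also have "(\<Sum>n. (T ^^ Suc n) f x / z ^ Suc (Suc n)) = (\<Sum>n. (1 / z) * ((T ^^ n) (T f) x / z ^ Suc n))"
    by (simp add: funpow_swap1)
  also have "\<dots> = (1 / z) * neumann_series T z (T f) x"
  proof -
    \<comment> \<open>Summability of the series of \<open>T f\<close> at x is read off from the tail
      of the series of f, so no further exceptional set arises.\<close>
    have "summable (\<lambda>n. (T ^^ Suc n) f x / z ^ Suc (Suc n))"
      using s by (subst summable_Suc_iff)
    then have "summable (\<lambda>n. z * ((T ^^ Suc n) f x / z ^ Suc (Suc n)))"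
      by (rule summable_mult)
    also have "(\<lambda>n. z * ((T ^^ Suc n) f x / z ^ Suc (Suc n))) = (\<lambda>n. (T ^^ n) (T f) x / z ^ Suc n)"
      using z by (auto simp: funpow_swap1)
    finally show ?thesis
      unfolding neumann_series_def by (rule suminf_mult)
  qed
  finally show "neumann_series T z f x = (1 / z) * f x + (1 / z) * neumann_series T z (T f) x"
    by simp
qed

text \<open>
  The commutator \<open>E = T R - R T\<close> of \<open>T\<close> with the Neumann series \<open>R\<close> satisfies \<open>E = z\<^sup>-\<^sup>1 E T\<close>, and iterating this
  forces \<open>E = 0\<close> because \<open>E\<close> is bounded.
\<close>

lemma neumann_commute:
  assumes f: "f \<in> L2_space Q"
  shows "AE x in Q. T (neumann_series T z f) x = neumann_series T z (T f) x"
proof -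
  let ?R = "neumann_series T z"
  define E where "E g = (\<lambda>x. 1 * T (?R g) x + (- 1) * ?R (T g) x)" for g
  have TL2: "T g \<in> L2_space Q" if "g \<in> L2_space Q" for g
    using L2_operator_L2[OF T_operator that] .
  have Tn: "L2_norm Q (T g) \<le> L2_norm Q g" if "g \<in> L2_space Q" for g
    using T that by (simp add: L2_contraction_def)
  have E_L2: "E g \<in> L2_space Q" if "g \<in> L2_space Q" for g
    unfolding E_def using that by (intro L2_lincomb TL2 neumann_L2)
  have E_norm: "(L2_norm Q (E g))\<^sup>2 \<le> 4 * total_weight\<^sup>2 * (L2_norm Q g)\<^sup>2" if g: "g \<in> L2_space Q" for g
  proof -
    have "(L2_norm Q (E g))\<^sup>2 \<le> 2 * (L2_norm Q (T (?R g)))\<^sup>2 + 2 * (L2_norm Q (?R (T g)))\<^sup>2"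
      using L2_norm_add_square[OF L2_scale[OF TL2[OF neumann_L2[OF g]], of 1] L2_scale[OF neumann_L2[OF TL2[OF g]], of "- 1"]]
      unfolding E_def L2_norm_scale by simp
    also have "\<dots> \<le> 2 * (total_weight * L2_norm Q g)\<^sup>2 + 2 * (total_weight * L2_norm Q g)\<^sup>2"
    proof (intro add_mono mult_left_mono power_mono L2_norm_nonneg)
      show "L2_norm Q (T (?R g)) \<le> total_weight * L2_norm Q g"
        using Tn[OF neumann_L2[OF g]] neumann_norm[OF g] by simp
      show "L2_norm Q (?R (T g)) \<le> total_weight * L2_norm Q g"
        using neumann_norm[OF TL2[OF g]] mult_left_mono[OF Tn[OF g] total_weight_nonneg] by simp
    qed auto
    finally show ?thesis by (simp add: power_mult_distrib)
  qed
  \<comment> \<open>\<open>neumann_shift\<close> is used for g under T and again for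
    \<open>T g\<close>; the two terms \<open>T g / z\<close> cancel in the difference.\<close>
  have E_shift: "L2_norm Q (E g) = (1 / cmod z) * L2_norm Q (E (T g))" if g: "g \<in> L2_space Q" for g
  proof -
    have Rg: "?R g \<in> L2_space Q" and RTg: "?R (T g) \<in> L2_space Q"
      using g TL2 neumann_L2 by auto
    have "AE x in Q. T (?R g) x = T (\<lambda>x. (1 / z) * g x + (1 / z) * ?R (T g) x) x"
      using Rg RTg g by (intro L2_operator_cong_AE[OF T_operator] L2_lincomb neumann_shift)
    moreover have "AE x in Q. T (\<lambda>x. (1 / z) * g x + (1 / z) * ?R (T g) x) x = (1 / z) * T g x + (1 / z) * T (?R (T g)) x"
      using g RTg by (intro L2_operator_lincomb[OF T_operator])
    ultimately have "AE x in Q. E g x = (1 / z) * E (T g) x"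
      using neumann_shift[OF TL2[OF g]]
      unfolding E_def by eventually_elim (simp add: algebra_simps)
    then have "L2_norm Q (E g) = L2_norm Q (\<lambda>x. (1 / z) * E (T g) x)"
      using g by (intro L2_norm_cong_AE L2_scale E_L2 TL2)
    then show ?thesis
      unfolding L2_norm_scale by (simp add: norm_divide)
  qed
  have E_iter: "L2_norm Q (E f) = (1 / cmod z) ^ n * L2_norm Q (E ((T ^^ n) f))" for n
    by (induction n) (simp_all add: E_shift[OF T_power_L2[OF f]] mult_ac)
  \<comment> \<open>The bound on E is uniform along the orbit because T is a contraction, so the
    geometric factor decides.\<close>
  have "L2_norm Q (E f) \<le> (1 / cmod z) ^ n * (2 * total_weight * L2_norm Q f)" for n
  proof -
    have "(L2_norm Q (E ((T ^^ n) f)))\<^sup>2 \<le> (2 * total_weight * L2_norm Q ((T ^^ n) f))\<^sup>2"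
      using E_norm[OF T_power_L2[OF f]] by (simp add: power_mult_distrib)
    then have "L2_norm Q (E ((T ^^ n) f)) \<le> 2 * total_weight * L2_norm Q ((T ^^ n) f)"
      by (rule power2_le_imp_le) (simp add: total_weight_nonneg L2_norm_nonneg)
    also have "\<dots> \<le> 2 * total_weight * L2_norm Q f"
      using T_power_norm[OF f] total_weight_nonneg by (intro mult_left_mono) auto
    finally show ?thesis
      unfolding E_iter[of n] by (intro mult_left_mono) auto
  qed
  moreover have "(\<lambda>n. (1 / cmod z) ^ n * (2 * total_weight * L2_norm Q f)) \<longlonglongrightarrow> 0 * (2 * total_weight * L2_norm Q f)"
    using z by (intro tendsto_intros LIMSEQ_power_zero) (simp add: norm_divide divide_less_eq)
  ultimately have "L2_norm Q (E f) \<le> 0"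
    by (intro LIMSEQ_le_const[where X="\<lambda>n. (1 / cmod z) ^ n * (2 * total_weight * L2_norm Q f)"]) auto
  then have "AE x in Q. E f x = 0"
    using L2_norm_nonneg[of Q "E f"] L2_norm_eq_0_iff[OF E_L2[OF f]] by simp
  then show ?thesis
    unfolding E_def by eventually_elim simp
qed

lemma not_in_S\<^sub>2: "z \<notin> S\<^sub>2 Q T"
proof -
  let ?R = "neumann_series T z"
  have z0: "z \<noteq> 0" using z by auto
  have "AE x in Q. ?R (\<lambda>x. z * f x - T f x) x = f x" and "AE x in Q. z * ?R f x - T (?R f) x = f x"
    if f: "f \<in> L2_space Q" for f
  proof -
    have Tf: "T f \<in> L2_space Q" using L2_operator_L2[OF T_operator f] .
    have "AE x in Q. ?R (\<lambda>x. z * f x + (- 1) * T f x) x = z * ?R f x + (- 1) * ?R (T f) x"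
      using f Tf by (rule L2_operator_lincomb[OF neumann_operator])
    with neumann_shift[OF f] show "AE x in Q. ?R (\<lambda>x. z * f x - T f x) x = f x"
      using z0 by (auto simp: field_simps elim!: eventually_elim2)
    from neumann_shift[OF f] neumann_commute[OF f] show "AE x in Q. z * ?R f x - T (?R f) x = f x"
      by eventually_elim (use z0 in \<open>simp add: field_simps\<close>)
  qed
  then show ?thesis
    using neumann_operator unfolding S\<^sub>2_def by blast
qed

end

section \<open>Bounds for the spectral gap, attained maxima, adjoints\<close>

lemma spectral_gap_contraction:
  assumes T: "L2_contraction Q T"
  shows "0 \<le> spectral_gap Q T" "spectral_gap Q T \<le> 2"
proof -
  define \<Lambda> where "\<Lambda> = {r::real. complex_of_real r \<in> S\<^sub>2 Q T \<and> r \<noteq> 1}"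
  \<comment> \<open>Off the closed unit disc the Neumann series is a bounded inverse. The resulting
    upper bound 2 on the gap is what later makes the maximum over k exist.\<close>
  have "\<bar>r\<bar> \<le> 1" if "r \<in> \<Lambda>" for r
    using contraction_resolvent.not_in_S\<^sub>2[OF contraction_resolvent.intro[OF T], of "complex_of_real r"] that by (auto simp: \<Lambda>_def not_less[symmetric])
  then have b: "- 1 \<le> r" "r \<le> 1" if "r \<in> \<Lambda>" for r
    using that by (auto simp: abs_le_iff)
  have "- 1 \<le> Sup \<Lambda> \<and> Sup \<Lambda> \<le> 1" if nonempty: "\<Lambda> \<noteq> {}"
  proof -
    obtain r where r: "r \<in> \<Lambda>" using nonempty by auto
    have "r \<le> Sup \<Lambda>" using r b by (intro cSup_upper bdd_aboveI[of _ 1])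
    moreover have "Sup \<Lambda> \<le> 1" using nonempty b by (intro cSup_least)
    ultimately show ?thesis using b[OF r] by simp
  qed
  then show "0 \<le> spectral_gap Q T" "spectral_gap Q T \<le> 2"
    by (auto simp: spectral_gap_def Let_def \<Lambda>_def[symmetric])
qed

text \<open>
  \<open>GREATEST\<close> is unspecified unless a maximum exists; here boundedness of \<open>c\<close> makes \<open>c k / k\<close> attain one.
\<close>

lemma Greatest_ratio_nonneg:
  fixes c :: "nat \<Rightarrow> real"
  assumes c: "\<And>k. 0 \<le> c k" "\<And>k. c k \<le> C"
  shows "0 \<le> (GREATEST r. \<exists>k\<ge>1. r = c k / real k)"
proof -
  have "\<exists>k\<ge>1. \<forall>j\<ge>1. c j / real j \<le> c k / real k"
  proof (cases "\<exists>k\<ge>1. c k \<noteq> 0")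
    case True
    then obtain k where k: "k \<ge> 1" "c k > 0" using c(1) by (metis less_le)
    \<comment> \<open>For j > n the quotient is at most \<open>C / j \<le> c k / k\<close>, so a
      maximiser over the finite range {1..n} is global; the summand k puts k itself into that
      range.\<close>
    define n where "n = nat \<lceil>C * real k / c k\<rceil> + k"
    have "\<exists>i\<in>{1..n}. \<forall>j\<in>{1..n}. c j / real j \<le> c i / real i"
    proof -
      have "Max ((\<lambda>j. c j / real j) ` {1..n}) \<in> (\<lambda>j. c j / real j) ` {1..n}"
        using k by (intro Max_in) (auto simp: n_def)
      then obtain i where i: "i \<in> {1..n}" "Max ((\<lambda>j. c j / real j) ` {1..n}) = c i / real i" by auto
      have "c j / real j \<le> Max ((\<lambda>j. c j / real j) ` {1..n})" if "j \<in> {1..n}" for j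
        using that by (intro Max_ge) auto
      then show ?thesis
        using i by (intro bexI[of _ i] ballI) metis+
    qed
    then obtain i where i: "i \<in> {1..n}" "\<And>j. j \<in> {1..n} \<Longrightarrow> c j / real j \<le> c i / real i" by auto
    have "c j / real j \<le> c i / real i" if "j \<ge> 1" for j
    proof (cases "j \<le> n")
      case True
      then show ?thesis using i that by auto
    next
      case False
      then have "C * real k / c k \<le> real j" unfolding n_def by linarith
      then have "C / real j \<le> c k / real k"
        using k that by (simp add: field_simps)
      moreover have "c j / real j \<le> C / real j"
        using c(2) by (simp add: divide_right_mono)
      moreover have "c k / real k \<le> c i / real i"
        using k by (intro i) (auto simp: n_def)
      ultimately show ?thesis by linarith
    qed
    then show ?thesis using i(1) by auto
  qed auto
  then obtain k where k: "k \<ge> 1" "\<And>j. j \<ge> 1 \<Longrightarrow> c j / real j \<le> c k / real k" by auto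
  then have "(GREATEST r. \<exists>k\<ge>1. r = c k / real k) = c k / real k"
    by (intro Greatest_equality) auto
  then show ?thesis using c(1)[of k] by simp
qed

text \<open>Choosing some h for every g gives a map that need not be linear at every point. Adjoint
  functions are unique almost everywhere (test the difference against itself), and this forces
  linearity almost everywhere.\<close>

lemma L2_adjointI:
  assumes T: "L2_contraction Q T"
    and ex: "\<And>g. g \<in> L2_space Q \<Longrightarrow> \<exists>h\<in>L2_space Q. \<forall>f\<in>L2_space Q. L2_inner Q (T f) g = L2_inner Q f h"
  shows "L2_contraction Q (L2_adjoint Q T)"
proof -
  let ?adj = "\<lambda>T'. \<forall>f\<in>L2_space Q. \<forall>g\<in>L2_space Q. L2_inner Q (T f) g = L2_inner Q f (T' g)"
  have T': "L2_operator Q T" using T by (simp add: L2_contraction_def)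
  \<comment> \<open>From \<open>L2_inner Q (A g) (A g) = L2_inner Q (T (A g)) g\<close> and
    Cauchy-Schwarz. It is stated for an arbitrary adjoint A because it serves both the constructed
    witness and whatever \<open>SOME\<close> returns.\<close>
  have norm: "L2_norm Q (A g) \<le> L2_norm Q g"
    if A: "\<And>g. g \<in> L2_space Q \<Longrightarrow> A g \<in> L2_space Q" "?adj A" and g: "g \<in> L2_space Q" for A g
  proof -
    have "(L2_norm Q (A g))\<^sup>2 = cmod (L2_inner Q (A g) (A g))"
      using A g by (simp add: L2_inner_self norm_power L2_norm_nonneg)
    also have "\<dots> = cmod (L2_inner Q (T (A g)) g)"
      using A g by simp
    also have "\<dots> \<le> L2_norm Q (T (A g)) * L2_norm Q g"
      using A g L2_operator_L2[OF T'] by (intro L2_Cauchy_Schwarz) auto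
    also have "\<dots> \<le> L2_norm Q (A g) * L2_norm Q g"
      using T A g by (intro mult_right_mono L2_norm_nonneg) (auto simp: L2_contraction_def)
    finally show ?thesis
      using L2_norm_nonneg[of Q "A g"] L2_norm_nonneg[of Q g]
      by (cases "L2_norm Q (A g) = 0") (auto simp: power2_eq_square)
  qed
  obtain A where A: "\<And>g. g \<in> L2_space Q \<Longrightarrow> A g \<in> L2_space Q"
    and adj: "\<And>f g. f \<in> L2_space Q \<Longrightarrow> g \<in> L2_space Q \<Longrightarrow> L2_inner Q (T f) g = L2_inner Q f (A g)"
  proof -
    have "\<forall>g\<in>L2_space Q. \<exists>h. h \<in> L2_space Q \<and> (\<forall>f\<in>L2_space Q. L2_inner Q (T f) g = L2_inner Q f h)"
      using ex by blast
    from bchoice[OF this] obtain A where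
      "\<forall>g\<in>L2_space Q. A g \<in> L2_space Q \<and> (\<forall>f\<in>L2_space Q. L2_inner Q (T f) g = L2_inner Q f (A g))" ..
    then show thesis by (intro that[of A]) blast+
  qed
  have unique: "AE x in Q. h x = h' x"
    if h: "h \<in> L2_space Q" "h' \<in> L2_space Q" and eq: "\<And>f. f \<in> L2_space Q \<Longrightarrow> L2_inner Q f h = L2_inner Q f h'" for h h'
  proof -
    define d where "d = (\<lambda>x. h x + (- 1) * h' x)"
    have h'': "(\<lambda>x. (- 1) * h' x) \<in> L2_space Q" using h by (intro L2_scale)
    have d: "d \<in> L2_space Q" unfolding d_def using h(1) h'' by (rule L2_add)
    have "L2_inner Q d d = L2_inner Q d h + L2_inner Q d (\<lambda>x. (- 1) * h' x)"
      using L2_inner_add_right[OF h(1) h'' d] by (simp add: d_def)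
    also have "\<dots> = 0"
      using eq[OF d] by (subst L2_inner_scale_right) simp
    finally have "L2_norm Q d = 0" by (simp add: L2_inner_self[OF d])
    then show ?thesis
      using L2_norm_eq_0_iff[OF d] by (simp add: d_def)
  qed
  have "L2_operator Q A"
    unfolding L2_operator_def
  proof (intro conjI ballI allI)
    fix f g assume fg: "f \<in> L2_space Q" "g \<in> L2_space Q"
    show "AE x in Q. A (\<lambda>x. f x + g x) x = A f x + A g x"
      using fg A L2_operator_L2[OF T']
      by (intro unique) (simp_all add: L2_add L2_inner_add_right flip: adj)
  next
    fix f c assume f: "f \<in> L2_space Q"
    show "AE x in Q. A (\<lambda>x. c * f x) x = c * A f x"
      using f A by (intro unique) (simp_all add: L2_scale L2_inner_scale_right flip: adj)
    show "A f \<in> L2_space Q" using f by (rule A)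
  qed (use norm[of A] A adj in \<open>auto intro!: exI[of _ 1]\<close>)
  then have "L2_operator Q (L2_adjoint Q T) \<and> ?adj (L2_adjoint Q T)"
    unfolding L2_adjoint_def using adj by (intro someI[of "\<lambda>T'. L2_operator Q T' \<and> ?adj T'" A]) blast
  then show ?thesis
    using norm[of "L2_adjoint Q T"] by (auto simp: L2_contraction_def L2_operator_L2)
qed

section \<open>The pseudo spectral gap\<close>

locale invariant_kernel = markov_kernel_law +
  assumes Q_invariant: "Q \<bind> K = Q"
begin

lemma borel_measurable_Q: "borel_measurable Q = borel_measurable S"
  using measurable_cong_sets[OF sets_Q refl] .

lemma K_subprob_Q: "K \<in> Q \<rightarrow>\<^sub>M subprob_algebra S"
  using K_subprob measurable_cong_sets[OF sets_Q refl] by blast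

lemma measurable_K: "x \<in> space S \<Longrightarrow> f \<in> borel_measurable S \<Longrightarrow> f \<in> borel_measurable (K x)"
  using measurable_cong_sets[OF sets_K refl] by blast

lemma nn_integral_K_measurable:
  "f \<in> borel_measurable S \<Longrightarrow> (\<lambda>x. \<integral>\<^sup>+y. f y \<partial>K x) \<in> borel_measurable S"
  by (rule measurable_compose[OF K_subprob nn_integral_measurable_subprob_algebra])

lemma integral_K_measurable:
  fixes f :: "'a \<Rightarrow> 'b::{banach, second_countable_topology}"
  shows "f \<in> borel_measurable S \<Longrightarrow> (\<lambda>x. \<integral>y. f y \<partial>K x) \<in> borel_measurable S"
  by (rule measurable_compose[OF K_subprob integral_measurable_subprob_algebra])

lemma nn_integral_invariant:
  assumes "f \<in> borel_measurable S"
  shows "(\<integral>\<^sup>+x. (\<integral>\<^sup>+y. f y \<partial>K x) \<partial>Q) = (\<integral>\<^sup>+x. f x \<partial>Q)"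
  using nn_integral_bind[OF assms K_subprob_Q] Q_invariant by simp

lemma nn_integral_K_square_le:
  assumes x: "x \<in> space S" and f: "f \<in> borel_measurable S"
  shows "(\<integral>\<^sup>+y. f y \<partial>K x)\<^sup>2 \<le> (\<integral>\<^sup>+y. (f y)\<^sup>2 \<partial>K x)"
  using Cauchy_Schwarz_nn_integral[OF measurable_K[OF x f], of "\<lambda>_. 1"]
    prob_space.emeasure_space_1[OF prob_space_K[OF x]]
  by simp

text \<open>The Bochner integral of a non-integrable function is 0, so additivity of
  \<open>kernel_operator K\<close> requires integrability under \<open>K x\<close>; invariance of Q
  provides it for almost every x.\<close>

lemma AE_integrable_K:
  fixes f :: "'a \<Rightarrow> complex"
  assumes f: "f \<in> L2_space Q"
  shows "AE x in Q. integrable (K x) f"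
proof -
  have fm: "f \<in> borel_measurable S"
    using L2_measurable[OF f] borel_measurable_Q by simp
  then have m: "(\<lambda>y. ennreal ((cmod (f y))\<^sup>2)) \<in> borel_measurable S" by measurable
  have "(\<integral>\<^sup>+x. (\<integral>\<^sup>+y. ennreal ((cmod (f y))\<^sup>2) \<partial>K x) \<partial>Q) \<noteq> \<infinity>"
    unfolding nn_integral_invariant[OF m] nn_integral_L2[OF f] by simp
  then have "AE x in Q. (\<integral>\<^sup>+y. ennreal ((cmod (f y))\<^sup>2) \<partial>K x) \<noteq> \<infinity>"
    using nn_integral_K_measurable[OF m] borel_measurable_Q by (intro nn_integral_noteq_infinite) auto
  then show ?thesis
    using AE_space
  proof eventually_elim
    fix x assume fin: "(\<integral>\<^sup>+y. ennreal ((cmod (f y))\<^sup>2) \<partial>K x) \<noteq> \<infinity>" and "x \<in> space Q"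
    then have x: "x \<in> space S" by simp
    interpret Kx: prob_space "K x" using x by (rule prob_space_K)
    have fx: "f \<in> borel_measurable (K x)" using x fm by (rule measurable_K)
    then have "integrable (K x) (\<lambda>y. (cmod (f y))\<^sup>2)"
      using fin by (intro integrableI_bounded) (auto simp: less_top)
    then have "integrable (K x) (\<lambda>y. 1 + (cmod (f y))\<^sup>2)"
      by (intro Bochner_Integration.integrable_add) auto
    then show "integrable (K x) f"
    proof (rule Bochner_Integration.integrable_bound)
      show "AE y in K x. norm (f y) \<le> norm (1 + (cmod (f y))\<^sup>2)"
      proof (rule AE_I2)
        fix y
        have "2 * cmod (f y) \<le> 1 + (cmod (f y))\<^sup>2"
          using sum_squares_bound[of 1 "cmod (f y)"] by simp
        then have "cmod (f y) \<le> 1 + (cmod (f y))\<^sup>2"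
          using norm_ge_zero[of "f y"] by linarith
        then show "norm (f y) \<le> norm (1 + (cmod (f y))\<^sup>2)" by simp
      qed
    qed (rule fx)
  qed
qed

text \<open>The square of an average is at most the average of the square under \<open>K x\<close>;
  integrating over the invariant Q then removes K.\<close>

lemma kernel_operator_contraction: "L2_contraction Q (kernel_operator K)"
proof -
  have *: "kernel_operator K f \<in> L2_space Q \<and> L2_norm Q (kernel_operator K f) \<le> L2_norm Q f"
    if f: "f \<in> L2_space Q" for f
  proof -
    have fm: "f \<in> borel_measurable S"
      using L2_measurable[OF f] borel_measurable_Q by simp
    then have m: "(\<lambda>y. ennreal ((cmod (f y))\<^sup>2)) \<in> borel_measurable S" by measurable
    have Kf: "kernel_operator K f \<in> borel_measurable Q"
      unfolding kernel_operator_def borel_measurable_Q using fm by (rule integral_K_measurable)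
    have "(\<integral>\<^sup>+x. ennreal ((cmod (kernel_operator K f x))\<^sup>2) \<partial>Q)
        \<le> (\<integral>\<^sup>+x. (\<integral>\<^sup>+y. ennreal ((cmod (f y))\<^sup>2) \<partial>K x) \<partial>Q)"
    proof (rule nn_integral_mono_AE, use AE_integrable_K[OF f] AE_space in eventually_elim)
      fix x assume int: "integrable (K x) f" and "x \<in> space Q"
      then have x: "x \<in> space S" by simp
      have "ennreal (cmod (kernel_operator K f x)) \<le> (\<integral>\<^sup>+y. ennreal (cmod (f y)) \<partial>K x)"
        unfolding kernel_operator_def using int by (rule integral_norm_bound_ennreal)
      then have "(ennreal (cmod (kernel_operator K f x)))\<^sup>2 \<le> (\<integral>\<^sup>+y. ennreal (cmod (f y)) \<partial>K x)\<^sup>2"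
        by (intro power_mono) auto
      also have "\<dots> \<le> (\<integral>\<^sup>+y. (ennreal (cmod (f y)))\<^sup>2 \<partial>K x)"
        using fm by (intro nn_integral_K_square_le[OF x]) measurable
      finally show "ennreal ((cmod (kernel_operator K f x))\<^sup>2) \<le> (\<integral>\<^sup>+y. ennreal ((cmod (f y))\<^sup>2) \<partial>K x)"
        by (simp add: ennreal_power)
    qed
    also have "\<dots> = ennreal ((L2_norm Q f)\<^sup>2)"
      unfolding nn_integral_invariant[OF m] nn_integral_L2[OF f] ..
    finally show ?thesis
      using L2_normI[OF Kf] L2_norm_nonneg[of Q f] by simp
  qed
  have "L2_operator Q (kernel_operator K)"
    unfolding L2_operator_def
  proof (intro conjI ballI allI)
    fix f g assume f: "f \<in> L2_space Q" and g: "g \<in> L2_space Q"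
    show "AE x in Q. kernel_operator K (\<lambda>x. f x + g x) x = kernel_operator K f x + kernel_operator K g x"
      using AE_integrable_K[OF f] AE_integrable_K[OF g]
      by eventually_elim (simp add: kernel_operator_def)
  qed (use * in \<open>auto simp: kernel_operator_def intro!: exI[of _ 1]\<close>)
  with * show ?thesis by (simp add: L2_contraction_def)
qed

text \<open>On nonnegative functions the adjoint is the Radon-Nikodym density of \<open>(gQ)K\<close> with respect to \<open>Q\<close>.\<close>

lemma reversed_density:
  fixes g :: "'a \<Rightarrow> real"
  assumes g: "g \<in> borel_measurable S" "\<And>x. 0 \<le> g x" "(\<integral>\<^sup>+x. ennreal ((g x)\<^sup>2) \<partial>Q) < \<infinity>"
  obtains h :: "'a \<Rightarrow> real" where "h \<in> borel_measurable S" "\<And>x. 0 \<le> h x"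
    "(\<integral>\<^sup>+x. ennreal ((h x)\<^sup>2) \<partial>Q) < \<infinity>"
    "\<And>f. f \<in> borel_measurable S \<Longrightarrow>
      (\<integral>\<^sup>+x. ennreal (h x) * f x \<partial>Q) = (\<integral>\<^sup>+x. ennreal (g x) * (\<integral>\<^sup>+y. f y \<partial>K x) \<partial>Q)"
proof -
  note [measurable] = g(1)
  define G where "G = (\<integral>\<^sup>+x. ennreal ((g x)\<^sup>2) \<partial>Q)"
  define R where "R = density Q (\<lambda>x. ennreal (g x))"
  define \<nu> where "\<nu> = R \<bind> K"
  have sets_R: "sets R = sets S" by (simp add: R_def)
  have KR: "K \<in> R \<rightarrow>\<^sub>M subprob_algebra S"
    using K_subprob measurable_cong_sets[OF sets_R refl] by blast
  have space_R: "space R = space S" using sets_R by (rule sets_eq_imp_space_eq)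
  have sets_\<nu>: "sets \<nu> = sets Q"
    unfolding \<nu>_def using Q.not_empty by (subst sets_bind[where N=S]) (auto simp: sets_K space_R)
  have \<nu>: "(\<integral>\<^sup>+x. f x \<partial>\<nu>) = (\<integral>\<^sup>+x. ennreal (g x) * (\<integral>\<^sup>+y. f y \<partial>K x) \<partial>Q)"
    if f: "f \<in> borel_measurable S" for f :: "'a \<Rightarrow> ennreal"
  proof -
    have "(\<integral>\<^sup>+x. f x \<partial>\<nu>) = (\<integral>\<^sup>+x. (\<integral>\<^sup>+y. f y \<partial>K x) \<partial>R)"
      unfolding \<nu>_def using f KR by (rule nn_integral_bind)
    also have "\<dots> = (\<integral>\<^sup>+x. ennreal (g x) * (\<integral>\<^sup>+y. f y \<partial>K x) \<partial>Q)"
      unfolding R_def using nn_integral_K_measurable[OF f]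
      by (intro nn_integral_density) (auto simp: borel_measurable_Q)
    finally show ?thesis .
  qed
  \<comment> \<open>By invariance a Q-null set is reached with probability 0 from almost every
    state, and weighting the states by g cannot change that.\<close>
  have ac: "absolutely_continuous Q \<nu>"
    unfolding absolutely_continuous_def
  proof
    fix A assume A: "A \<in> null_sets Q"
    then have AS: "A \<in> sets S" by (auto simp: null_sets_def)
    then have ind: "(indicator A :: 'a \<Rightarrow> ennreal) \<in> borel_measurable S" by simp
    have "(\<integral>\<^sup>+x. (\<integral>\<^sup>+y. indicator A y \<partial>K x) \<partial>Q) = 0"
      unfolding nn_integral_invariant[OF ind] using A AS by (simp add: null_sets_def)
    then have "AE x in Q. (\<integral>\<^sup>+y. indicator A y \<partial>K x) = 0"
      using nn_integral_K_measurable[OF ind] by (subst (asm) nn_integral_0_iff_AE) (auto simp: borel_measurable_Q)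
    then have "(\<integral>\<^sup>+x. ennreal (g x) * (\<integral>\<^sup>+y. indicator A y \<partial>K x) \<partial>Q) = (\<integral>\<^sup>+x. 0 \<partial>Q)"
      by (intro nn_integral_cong_AE) auto
    then have "(\<integral>\<^sup>+x. indicator A x \<partial>\<nu>) = 0"
      using \<nu>[OF ind] by simp
    then show "A \<in> null_sets \<nu>"
      using AS sets_\<nu> by (simp add: null_sets_def)
  qed
  define h' where "h' = RN_deriv Q \<nu>"
  have h'_measurable[measurable]: "h' \<in> borel_measurable S"
    unfolding h'_def using borel_measurable_RN_deriv[of Q \<nu>] borel_measurable_Q by blast
  have h': "(\<integral>\<^sup>+x. h' x * f x \<partial>Q) = (\<integral>\<^sup>+x. ennreal (g x) * (\<integral>\<^sup>+y. f y \<partial>K x) \<partial>Q)"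
    if f: "f \<in> borel_measurable S" for f
    using Q.RN_deriv_nn_integral[OF ac sets_\<nu>, of f] f \<nu>[OF f] by (simp add: h'_def borel_measurable_Q)
  \<comment> \<open>The total mass of the density is that of g, which is finite because g is at most
    1 + g^2; so the density is finite almost everywhere and may be taken real.\<close>
  have "(\<integral>\<^sup>+x. h' x \<partial>Q) = (\<integral>\<^sup>+x. ennreal (g x) \<partial>Q)"
  proof -
    have "(\<integral>\<^sup>+x. h' x \<partial>Q) = (\<integral>\<^sup>+x. ennreal (g x) * (\<integral>\<^sup>+y. 1 \<partial>K x) \<partial>Q)"
      using h'[of "\<lambda>_. 1"] by simp
    also have "\<dots> = (\<integral>\<^sup>+x. ennreal (g x) \<partial>Q)"
      using prob_space.emeasure_space_1[OF prob_space_K] by (intro nn_integral_cong) simp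
    finally show ?thesis .
  qed
  also have "\<dots> \<le> (\<integral>\<^sup>+x. 1 + ennreal ((g x)\<^sup>2) \<partial>Q)"
  proof (rule nn_integral_mono)
    fix x
    have "g x \<le> 1 + (g x)\<^sup>2" using sum_squares_bound[of 1 "g x"] g(2)[of x] by simp
    then have "ennreal (g x) \<le> ennreal (1 + (g x)\<^sup>2)" by (rule ennreal_leI)
    then show "ennreal (g x) \<le> 1 + ennreal ((g x)\<^sup>2)" by simp
  qed
  also have "\<dots> < \<infinity>"
    using g(3) by (subst nn_integral_add) (auto simp: Q.emeasure_space_1[simplified] less_top[symmetric])
  finally have "AE x in Q. h' x \<noteq> \<infinity>"
    by (intro nn_integral_noteq_infinite) auto
  define h where "h x = enn2real (h' x)" for x
  have h_measurable[measurable]: "h \<in> borel_measurable S"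
    unfolding h_def by measurable
  have h_eq: "AE x in Q. ennreal (h x) = h' x"
    using \<open>AE x in Q. h' x \<noteq> \<infinity>\<close> by eventually_elim (simp add: h_def less_top)
  have h: "(\<integral>\<^sup>+x. ennreal (h x) * f x \<partial>Q) = (\<integral>\<^sup>+x. ennreal (g x) * (\<integral>\<^sup>+y. f y \<partial>K x) \<partial>Q)"
    if f: "f \<in> borel_measurable S" for f
  proof -
    have "(\<integral>\<^sup>+x. ennreal (h x) * f x \<partial>Q) = (\<integral>\<^sup>+x. h' x * f x \<partial>Q)"
      using h_eq by (intro nn_integral_cong_AE) auto
    then show ?thesis using h'[OF f] by simp
  qed
  have h_nonneg: "0 \<le> h x" for x by (simp add: h_def)
  \<comment> \<open>Truncation makes I finite, so that it can be cancelled: with u the truncated h,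
    I is at most the integral of h u, which is that of g times K u. Cauchy-Schwarz and invariance
    give I * I \<le> G * I, and the limit in n is monotone.\<close>
  have trunc: "(\<integral>\<^sup>+x. ennreal ((min (h x) (real n))\<^sup>2) \<partial>Q) \<le> G" for n
  proof -
    define u where "u x = ennreal (min (h x) (real n))" for x
    have u[measurable]: "u \<in> borel_measurable S" unfolding u_def by measurable
    define I where "I = (\<integral>\<^sup>+x. (u x)\<^sup>2 \<partial>Q)"
    have u_nonneg: "0 \<le> min (h x) (real n)" for x using h_nonneg[of x] by simp
    have "I \<le> (\<integral>\<^sup>+x. (ennreal (real n))\<^sup>2 \<partial>Q)"
      unfolding I_def u_def by (intro nn_integral_mono power_mono ennreal_leI) auto
    also have "\<dots> = (ennreal (real n))\<^sup>2"
      using Q.emeasure_space_1 by simp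
    also have "\<dots> < \<infinity>" by (simp add: ennreal_power)
    finally have I_fin: "I < \<infinity>" .
    have "I \<le> (\<integral>\<^sup>+x. ennreal (h x) * u x \<partial>Q)"
      unfolding I_def power2_eq_square using u_nonneg
      by (intro nn_integral_mono mult_right_mono) (auto simp: u_def intro!: ennreal_leI)
    also have "\<dots> = (\<integral>\<^sup>+x. ennreal (g x) * (\<integral>\<^sup>+y. u y \<partial>K x) \<partial>Q)"
      using u by (rule h)
    finally have "I\<^sup>2 \<le> (\<integral>\<^sup>+x. ennreal (g x) * (\<integral>\<^sup>+y. u y \<partial>K x) \<partial>Q)\<^sup>2"
      by (intro power_mono) auto
    also have "\<dots> \<le> (\<integral>\<^sup>+x. (ennreal (g x))\<^sup>2 \<partial>Q) * (\<integral>\<^sup>+x. (\<integral>\<^sup>+y. u y \<partial>K x)\<^sup>2 \<partial>Q)"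
      using nn_integral_K_measurable[OF u]
      by (intro Cauchy_Schwarz_nn_integral) (auto simp: borel_measurable_Q)
    also have "\<dots> \<le> G * (\<integral>\<^sup>+x. (\<integral>\<^sup>+y. (u y)\<^sup>2 \<partial>K x) \<partial>Q)"
      unfolding G_def using g(2) nn_integral_K_square_le[OF _ u]
      by (intro mult_mono nn_integral_mono) (auto simp: ennreal_power)
    also have "(\<integral>\<^sup>+x. (\<integral>\<^sup>+y. (u y)\<^sup>2 \<partial>K x) \<partial>Q) = I"
      unfolding I_def by (intro nn_integral_invariant) measurable
    finally have sq: "I * I \<le> G * I" by (simp add: power2_eq_square)
    have "I \<le> G"
    proof (cases "I = 0")
      case False
      then show ?thesis
        using sq I_fin ennreal_mult_le_mult_iff[of I I G] by (simp add: mult.commute)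
    qed simp
    then show ?thesis
      unfolding I_def u_def using u_nonneg by (simp add: ennreal_power)
  qed
  have "(\<lambda>n. \<integral>\<^sup>+x. ennreal ((min (h x) (real n))\<^sup>2) \<partial>Q) \<longlonglongrightarrow> (\<integral>\<^sup>+x. ennreal ((h x)\<^sup>2) \<partial>Q)"
  proof (rule nn_integral_LIMSEQ)
    show "incseq (\<lambda>n x. ennreal ((min (h x) (real n))\<^sup>2))"
      using h_nonneg by (auto simp: incseq_def le_fun_def intro!: ennreal_leI power_mono)
    show "(\<lambda>n. ennreal ((min (h x) (real n))\<^sup>2)) \<longlonglongrightarrow> ennreal ((h x)\<^sup>2)" for x
    proof (rule tendsto_eventually)
      show "\<forall>\<^sub>F n in sequentially. ennreal ((min (h x) (real n))\<^sup>2) = ennreal ((h x)\<^sup>2)"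
        using eventually_ge_at_top[of "nat \<lceil>h x\<rceil>"]
      proof eventually_elim
        fix n assume "nat \<lceil>h x\<rceil> \<le> n"
        then have "h x \<le> real n" by linarith
        then show "ennreal ((min (h x) (real n))\<^sup>2) = ennreal ((h x)\<^sup>2)" by simp
      qed
    qed
  qed measurable
  then have "(\<integral>\<^sup>+x. ennreal ((h x)\<^sup>2) \<partial>Q) \<le> G"
    by (rule LIMSEQ_le_const2) (use trunc in blast)
  also have "G < \<infinity>" using g(3) by (simp add: G_def)
  finally show thesis
    using h h_nonneg h_measurable by (intro that[of h])
qed

text \<open>Both sides are linear in f and conjugate linear in g, so nonnegative real f and g
  suffice; there the claim is the defining identity of the reversed density, read through
  nonnegative integrals.\<close>

lemma kernel_operator_adjoint_exists:
  assumes g: "g \<in> L2_space Q"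
  shows "\<exists>h\<in>L2_space Q. \<forall>f\<in>L2_space Q. L2_inner Q (kernel_operator K f) g = L2_inner Q f h"
  using g
proof (induction g rule: L2_nonneg_induct)
  case (add g1 g2)
  then obtain h1 h2 where h: "h1 \<in> L2_space Q" "h2 \<in> L2_space Q"
    "\<And>f. f \<in> L2_space Q \<Longrightarrow> L2_inner Q (kernel_operator K f) g1 = L2_inner Q f h1"
    "\<And>f. f \<in> L2_space Q \<Longrightarrow> L2_inner Q (kernel_operator K f) g2 = L2_inner Q f h2" by blast
  have KL2: "kernel_operator K f \<in> L2_space Q" if "f \<in> L2_space Q" for f
    using kernel_operator_contraction that by (auto simp: L2_contraction_def intro: L2_operator_L2)
  show ?case
    using h add.hyps KL2 by (intro bexI[of _ "\<lambda>x. h1 x + h2 x"] ballI L2_add) (simp_all add: L2_inner_add_right)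
next
  case (scale g c)
  then obtain h where "h \<in> L2_space Q"
    "\<And>f. f \<in> L2_space Q \<Longrightarrow> L2_inner Q (kernel_operator K f) g = L2_inner Q f h" by blast
  then show ?case
    by (intro bexI[of _ "\<lambda>x. c * h x"] ballI L2_scale) (simp_all only: L2_inner_scale_right)
next
  case (nonneg u)
  have u[measurable]: "u \<in> borel_measurable S"
    using nonneg(1) borel_measurable_Q by simp
  have "(\<integral>\<^sup>+x. ennreal ((u x)\<^sup>2) \<partial>Q) < \<infinity>"
    using nonneg(3) by (simp add: L2_space_iff)
  then obtain h where
    h[measurable]: "h \<in> borel_measurable S" and h_nonneg: "\<And>x. 0 \<le> h x"
    and h_fin: "(\<integral>\<^sup>+x. ennreal ((h x)\<^sup>2) \<partial>Q) < \<infinity>"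
    and h_eq: "\<And>f. f \<in> borel_measurable S \<Longrightarrow>
      (\<integral>\<^sup>+x. ennreal (h x) * f x \<partial>Q) = (\<integral>\<^sup>+x. ennreal (u x) * (\<integral>\<^sup>+y. f y \<partial>K x) \<partial>Q)"
    by (rule reversed_density[OF u nonneg(2)]) (rule that)
  let ?g = "\<lambda>x. complex_of_real (u x)" and ?h = "\<lambda>x. complex_of_real (h x)"
  have hL2: "?h \<in> L2_space Q"
    using h_fin by (simp add: L2_space_iff borel_measurable_Q)
  have T: "L2_operator Q (kernel_operator K)"
    using kernel_operator_contraction by (simp add: L2_contraction_def)
  have "L2_inner Q (kernel_operator K f) ?g = L2_inner Q f ?h" if "f \<in> L2_space Q" for f
    using that
  proof (induction f rule: L2_nonneg_induct)
    case (add f1 f2)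
    have "L2_inner Q (kernel_operator K (\<lambda>x. f1 x + f2 x)) ?g
        = L2_inner Q (\<lambda>x. kernel_operator K f1 x + kernel_operator K f2 x) ?g"
      using add.hyps nonneg(3) by (intro L2_inner_cong_AE L2_operator_add[OF T] L2_operator_L2[OF T] L2_add)
    then show ?case
      using add nonneg(3) hL2 by (simp add: L2_inner_add_left L2_operator_L2[OF T])
  next
    case (scale f c)
    have "L2_inner Q (kernel_operator K (\<lambda>x. c * f x)) ?g = L2_inner Q (\<lambda>x. c * kernel_operator K f x) ?g"
      using scale.hyps nonneg(3) by (intro L2_inner_cong_AE L2_operator_scale[OF T] L2_operator_L2[OF T] L2_scale)
    then show ?case
      using scale.IH by (simp only: L2_inner_scale_left)
  next
    case (nonneg v)
    have v[measurable]: "v \<in> borel_measurable S"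
      using nonneg(1) borel_measurable_Q by simp
    \<comment> \<open>Off a null set the Bochner integral of v under \<open>K x\<close> therefore
      agrees with the nonnegative one.\<close>
    have int: "AE x in Q. integrable (K x) v"
      using AE_integrable_K[OF nonneg(3)] by (simp add: complex_of_real_integrable_eq)
    have "L2_inner Q (kernel_operator K (\<lambda>x. complex_of_real (v x))) ?g
        = complex_of_real (\<integral>x. u x * (\<integral>y. v y \<partial>K x) \<partial>Q)"
      by (simp add: L2_inner_def kernel_operator_def mult.commute flip: of_real_mult)
    also have "(\<integral>x. u x * (\<integral>y. v y \<partial>K x) \<partial>Q) = enn2real (\<integral>\<^sup>+x. ennreal (u x * (\<integral>y. v y \<partial>K x)) \<partial>Q)"
      using \<open>\<And>x. 0 \<le> u x\<close> nonneg(2) integral_K_measurable[OF v]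
      by (intro integral_eq_nn_integral) (auto simp: borel_measurable_Q)
    also have "(\<integral>\<^sup>+x. ennreal (u x * (\<integral>y. v y \<partial>K x)) \<partial>Q) = (\<integral>\<^sup>+x. ennreal (u x) * (\<integral>\<^sup>+y. ennreal (v y) \<partial>K x) \<partial>Q)"
      using int \<open>\<And>x. 0 \<le> u x\<close> nonneg(2)
      by (intro nn_integral_cong_AE) (auto elim!: eventually_mono simp: ennreal_mult' nn_integral_eq_integral)
    also have "\<dots> = (\<integral>\<^sup>+x. ennreal (h x) * ennreal (v x) \<partial>Q)"
      by (rule h_eq[symmetric]) measurable
    also have "enn2real \<dots> = (\<integral>x. v x * h x \<partial>Q)"
      using nonneg(2) h_nonneg
      by (subst integral_eq_nn_integral) (auto simp: borel_measurable_Q ennreal_mult' mult.commute)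
    also have "complex_of_real \<dots> = L2_inner Q (\<lambda>x. complex_of_real (v x)) ?h"
      by (simp add: L2_inner_def flip: of_real_mult)
    finally show ?case .
  qed
  with hL2 show ?case by blast
qed

lemma pseudo_spectral_gap_nonneg: "0 \<le> pseudo_spectral_gap K Q"
proof -
  let ?T = "kernel_operator K"
  have "L2_contraction Q (L2_adjoint Q ?T)"
    using kernel_operator_contraction kernel_operator_adjoint_exists by (rule L2_adjointI)
  then have "L2_contraction Q ((L2_adjoint Q ?T ^^ k) \<circ> (?T ^^ k))" for k
    using kernel_operator_contraction by (intro L2_contraction_comp L2_contraction_funpow)
  then show ?thesis
    unfolding pseudo_spectral_gap_def Let_def
    by (intro Greatest_ratio_nonneg[where C=2] spectral_gap_contraction)
qed

end

lemma (in ergodic_kernel) invariant_kernel: "invariant_kernel S K Q"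
  by unfold_locales (rule invariant)

section \<open>Selecting among finitely many predictors\<close>

text \<open>Chernoff and union bound at once: where \<open>W v > \<epsilon>\<close>, the selected
  summand \<open>exp (c * (Z k v - \<epsilon>))\<close> alone is at least 1, and the others are
  nonnegative.\<close>

lemma (in prob_space) measure_selection_gt_le:
  fixes Z :: "'i \<Rightarrow> 'a \<Rightarrow> real" and W :: "'a \<Rightarrow> real"
  assumes I: "finite I" and Z[measurable]: "\<And>k. k \<in> I \<Longrightarrow> Z k \<in> borel_measurable M"
    and c: "0 < c" and mgf: "\<And>k. k \<in> I \<Longrightarrow> (\<integral>\<^sup>+v. ennreal (exp (c * Z k v)) \<partial>M) \<le> 2"
    and W: "\<And>v. v \<in> space M \<Longrightarrow> \<exists>k\<in>I. W v = Z k v"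
  shows "measure M {v \<in> space M. W v > \<epsilon>} \<le> 2 * real (card I) * exp (- (c * \<epsilon>))"
proof (cases "{v \<in> space M. W v > \<epsilon>} \<in> sets M")
  \<comment> \<open>A set outside the \<sigma>-algebra has measure 0 by default, so W may be any
    pointwise selection.\<close>
  case False
  then show ?thesis by (simp add: measure_notin_sets)
next
  case True
  have "emeasure M {v \<in> space M. W v > \<epsilon>} = (\<integral>\<^sup>+v. indicator {v \<in> space M. W v > \<epsilon>} v \<partial>M)"
    using True by simp
  also have "\<dots> \<le> (\<integral>\<^sup>+v. (\<Sum>k\<in>I. ennreal (exp (- (c * \<epsilon>))) * ennreal (exp (c * Z k v))) \<partial>M)"
  proof (rule nn_integral_mono)
    fix v assume v: "v \<in> space M"
    obtain k where k: "k \<in> I" "W v = Z k v" using W[OF v] by blast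
    have "indicator {v \<in> space M. W v > \<epsilon>} v \<le> ennreal (exp (- (c * \<epsilon>))) * ennreal (exp (c * Z k v))"
    proof (cases "W v > \<epsilon>")
      case True
      then have "0 \<le> - (c * \<epsilon>) + c * Z k v" using c k by simp
      then have "1 \<le> exp (- (c * \<epsilon>)) * exp (c * Z k v)" by (simp flip: exp_add)
      then show ?thesis using True v by (simp flip: ennreal_mult)
    qed simp
    also have "\<dots> \<le> (\<Sum>k\<in>I. ennreal (exp (- (c * \<epsilon>))) * ennreal (exp (c * Z k v)))"
      using I k by (intro member_le_sum) auto
    finally show "indicator {v \<in> space M. W v > \<epsilon>} v \<le> \<dots>" .
  qed
  also have "\<dots> = (\<Sum>k\<in>I. ennreal (exp (- (c * \<epsilon>))) * (\<integral>\<^sup>+v. ennreal (exp (c * Z k v)) \<partial>M))"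
    by (subst nn_integral_sum) (auto intro!: sum.cong nn_integral_cmult)
  also have "\<dots> \<le> (\<Sum>k\<in>I. ennreal (exp (- (c * \<epsilon>))) * 2)"
    using mgf by (intro sum_mono mult_left_mono) auto
  also have "\<dots> = ennreal (2 * real (card I) * exp (- (c * \<epsilon>)))"
    by (simp add: ennreal_mult ennreal_of_nat_eq_real_of_nat mult_ac)
  finally show ?thesis
    by (simp add: emeasure_eq_measure)
qed

text \<open>Jensen in tangent form: \<open>c * W v\<close> is at most exp (c W) / s + ln s - 1.
  Taking s = 2 card I, the bound on the sum of all exponential moments, makes the first term
  integrate to at most 1.\<close>

lemma (in prob_space) expectation_selection_le:
  fixes Z :: "'i \<Rightarrow> 'a \<Rightarrow> real" and W :: "'a \<Rightarrow> real"
  assumes I: "finite I" "I \<noteq> {}" and Z[measurable]: "\<And>k. k \<in> I \<Longrightarrow> Z k \<in> borel_measurable M"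
    and c: "0 < c" and mgf: "\<And>k. k \<in> I \<Longrightarrow> (\<integral>\<^sup>+v. ennreal (exp (c * Z k v)) \<partial>M) \<le> 2"
    and W: "\<And>v. v \<in> space M \<Longrightarrow> \<exists>k\<in>I. W v = Z k v"
  shows "(\<integral>v. W v \<partial>M) \<le> ln (2 * real (card I)) / c"
proof -
  define s where "s = 2 * real (card I)"
  have card: "card I \<ge> 1" using I by (simp add: Suc_le_eq card_gt_0_iff)
  have s: "s \<ge> 2" using card by (simp add: s_def)
  show ?thesis
  proof (cases "integrable M W")
    \<comment> \<open>The integral is 0 by default, and s \<ge> 2 makes the right side
      nonnegative.\<close>
    case False
    then show ?thesis using c s by (simp add: not_integrable_integral_eq flip: s_def)
  next
    case True
    have int: "integrable M (\<lambda>v. exp (c * Z k v))" if k: "k \<in> I" for k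
    proof -
      have "(\<integral>\<^sup>+v. ennreal (exp (c * Z k v)) \<partial>M) < \<infinity>"
        using mgf[OF k] by (rule le_less_trans) simp
      then show ?thesis using k by (intro integrableI_bounded) auto
    qed
    have int_le: "(\<integral>v. exp (c * Z k v) \<partial>M) \<le> 2" if k: "k \<in> I" for k
    proof -
      have "ennreal (\<integral>v. exp (c * Z k v) \<partial>M) \<le> ennreal 2"
        using mgf[OF k] nn_integral_eq_integral[OF int[OF k]] by simp
      then show ?thesis by (subst (asm) ennreal_le_iff) auto
    qed
    have "c * (\<integral>v. W v \<partial>M) = (\<integral>v. c * W v \<partial>M)" by simp
    also have "\<dots> \<le> (\<integral>v. (\<Sum>k\<in>I. exp (c * Z k v)) / s + (ln s - 1) \<partial>M)"
    proof (rule integral_mono)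
      show "integrable M (\<lambda>v. c * W v)" using True by simp
      show "integrable M (\<lambda>v. (\<Sum>k\<in>I. exp (c * Z k v)) / s + (ln s - 1))"
        using int by (intro Bochner_Integration.integrable_add integrable_divide Bochner_Integration.integrable_sum) auto
      fix v assume v: "v \<in> space M"
      obtain k where k: "k \<in> I" "W v = Z k v" using W[OF v] by blast
      have "1 + (c * W v - ln s) \<le> exp (c * W v - ln s)" by (rule exp_ge_add_one_self)
      also have "\<dots> = exp (c * Z k v) / s" using s k by (simp add: exp_diff)
      also have "\<dots> \<le> (\<Sum>k\<in>I. exp (c * Z k v)) / s"
        using s I k by (intro divide_right_mono member_le_sum) auto
      finally show "c * W v \<le> (\<Sum>k\<in>I. exp (c * Z k v)) / s + (ln s - 1)" by simp
    qed
    also have "\<dots> = (\<Sum>k\<in>I. \<integral>v. exp (c * Z k v) \<partial>M) / s + (ln s - 1)"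
      using int prob_space by simp
    also have "(\<Sum>k\<in>I. \<integral>v. exp (c * Z k v) \<partial>M) / s \<le> (\<Sum>k\<in>I. 2) / s"
      using s int_le by (intro divide_right_mono sum_mono) auto
    also have "(\<Sum>k\<in>I. 2) / s = 1" using s by (simp add: s_def)
    finally have "c * (\<integral>v. W v \<partial>M) \<le> ln s" by simp
    then show ?thesis using c by (simp add: s_def field_simps)
  qed
qed

section \<open>Windows and losses\<close>

lemma window_kernel_measurable:
  fixes \<kappa> :: "(nat \<Rightarrow> 'y::topological_space) \<Rightarrow> 'y measure"
  assumes \<kappa>: "\<kappa> \<in> past_space k \<rightarrow>\<^sub>M prob_algebra borel" and "k \<le> p"
  shows "window_kernel p k \<kappa> \<in> state_space p \<rightarrow>\<^sub>M prob_algebra (state_space p)"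
  unfolding window_kernel_def
proof (rule measurable_distr_prob_space2)
  have "(\<lambda>x. \<lambda>i\<in>{1..k}. x (i - 1)) \<in> (state_space p :: (nat \<Rightarrow> 'y) measure) \<rightarrow>\<^sub>M past_space k"
    using \<open>k \<le> p\<close> by (intro measurable_restrict measurable_component_singleton) auto
  then show "(\<lambda>x. \<kappa> (\<lambda>i\<in>{1..k}. x (i - 1))) \<in> state_space p \<rightarrow>\<^sub>M prob_algebra borel"
    using \<kappa> by (rule measurable_compose)
  have "(\<lambda>w. if i = 0 then snd w else fst w (i - 1)) \<in> (state_space p :: (nat \<Rightarrow> 'y) measure) \<Otimes>\<^sub>M borel \<rightarrow>\<^sub>M borel"
    if "i \<in> {0..p}" for i
  proof (cases "i = 0")
    case False
    then have "(\<lambda>x. x (i - 1)) \<in> (state_space p :: (nat \<Rightarrow> 'y) measure) \<rightarrow>\<^sub>M borel"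
      using that by (intro measurable_component_singleton) auto
    then show ?thesis using False by (simp add: measurable_compose[OF measurable_fst])
  qed simp
  then have "(\<lambda>w. \<lambda>i\<in>{0..p}. if i = 0 then snd w else fst w (i - 1))
      \<in> (state_space p :: (nat \<Rightarrow> 'y) measure) \<Otimes>\<^sub>M borel \<rightarrow>\<^sub>M state_space p"
    by (rule measurable_restrict)
  then show "(\<lambda>(x, z). \<lambda>i\<in>{0..p}. if i = 0 then z else x (i - 1))
      \<in> (state_space p :: (nat \<Rightarrow> 'y) measure) \<Otimes>\<^sub>M borel \<rightarrow>\<^sub>M state_space p"
    by (simp add: case_prod_beta')
qed

lemma window_law_in_prob_algebra:
  fixes Y :: "int \<Rightarrow> 'w \<Rightarrow> 'y::topological_space"
  assumes "prob_space M" and "\<And>t. Y t \<in> borel_measurable M"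
  shows "window_law p M Y \<in> space (prob_algebra (state_space p))"
proof -
  have "(\<lambda>\<omega>. window p (\<lambda>s. Y s \<omega>) 0) \<in> M \<rightarrow>\<^sub>M state_space p"
    unfolding window_def using assms(2) by (intro measurable_restrict)
  then show ?thesis
    using assms(1) by (auto simp: window_law_def space_prob_algebra intro: prob_space.prob_space_distr)
qed

lemma loss_measurable:
  fixes L :: "'y::second_countable_topology \<times> 'y \<Rightarrow> real"
  assumes "loss_function L" and g: "g \<in> prediction_functions p"
  shows "loss p L g \<in> borel_measurable (state_space p)"
proof -
  have L: "L \<in> borel_measurable (borel \<Otimes>\<^sub>M borel)" using assms(1) by (simp add: loss_function_def)
  have "(\<lambda>x. restrict x {1..p}) \<in> (state_space p :: (nat \<Rightarrow> 'y) measure) \<rightarrow>\<^sub>M past_space p"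
    by (rule measurable_restrict_subset) auto
  moreover have "g \<in> past_space p \<rightarrow>\<^sub>M borel" using g by (simp add: prediction_functions_def)
  ultimately have "(\<lambda>x. g (restrict x {1..p})) \<in> state_space p \<rightarrow>\<^sub>M borel"
    by (rule measurable_compose)
  moreover have "(\<lambda>x. x 0) \<in> (state_space p :: (nat \<Rightarrow> 'y) measure) \<rightarrow>\<^sub>M borel"
    by (rule measurable_component_singleton) simp
  ultimately have "(\<lambda>x. (g (restrict x {1..p}), x 0)) \<in> state_space p \<rightarrow>\<^sub>M borel \<Otimes>\<^sub>M borel"
    by (rule measurable_Pair)
  then have "(\<lambda>x. L (g (restrict x {1..p}), x 0)) \<in> borel_measurable (state_space p)"
    using L by (rule measurable_compose)
  then show ?thesis by (simp add: loss_def[abs_def])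
qed

section \<open>Comparison with the claimed rate and prefactor\<close>

lemma tail_weaken:
  fixes c c' E \<epsilon> :: real
  assumes "c' \<le> c" "0 \<le> \<epsilon>" "1 \<le> E"
  shows "2 * real N * exp (- (c * \<epsilon>)) \<le> real N * (1 + 2 * E) * exp (- (c' * \<epsilon>))"
proof -
  have "c' * \<epsilon> \<le> c * \<epsilon>" using assms by (intro mult_right_mono)
  then have "2 * exp (- (c * \<epsilon>)) \<le> (1 + 2 * E) * exp (- (c' * \<epsilon>))"
    using assms by (intro mult_mono) auto
  then have "real N * (2 * exp (- (c * \<epsilon>))) \<le> real N * ((1 + 2 * E) * exp (- (c' * \<epsilon>)))"
    by (rule mult_left_mono) simp
  then show ?thesis by (simp add: mult_ac)
qed

lemma expectation_weaken:
  fixes c c' E :: real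
  assumes "0 < c'" "c' \<le> c" "1 \<le> E" "N \<ge> 1"
  shows "ln (2 * real N) / c \<le> ln (exp 1 * real N * (2 * E + 1)) / c'"
proof (rule frac_le)
  have "2 * real N \<le> real N * (2 * E + 1)"
    using assms mult_left_mono[of 2 "2 * E + 1" "real N"] by (simp add: mult.commute)
  also have "\<dots> \<le> exp 1 * (real N * (2 * E + 1))"
    using assms exp_ge_add_one_self[of 1] mult_right_mono[of 1 "exp 1" "real N * (2 * E + 1)"] by auto
  finally have "2 * real N \<le> exp 1 * real N * (2 * E + 1)" by (simp add: mult_ac)
  then show "ln (2 * real N) \<le> ln (exp 1 * real N * (2 * E + 1))"
    using assms by (subst ln_le_cancel_iff) (auto intro!: mult_pos_pos add_pos_pos)
  have "1 \<le> 2 * real N" using assms by simp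
  then have "1 \<le> exp 1 * real N * (2 * E + 1)"
    using \<open>2 * real N \<le> exp 1 * real N * (2 * E + 1)\<close> by linarith
  then show "0 \<le> ln (exp 1 * real N * (2 * E + 1))" by simp
qed (use assms in auto)

theorem theorem4p2:
  fixes M :: "'w measure"
    and Y :: "int \<Rightarrow> 'w \<Rightarrow> 'y::polish_space"
    and \<kappa> :: "(nat \<Rightarrow> 'y) \<Rightarrow> 'y measure"
    and k\<^sub>0 p n m N ktilde :: nat
    and K :: "(nat \<Rightarrow> 'y) \<Rightarrow> (nat \<Rightarrow> 'y) measure"
    and Q :: "(nat \<Rightarrow> 'y) measure"
    and L Ltilde :: "'y \<times> 'y \<Rightarrow> real"
    and \<G> :: "nat \<Rightarrow> ((nat \<Rightarrow> 'y) \<Rightarrow> 'y) set"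
    and y :: "int \<Rightarrow> 'y"
    and x :: "nat \<Rightarrow> (nat \<Rightarrow> 'y)"
    and ghat :: "nat \<Rightarrow> ((nat \<Rightarrow> 'y) \<Rightarrow> 'y)"
    and khat :: "(nat \<Rightarrow> (nat \<Rightarrow> 'y)) \<Rightarrow> nat"
    and a :: real
  defines "K \<equiv> window_kernel p k\<^sub>0 \<kappa>"
    and "Q \<equiv> window_law p M Y"
    and "tmix \<equiv> real (mixing_time (state_space p) K Q)"
    and "\<gamma>ps \<equiv> pseudo_spectral_gap K Q"
    and "P \<equiv> validation_law (state_space p) K n m (x n)"
    and "\<LL> \<equiv> expected_loss p L Q"
    and "Lhat \<equiv> empirical_loss p L n m"
  assumes chain: "homogeneous_markov_chain M Y k\<^sub>0 \<kappa>"
    and stationary: "stationary_process M Y"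
    and order: "k\<^sub>0 \<le> p"
    and ergodic: "uniformly_ergodic (state_space p) K Q"
    and losses: "loss_function L" "loss_function Ltilde"
    and sizes: "n \<ge> 1" "m \<ge> 1" "N \<ge> 1"
    and models: "\<And>k. k \<in> {1..N} \<Longrightarrow> \<G> k \<subseteq> prediction_functions p"
    and realization: "\<And>t. t \<in> {1..n} \<Longrightarrow> x t = window p y (int t)"
    and estimators: "\<And>k. k \<in> {1..N} \<Longrightarrow>
      is_arg_min (\<lambda>g. \<Sum>t=1..n. loss p Ltilde g (x t)) (\<lambda>g. g \<in> \<G> k) (ghat k)"
    and best_choice: "is_arg_min (\<lambda>k. \<LL> (ghat k)) (\<lambda>k. k \<in> {1..N}) ktilde"
    and khat_measurable:
      "khat \<in> PiM {n+1..n+m} (\<lambda>_. state_space p) \<rightarrow>\<^sub>M count_space UNIV"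
    and empirical_choice: "\<And>v. v \<in> space (PiM {n+1..n+m} (\<lambda>_. state_space p)) \<Longrightarrow>
      is_arg_min (\<lambda>k. Lhat v (ghat k)) (\<lambda>k. k \<in> {1..N}) (khat v)"
    and a: "0 < a" "a < 1"
  shows
    "(\<forall>\<epsilon>. 0 \<le> \<epsilon> \<and> \<epsilon> \<le> 1 \<longrightarrow>
        measure P {v \<in> space P. 1 / (1 + a) * Lhat v (ghat ktilde) - \<LL> (ghat ktilde) > \<epsilon>}
          \<le> real N * (1 + 2 * exp (ln 2 / tmix))
              * exp (- (a * (1 + a) * real m * \<epsilon> / (4 * tmix * (8 * (1 + 1 / \<gamma>ps) + 20)))))
     \<and> (\<forall>\<epsilon>. 0 \<le> \<epsilon> \<and> \<epsilon> \<le> 1 \<longrightarrow>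
        measure P {v \<in> space P. \<LL> (ghat (khat v)) - 1 / (1 - a) * Lhat v (ghat (khat v)) > \<epsilon>}
          \<le> real N * (1 + 2 * exp (ln 2 / tmix))
              * exp (- (a * (1 - a) * real m * \<epsilon> / (4 * tmix * (8 * (1 + 1 / \<gamma>ps) + 20)))))
     \<and> (\<integral>v. (1 / (1 + a) * Lhat v (ghat ktilde) - \<LL> (ghat ktilde)) \<partial>P)
          \<le> 4 * tmix * (8 * (1 + 1 / \<gamma>ps) + 20)
              * ln (exp 1 * real N * (2 * exp (ln 2 / tmix) + 1)) / (a * (1 + a) * real m)
     \<and> (\<integral>v. (\<LL> (ghat (khat v)) - 1 / (1 - a) * Lhat v (ghat (khat v))) \<partial>P)
          \<le> 4 * tmix * (8 * (1 + 1 / \<gamma>ps) + 20)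
              * ln (exp 1 * real N * (2 * exp (ln 2 / tmix) + 1)) / (a * (1 - a) * real m)"
proof -
  let ?S = "state_space p :: (nat \<Rightarrow> 'y) measure"
  interpret ergodic_kernel ?S K Q
  proof
    show "K \<in> ?S \<rightarrow>\<^sub>M prob_algebra ?S"
      unfolding K_def using chain order
      by (intro window_kernel_measurable) (auto simp: homogeneous_markov_chain_def)
    show "Q \<in> space (prob_algebra ?S)"
      unfolding Q_def using chain by (intro window_law_in_prob_algebra) (auto simp: homogeneous_markov_chain_def)
  qed (rule ergodic)
  interpret invariant_kernel ?S K Q by (rule invariant_kernel)
  have gap: "0 \<le> \<gamma>ps" unfolding \<gamma>ps_def by (rule pseudo_spectral_gap_nonneg)
  have t: "1 \<le> tmix" unfolding tmix_def using mixing_time_ge_1 by simp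
  define B where "B = 8 * (1 + 1 / \<gamma>ps) + 20"
  define E where "E = exp (ln 2 / tmix)"
  \<comment> \<open>\<open>Z1\<close> and \<open>Z2\<close> below carry the factors 1 / (1 + a) and
    1 / (1 - a), which cancel against those in the rates of the two moment bounds; hence one c
    serves both tails.\<close>
  define c where "c = a * real m / (4 * tmix)"
  have B: "B \<ge> 28" using gap by (simp add: B_def)
  have E: "E \<ge> 1" using t by (simp add: E_def)
  have m: "real m > 0" using sizes by simp
  have c: "0 < c" using a m t by (simp add: c_def)
  have xn: "x n \<in> space ?S"
    using realization[of n] sizes by (simp add: window_def space_PiM)
  interpret P: prob_space P
    unfolding P_def using xn by (rule prob_space_validation_law)
  have sets_P: "sets P = sets (PiM {n+1..n+m} (\<lambda>_. ?S))"
    by (simp add: P_def)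
  have space_P: "space P = space (PiM {n+1..n+m} (\<lambda>_. ?S))"
    using sets_P by (rule sets_eq_imp_space_eq)
  have f: "loss p L (ghat k) \<in> unit_functions" if "k \<in> {1..N}" for k
  proof -
    have "ghat k \<in> prediction_functions p"
      using estimators[OF that] models[OF that] by (auto simp: is_arg_min_def)
    then show ?thesis
      using loss_measurable[OF losses(1)] losses(1)
      by (auto simp: unit_functions_def loss_function_def loss_def image_subset_iff)
  qed
  have Lhat_measurable: "(\<lambda>v. Lhat v (ghat k)) \<in> borel_measurable P" if "k \<in> {1..N}" for k
  proof -
    have "(\<lambda>v. loss p L (ghat k) (v j)) \<in> borel_measurable (PiM {n+1..n+m} (\<lambda>_. ?S))" if "j \<in> {n+1..n+m}" for j
      using measurable_component_singleton[OF that] unit_functions_measurable[OF f[OF \<open>k \<in> {1..N}\<close>]]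
      by (rule measurable_compose)
    then have "(\<lambda>v. Lhat v (ghat k)) \<in> borel_measurable (PiM {n+1..n+m} (\<lambda>_. ?S))"
      unfolding Lhat_def empirical_loss_def by (intro borel_measurable_times borel_measurable_const borel_measurable_sum)
    then show ?thesis
      using measurable_cong_sets[OF sets_P refl] by blast
  qed
  have ktilde: "ktilde \<in> {1..N}"
    using best_choice by (simp add: is_arg_min_def)
  have khat: "khat v \<in> {1..N}" if "v \<in> space P" for v
    using empirical_choice[of v] that by (simp add: space_P is_arg_min_def)
  define Z1 where "Z1 k v = 1 / (1 + a) * Lhat v (ghat k) - \<LL> (ghat k)" for k v
  define Z2 where "Z2 k v = \<LL> (ghat k) - 1 / (1 - a) * Lhat v (ghat k)" for k v
  have Z1_measurable: "Z1 k \<in> borel_measurable P" and Z2_measurable: "Z2 k \<in> borel_measurable P"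
    if "k \<in> {1..N}" for k
    unfolding Z1_def Z2_def using Lhat_measurable[OF that] by measurable
  have Lhat_sum: "real m * Lhat v g = (\<Sum>j\<in>{n+1..n+m}. loss p L g (v j))" for v g
    using m by (simp add: Lhat_def empirical_loss_def)
  have mgf1: "(\<integral>\<^sup>+v. ennreal (exp (c * Z1 k v)) \<partial>P) \<le> 2" if k: "k \<in> {1..N}" for k
  proof -
    have "c * Z1 k v = (\<Sum>j\<in>{n+1..n+m}. a / (4 * tmix * (1 + a)) * (loss p L (ghat k) (v j) - (1 + a) * \<LL> (ghat k)))" for v
    proof -
      have "c * Z1 k v = a / (4 * tmix * (1 + a)) * (real m * Lhat v (ghat k) - real m * ((1 + a) * \<LL> (ghat k)))"
        using a t unfolding c_def Z1_def by (simp add: field_simps)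
      then show ?thesis
        unfolding Lhat_sum by (subst sum_distrib_left[symmetric]) (simp add: sum_subtractf)
    qed
    then show ?thesis
      using nn_integral_exp_upper[OF f[OF k] xn a, of n m]
      by (simp add: P_def tmix_def \<LL>_def expected_loss_def)
  qed
  have mgf2: "(\<integral>\<^sup>+v. ennreal (exp (c * Z2 k v)) \<partial>P) \<le> 2" if k: "k \<in> {1..N}" for k
  proof -
    have "c * Z2 k v = (\<Sum>j\<in>{n+1..n+m}. a / (4 * tmix * (1 - a)) * ((1 - a) * \<LL> (ghat k) - loss p L (ghat k) (v j)))" for v
    proof -
      have "c * Z2 k v = a / (4 * tmix * (1 - a)) * (real m * ((1 - a) * \<LL> (ghat k)) - real m * Lhat v (ghat k))"
        using a t unfolding c_def Z2_def by (simp add: field_simps)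
      then show ?thesis
        unfolding Lhat_sum by (subst sum_distrib_left[symmetric]) (simp add: sum_subtractf)
    qed
    then show ?thesis
      using nn_integral_exp_lower[OF f[OF k] xn a, of n m]
      by (simp add: P_def tmix_def \<LL>_def expected_loss_def)
  qed
  \<comment> \<open>The claimed rate is c * b / B with b = 1 + a or 1 - a, so b \<le> 2 and B \<ge>
    28 place it below c.\<close>
  have rate: "0 < a * b * real m / (4 * tmix * B)" "a * b * real m / (4 * tmix * B) \<le> c"
    if b: "0 < b" "b \<le> 2" for b
  proof -
    show "0 < a * b * real m / (4 * tmix * B)" using a b m t B by simp
    have "b / B \<le> 1" using b B by simp
    then have "c * (b / B) \<le> c" using c by (intro mult_left_le) auto
    then show "a * b * real m / (4 * tmix * B) \<le> c" by (simp add: c_def mult_ac)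
  qed
  \<comment> \<open>W stands for either selection: \<open>Z1 ktilde\<close>, where the index is
    constant, or \<open>Z2 (khat v) v\<close>, where it varies with the validation set.\<close>
  have tail: "measure P {v \<in> space P. W v > \<epsilon>} \<le> real N * (1 + 2 * E) * exp (- (a * b * real m * \<epsilon> / (4 * tmix * B)))"
    and expectation: "(\<integral>v. W v \<partial>P) \<le> 4 * tmix * B * ln (exp 1 * real N * (2 * E + 1)) / (a * b * real m)"
    if Z: "\<And>k. k \<in> {1..N} \<Longrightarrow> Z k \<in> borel_measurable P"
      and mgf: "\<And>k. k \<in> {1..N} \<Longrightarrow> (\<integral>\<^sup>+v. ennreal (exp (c * Z k v)) \<partial>P) \<le> 2"
      and W: "\<And>v. v \<in> space P \<Longrightarrow> \<exists>k\<in>{1..N}. W v = Z k v"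
      and b: "0 < b" "b \<le> 2" and \<epsilon>: "0 \<le> \<epsilon>" for Z W b \<epsilon>
  proof -
    have "measure P {v \<in> space P. W v > \<epsilon>} \<le> 2 * real N * exp (- (c * \<epsilon>))"
      using P.measure_selection_gt_le[where I="{1..N}" and Z=Z and W=W and \<epsilon>=\<epsilon>, OF _ Z c mgf W] by simp
    also have "\<dots> \<le> real N * (1 + 2 * E) * exp (- (a * b * real m / (4 * tmix * B) * \<epsilon>))"
      using rate(2)[OF b] \<epsilon> E by (rule tail_weaken)
    finally show "measure P {v \<in> space P. W v > \<epsilon>} \<le> real N * (1 + 2 * E) * exp (- (a * b * real m * \<epsilon> / (4 * tmix * B)))"
      by simp
    have "(\<integral>v. W v \<partial>P) \<le> ln (2 * real N) / c"
      using P.expectation_selection_le[where I="{1..N}" and Z=Z and W=W, OF _ _ Z c mgf W] sizes by simp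
    also have "\<dots> \<le> ln (exp 1 * real N * (2 * E + 1)) / (a * b * real m / (4 * tmix * B))"
      using rate[OF b] E sizes(3) by (rule expectation_weaken)
    finally show "(\<integral>v. W v \<partial>P) \<le> 4 * tmix * B * ln (exp 1 * real N * (2 * E + 1)) / (a * b * real m)"
      by (simp add: mult_ac)
  qed
  have W1: "\<exists>k\<in>{1..N}. Z1 ktilde v = Z1 k v" for v
    using ktilde by blast
  have W2: "\<exists>k\<in>{1..N}. Z2 (khat v) v = Z2 k v" if "v \<in> space P" for v
    using khat[OF that] by blast
  \<comment> \<open>The argument 0 fills the \<epsilon> that \<open>expectation\<close> inherits
    from the statement shared with \<open>tail\<close>.\<close>
  show ?thesis
    using tail[OF Z1_measurable mgf1 W1, of "1 + a"] tail[OF Z2_measurable mgf2 W2, of "1 - a"]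
      expectation[OF Z1_measurable mgf1 W1, of "1 + a" 0] expectation[OF Z2_measurable mgf2 W2, of "1 - a" 0] a
    unfolding Z1_def Z2_def B_def E_def by simp
qed

end
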